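(* Let $Q$ be a quadrangulation and let $s$ be a bridge in $Q$. Let $Q_1$ (resp. $Q_2$) be the quadrangulation obtained from $Q$ by removing all squares from one side of $s$ (resp. from the other side), so that both $Q_1$ and $Q_2$ contain $s$. Then the directed graph $\Gamma_Q$ is (isomorphic to) the direct product of the directed graphs $\Gamma_{Q_1}$ and $\Gamma_{Q_2}$.
   Context: Quadrangulations. Consider a regular polygon with $2n+2$ vertices ($n\ge 1$), numbered $0,\dots,2n+1$ clockwise (indices mod $2n+2$). A quadrangulation is a set of pairwise noncrossing diagonals cutting the polygon into quadrilaterals; there are then $n$ quadrilaterals, called squares, and $n-1$ diagonals, called inner edges. The $2n+2$ sides of the polygon are the boundary edges. Two squares are neighbours if they share an inner edge. Vertices are coloured alternately black and white; an edge (boundary or inner) always joins a white and a black vertex and is oriented from white to black. Compatibility. Fix a quadrangulation $Q$, drawn in a "blue" polygon with vertices $b_0,\dots,b_{2n+1}$. Let the "red" polygon, with vertices $r_0,\dots,r_{2n+1}$, be the blue one rotated clockwise by the angle $2\pi/(4n+4)$, so that the clockwise order on the circle is $b_0,r_0,b_1,r_1,\dots,b_{2n+1},r_{2n+1}$; $r_i$ has the same colour as $b_i$. A red edge is compatible with a blue edge if either they do not cross, or they cross and the pair (direction of the red edge, direction of the blue edge) is a positively oriented basis of the plane. A red edge is $Q$-compatible if it is compatible with all edges of $Q$. A $Q$-compatible quadrangulation is a quadrangulation $Q'$ of the red polygon all of whose edges are $Q$-compatible. (None of this depends on which of the two alternating colourings is chosen.) Flips. For a $Q$-compatible quadrangulation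 $Q'$ and an inner edge $i$ of $Q'$, there is exactly one other inner edge $j$ such that $(Q'\setminus\{i\})\cup\{j\}$ is a $Q$-compatible quadrangulation; replacing $i$ by $j$ is a flip. The flip takes place in the hexagon $H$ formed by the two squares of $Q'$ adjacent to $i$. There is always an inner edge of $Q$ (a long inner edge) that crosses two opposite sides of $H$, entering (for its white-to-black orientation) through one and leaving through the opposite one; all long inner edges enter through the same side and leave through the same side. Of the two $Q$-compatible diagonals of $H$, one, called (id), has its white endpoint on the side through which long inner edges enter $H$, and the other, called (op), has its white endpoint on the side through which they leave $H$. The flip is oriented from the quadrangulation containing (id) to the quadrangulation containing (op). $\Gamma_Q$ is the directed graph whose vertices are the $Q$-compatible quadrangulations and whose arrows are the oriented flips. Bridges. A square $s$ of $Q$ is a bridge if it has exactly two neighbour squares and these are attached to opposite edges of $s$. Equivalently to the description in the claim, $Q_1$ and $Q_2$ are obtained by cutting $Q$ along one, respectively the other, of the two inner edges of $s$ and keeping the part that contains $s$; each is regarded as a quadrangulation of a smaller polygon. The direct product of directed graphs is here the Cartesian product: vertices are pairs $(u,v)$, with arrows $(u,v)\to(u',v)$ for each arrow $u\to u'$ of the first graph and $(u,v)\to(u,v')$ for each arrow $v\to v'$ of the second. *)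

theory Defs
  imports
    "HOL-Analysis.Analysis"
    "Graph_Theory.Pair_Digraph"
    "Graph_Theory.Digraph_Isomorphism"
begin

section \<open>Inscribed polygons\<close>

text \<open>
  Vertices are natural numbers, ordered clockwise around a circle. A convex polygon with vertices
  on the circle is given by its set of vertices, and an edge or diagonal by the set of its two ends.
\<close>

definition verts_of :: "nat \<Rightarrow> nat set" where
  "verts_of n = {..<2 * n + 2}"

text \<open>The clockwise successor of \<open>v\<close> among the vertices of the polygon \<open>C\<close>.\<close>

definition nxt :: "nat set \<Rightarrow> nat \<Rightarrow> nat" where
  "nxt C v = (if \<exists>u\<in>C. v < u then Min {u \<in> C. v < u} else Min C)"

definition sides :: "nat set \<Rightarrow> nat set set" where
  "sides C = {{v, nxt C v} | v. v \<in> C}"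

text \<open>Opposite sides of a polygon with an even number of vertices (a square or a hexagon).\<close>

definition opposite_sides :: "nat set \<Rightarrow> nat set \<Rightarrow> nat set \<Rightarrow> bool" where
  "opposite_sides C \<sigma> \<tau> \<longleftrightarrow> \<sigma> \<in> sides C \<and> \<tau> = (nxt C ^^ (card C div 2)) ` \<sigma>"

text \<open>
  The blue regular polygon and the red one, which is the blue one rotated clockwise by the angle
  \<open>2\<pi> / (4n + 4)\<close>. The plane is the complex plane with its usual orientation.
\<close>

definition blue :: "nat \<Rightarrow> nat \<Rightarrow> complex" where
  "blue n k = cis (- (2 * pi * real k / real (2 * n + 2)))"

definition red :: "nat \<Rightarrow> nat \<Rightarrow> complex" where
  "red n k = cis (- (2 * pi / real (4 * n + 4))) * blue n k"

text \<open>The interior of the segment joining the two ends of \<open>e\<close>, for a placement \<open>p\<close> of the vertices.\<close>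

definition chord :: "(nat \<Rightarrow> complex) \<Rightarrow> nat set \<Rightarrow> complex set" where
  "chord p e = open_segment (p (Min e)) (p (Max e))"


section \<open>Quadrangulations\<close>

definition diagonals :: "nat \<Rightarrow> nat set set" where
  "diagonals n = {e. e \<subseteq> verts_of n \<and> card e = 2} - sides (verts_of n)"

definition edges :: "nat \<Rightarrow> nat set set \<Rightarrow> nat set set" where
  "edges n D = D \<union> sides (verts_of n)"

text \<open>
  The pieces into which pairwise noncrossing diagonals \<open>D\<close> cut the polygon, each given by its set of
  vertices. They are the polygons all of whose sides are edges and none of whose diagonals is an
  edge: since \<open>D\<close> is noncrossing, a member of \<open>D\<close> that meets the interior of a polygon bounded by
  edges is a diagonal of that polygon.
\<close>

definition pieces :: "nat \<Rightarrow> nat set set \<Rightarrow> nat set set" where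
  "pieces n D = {C. C \<subseteq> verts_of n \<and> 3 \<le> card C \<and>
     (\<forall>i\<in>C. \<forall>j\<in>C. i \<noteq> j \<longrightarrow> ({i, j} \<in> edges n D \<longleftrightarrow> {i, j} \<in> sides C))}"

text \<open>
  A quadrangulation is given by its set of inner edges; its squares are its pieces. Whether diagonals
  cross does not change under rotation, so the same notion serves for the red polygon.
\<close>

definition quadrangulation :: "nat \<Rightarrow> nat set set \<Rightarrow> bool" where
  "quadrangulation n D \<longleftrightarrow> D \<subseteq> diagonals n \<and>
     pairwise (\<lambda>e f. chord (blue n) e \<inter> chord (blue n) f = {}) D \<and>
     (\<forall>C \<in> pieces n D. card C = 4)"

text \<open>The white vertices are the even ones.\<close>

definition white_end :: "nat set \<Rightarrow> nat" where
  "white_end e = (THE v. v \<in> e \<and> even v)"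

definition black_end :: "nat set \<Rightarrow> nat" where
  "black_end e = (THE v. v \<in> e \<and> odd v)"

definition direction :: "(nat \<Rightarrow> complex) \<Rightarrow> nat set \<Rightarrow> complex" where
  "direction p e = p (black_end e) - p (white_end e)"


section \<open>Compatibility\<close>

text \<open>\<open>Im (cnj u * v)\<close> is the determinant of \<open>(u, v)\<close>.\<close>

definition positive_basis :: "complex \<Rightarrow> complex \<Rightarrow> bool" where
  "positive_basis u v \<longleftrightarrow> 0 < Im (cnj u * v)"

text \<open>The red edge \<open>e\<close> is compatible with the blue edge \<open>f\<close>.\<close>

definition compatible :: "nat \<Rightarrow> nat set \<Rightarrow> nat set \<Rightarrow> bool" where
  "compatible n e f \<longleftrightarrow> chord (red n) e \<inter> chord (blue n) f = {} \<or>
     positive_basis (direction (red n) e) (direction (blue n) f)"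

definition compatible_quadrangulations :: "nat \<Rightarrow> nat set set \<Rightarrow> nat set set set" where
  "compatible_quadrangulations n Q =
     {Q'. quadrangulation n Q' \<and> (\<forall>e \<in> edges n Q'. \<forall>f \<in> edges n Q. compatible n e f)}"


section \<open>Flips\<close>

text \<open>
  \<open>f\<close> is an inner edge of \<open>Q\<close> that, for its orientation from white to black, enters the red hexagon
  \<open>H\<close> through \<open>\<sigma>\<close> and leaves it through the opposite side \<open>\<tau>\<close>. As the ends of \<open>f\<close> lie outside of
  \<open>H\<close>, the side it enters through is the one that it meets first.
\<close>

definition long_inner_edge ::
  "nat \<Rightarrow> nat set set \<Rightarrow> nat set \<Rightarrow> nat set \<Rightarrow> nat set \<Rightarrow> nat set \<Rightarrow> bool" where
  "long_inner_edge n Q H \<sigma> \<tau> f \<longleftrightarrow> f \<in> Q \<and> opposite_sides H \<sigma> \<tau> \<and>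
     (\<exists>s t. 0 < s \<and> s < t \<and> t < 1 \<and>
        linepath (blue n (white_end f)) (blue n (black_end f)) s \<in> chord (red n) \<sigma> \<and>
        linepath (blue n (white_end f)) (blue n (black_end f)) t \<in> chord (red n) \<tau>)"

text \<open>
  The oriented flip from \<open>Q'\<close> to \<open>Q''\<close> replaces the diagonal \<open>i\<close> of \<open>H\<close> of kind (id) by the
  diagonal \<open>j\<close> of kind (op).
\<close>

definition flip :: "nat \<Rightarrow> nat set set \<Rightarrow> nat set set \<Rightarrow> nat set set \<Rightarrow> bool" where
  "flip n Q Q' Q'' \<longleftrightarrow>
     Q' \<in> compatible_quadrangulations n Q \<and> Q'' \<in> compatible_quadrangulations n Q \<and>
     (\<exists>i j S T H \<sigma> \<tau> f. i \<in> Q' \<and> j \<notin> Q' \<and> Q'' = insert j (Q' - {i}) \<and>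
        S \<in> pieces n Q' \<and> T \<in> pieces n Q' \<and> S \<noteq> T \<and> i \<subseteq> S \<and> i \<subseteq> T \<and> H = S \<union> T \<and>
        long_inner_edge n Q H \<sigma> \<tau> f \<and> white_end i \<in> \<sigma> \<and> white_end j \<in> \<tau>)"

definition flip_graph :: "nat \<Rightarrow> nat set set \<Rightarrow> nat set set pair_pre_digraph" where
  "flip_graph n Q = \<lparr> pverts = compatible_quadrangulations n Q,
                      parcs = {(Q', Q''). flip n Q Q' Q''} \<rparr>"

definition cartesian_product ::
  "'a pair_pre_digraph \<Rightarrow> 'b pair_pre_digraph \<Rightarrow> ('a \<times> 'b) pair_pre_digraph" where
  "cartesian_product G H = \<lparr> pverts = pverts G \<times> pverts H,
     parcs = {((u, v), (u', v)) | u u' v. (u, u') \<in> parcs G \<and> v \<in> pverts H} \<union>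
             {((u, v), (u, v')) | u v v'. u \<in> pverts G \<and> (v, v') \<in> parcs H} \<rparr>"


section \<open>Bridges\<close>

definition neighbours :: "nat \<Rightarrow> nat set set \<Rightarrow> nat set \<Rightarrow> nat set set" where
  "neighbours n Q s = {t \<in> pieces n Q. t \<noteq> s \<and> (\<exists>e\<in>Q. e \<subseteq> s \<and> e \<subseteq> t)}"

definition bridge :: "nat \<Rightarrow> nat set set \<Rightarrow> nat set \<Rightarrow> bool" where
  "bridge n Q s \<longleftrightarrow> s \<in> pieces n Q \<and>
     (\<exists>t\<^sub>1 t\<^sub>2 e\<^sub>1 e\<^sub>2. neighbours n Q s = {t\<^sub>1, t\<^sub>2} \<and> t\<^sub>1 \<noteq> t\<^sub>2 \<and> opposite_sides s e\<^sub>1 e\<^sub>2 \<and>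
        e\<^sub>1 \<in> Q \<and> e\<^sub>1 \<subseteq> t\<^sub>1 \<and> e\<^sub>2 \<in> Q \<and> e\<^sub>2 \<subseteq> t\<^sub>2)"

text \<open>The vertices of the part that contains \<open>s\<close> when the polygon is cut along \<open>e\<close>, a side of \<open>s\<close>.\<close>

definition kept_verts :: "nat \<Rightarrow> nat set \<Rightarrow> nat set \<Rightarrow> nat set" where
  "kept_verts n s e = (if s \<subseteq> {Min e..Max e} then {Min e..Max e}
                       else verts_of n - {Min e<..<Max e})"

text \<open>
  That part as a quadrangulation of a polygon of its own, with \<open>2m + 2\<close> vertices for
  \<open>m = kept_size n s e\<close>: its vertices are renumbered from 0 in clockwise order, and \<open>e\<close> becomes a
  boundary edge. The renumbering preserves the alternating colouring or interchanges its two colours.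
\<close>

definition kept_size :: "nat \<Rightarrow> nat set \<Rightarrow> nat set \<Rightarrow> nat" where
  "kept_size n s e = card (kept_verts n s e) div 2 - 1"

definition renumber :: "nat set \<Rightarrow> nat \<Rightarrow> nat" where
  "renumber V v = card {u \<in> V. u < v}"

definition kept_part :: "nat \<Rightarrow> nat set set \<Rightarrow> nat set \<Rightarrow> nat set \<Rightarrow> nat set set" where
  "kept_part n Q s e =
     (\<lambda>f. renumber (kept_verts n s e) ` f) ` {f \<in> Q. f \<subseteq> kept_verts n s e \<and> f \<noteq> e}"

end

theory Submission
  imports Defs
begin

text \<open>
  Let \<open>p\<close>, \<open>p'\<close>, \<open>q\<close>, \<open>q'\<close> be the vertices of the bridge in clockwise order, where \<open>{p, p'}\<close> and
  \<open>{q, q'}\<close> are boundary edges and \<open>{p', q}\<close> and \<open>{q', p}\<close> inner edges. As the colours alternate, \<open>p'\<close>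
  and \<open>q'\<close> have the same colour, so that the two inner edges of the bridge are antiparallel. Hence a red
  edge cannot cross both of them compatibly: each edge of a compatible quadrangulation \<open>D\<close> has both ends
  on the arc from \<open>p\<close> to \<open>q\<close> or both on the arc from \<open>q\<close> to \<open>p\<close> (\<open>red_split\<close>), and \<open>D\<close> is the disjoint
  union of its parts on these arcs.

  The red vertices \<open>p\<close> and \<open>q\<close> have the same colour and no edge of \<open>D\<close> separates them, so they are
  opposite corners of a square \<open>{p, a, q, b}\<close> of \<open>D\<close> (\<open>middle_square\<close>). Cutting off the squares of \<open>Q\<close>
  on one side of the bridge contracts the vertices strictly between \<open>q\<close> and \<open>p\<close> to the single vertex
  \<open>q'\<close>. The part of \<open>D\<close> on the arc from \<open>p\<close> to \<open>q\<close> then still has only squares, the middle one being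
  \<open>{p, a, q, q'}\<close>; conversely two such parts fit together along their middle squares. This is the bijection
  on the vertices of the graphs (\<open>restrict\<close>, \<open>join\<close>).

  Every blue edge that can serve as a long inner edge has both ends on the arc from \<open>p'\<close> to \<open>q\<close> or both on
  the arc from \<open>q'\<close> to \<open>p\<close>, and crosses no red edge on the other side. A flip thus takes place in a hexagon
  of which four vertices, namely the ends of the two exchanged diagonals, are on the same side. A remaining
  vertex of the hexagon that is not on that side is a neighbour of both \<open>p\<close> and \<open>q\<close>, and it does not matter
  which one (\<open>turn_transfer\<close>). So a flip changes one part only and is a flip of that part (\<open>flip_split\<close>).

  All of this depends only on the cyclic order of the vertices. With red vertices just after the blue ones
  of the same number, a red edge \<open>{a, b}\<close> that crosses a blue edge \<open>{c, d}\<close>, with \<open>a\<close>, \<open>c\<close>, \<open>b\<close>, \<open>d\<close> in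
  clockwise order, is compatible with it iff \<open>a\<close> and \<open>c\<close> have different colours (\<open>compatible_iff\<close>). An
  oriented flip replaces the diagonal \<open>{b, e}\<close> of a hexagon \<open>a, b, c, d, e, f\<close> by \<open>{a, d}\<close>, where some blue
  edge crosses \<open>{a, b}\<close> and \<open>{d, e}\<close> (\<open>flip_graph_eq\<close>). Neither description says which colour is
  white, so both survive a renumbering of the vertices that interchanges the colours.
\<close>

section \<open>The cyclic order of the vertices\<close>

text \<open>
  Relations between a few vertices in cyclic order are proved below by expanding \<open>cyc\<close>, which leaves linear
  arithmetic.
\<close>

declare [[smt_nat_as_int]]

text \<open>
  \<open>a\<close>, \<open>b\<close>, \<open>c\<close> are distinct and are met in this order when going clockwise.
\<close>

definition cyc :: "nat \<Rightarrow> nat \<Rightarrow> nat \<Rightarrow> bool" where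
  "cyc a b c \<longleftrightarrow> a < b \<and> b < c \<or> b < c \<and> c < a \<or> c < a \<and> a < b"

lemma cyc_rotate: "cyc a b c \<Longrightarrow> cyc b c a"
  unfolding cyc_def by (smt (verit))

lemma cyc_total: "a \<noteq> b \<Longrightarrow> b \<noteq> c \<Longrightarrow> a \<noteq> c \<Longrightarrow> cyc a b c \<or> cyc a c b"
  unfolding cyc_def by (smt (verit))

lemma cyc_trans: "cyc a b c \<Longrightarrow> cyc a c d \<Longrightarrow> cyc a b d"
  unfolding cyc_def by (smt (verit))

lemma cyc_distinct: "cyc a b c \<Longrightarrow> a \<noteq> b \<and> b \<noteq> c \<and> a \<noteq> c"
  unfolding cyc_def by (smt (verit))

lemma finite_minimal:
  assumes "finite C" "C \<noteq> {}" and irrefl: "\<And>x. \<not> R x x"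
    and trans: "\<And>x y z. R x y \<Longrightarrow> R y z \<Longrightarrow> R x z"
  shows "\<exists>v\<in>C. \<forall>w\<in>C. \<not> R w v"
  using assms(1,2)
proof (induction C rule: finite_ne_induct)
  case (singleton x)
  then show ?case using irrefl by blast
next
  case (insert x C)
  then obtain v where v: "v \<in> C" "\<forall>w\<in>C. \<not> R w v" by blast
  show ?case
  proof (cases "R x v")
    case True
    then have "\<forall>w\<in>insert x C. \<not> R w x" using v(2) irrefl trans by blast
    then show ?thesis by blast
  next
    case False
    then show ?thesis using v by blast
  qed
qed

lemma cyc_nearest:
  assumes "finite C" "C \<noteq> {}"
  obtains v where "v \<in> C" "\<forall>w\<in>C. \<not> cyc u w v"
proof -
  have "\<exists>v\<in>C. \<forall>w\<in>C. \<not> cyc u w v"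
    by (rule finite_minimal[OF assms]) (auto dest: cyc_distinct cyc_trans)
  with that show thesis by blast
qed

lemma cyc_farthest:
  assumes "finite C" "C \<noteq> {}"
  obtains v where "v \<in> C" "\<forall>w\<in>C. \<not> cyc u v w"
proof -
  have "\<exists>v\<in>C. \<forall>w\<in>C. \<not> cyc u v w"
    by (rule finite_minimal[OF assms]) (auto dest: cyc_distinct cyc_trans)
  with that show thesis by blast
qed

lemma nxt_works:
  assumes "finite C" "v \<in> C" "u \<in> C" "u \<noteq> v"
  shows "nxt C v \<in> C" "nxt C v \<noteq> v" "\<And>w. w \<in> C \<Longrightarrow> \<not> cyc v w (nxt C v)"
proof -
  let ?U = "{u \<in> C. v < u}"
  have "nxt C v \<in> C \<and> nxt C v \<noteq> v \<and> (\<forall>w\<in>C. \<not> cyc v w (nxt C v))"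
  proof (cases "?U = {}")
    case False
    then have "nxt C v = Min ?U" unfolding nxt_def by auto
    moreover have "Min ?U \<in> ?U" using False assms by (intro Min_in) auto
    moreover have "\<And>w. w \<in> ?U \<Longrightarrow> Min ?U \<le> w" using assms by auto
    ultimately show ?thesis by (fastforce simp: cyc_def)
  next
    case True
    then have "nxt C v = Min C" unfolding nxt_def by auto
    moreover have "Min C \<in> C" using assms by (intro Min_in) auto
    moreover have "\<And>w. w \<in> C \<Longrightarrow> Min C \<le> w \<and> w \<le> v" using assms True by force
    moreover have "u < v" using True assms by force
    ultimately show ?thesis using assms(3) by (fastforce simp: cyc_def)
  qed
  then show "nxt C v \<in> C" "nxt C v \<noteq> v" "\<And>w. w \<in> C \<Longrightarrow> \<not> cyc v w (nxt C v)" by auto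
qed

lemma nxt_eqI:
  assumes "finite C" "v \<in> C" "u \<in> C" "u \<noteq> v" "\<forall>w\<in>C. \<not> cyc v w u"
  shows "nxt C v = u"
proof (rule ccontr)
  note nx = nxt_works[OF assms(1-4)]
  assume "nxt C v \<noteq> u"
  then have "cyc v u (nxt C v) \<or> cyc v (nxt C v) u"
    using cyc_total[of v u "nxt C v"] nx(2) assms(4) by auto
  then show False using nx(3)[OF assms(3)] bspec[OF assms(5) nx(1)] by simp
qed

lemma sides_iff:
  assumes "finite C" "a \<noteq> b"
  shows "{a, b} \<in> sides C \<longleftrightarrow>
    a \<in> C \<and> b \<in> C \<and> ((\<forall>w\<in>C. \<not> cyc a w b) \<or> (\<forall>w\<in>C. \<not> cyc b w a))"
    (is "_ \<longleftrightarrow> ?R")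
proof
  assume "{a, b} \<in> sides C"
  then obtain v where v: "v \<in> C" "{a, b} = {v, nxt C v}" unfolding sides_def by auto
  with assms(2) have ne: "nxt C v \<noteq> v" by auto
  have "\<exists>u\<in>C. u \<noteq> v"
  proof (rule ccontr)
    assume "\<not> ?thesis"
    with v(1) have "C = {v}" by blast
    then have "nxt C v = v" by (simp add: nxt_def)
    with ne show False by simp
  qed
  then obtain u where "u \<in> C" "u \<noteq> v" by blast
  from nxt_works[OF assms(1) v(1) this] v show ?R by (auto simp: doubleton_eq_iff)
next
  assume R: ?R
  then consider "\<forall>w\<in>C. \<not> cyc a w b" | "\<forall>w\<in>C. \<not> cyc b w a" by blast
  then show "{a, b} \<in> sides C"
  proof cases
    case 1
    then have "nxt C a = b" using R assms by (intro nxt_eqI) auto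
    then show ?thesis using R unfolding sides_def by blast
  next
    case 2
    then have "nxt C b = a" using R assms by (intro nxt_eqI) auto
    then show ?thesis using R unfolding sides_def by (auto simp: insert_commute)
  qed
qed

text \<open>
  Edges of the same polygon, so that edges with a common end do not cross.
\<close>

definition crosses :: "nat set \<Rightarrow> nat set \<Rightarrow> bool" where
  "crosses e f \<longleftrightarrow> (\<exists>a b c d. e = {a, b} \<and> f = {c, d} \<and> cyc a c b \<and> cyc b d a)"

lemma ex_pairs_iff:
  "(\<exists>a b c d. {x, y} = {a, b} \<and> {z, w} = {c, d} \<and> P a b c d) \<longleftrightarrow>
    P x y z w \<or> P x y w z \<or> P y x z w \<or> P y x w z"
  unfolding doubleton_eq_iff by blast

lemma crosses_iff:
  "crosses {a, b} {c, d} \<longleftrightarrow> cyc a c b \<and> cyc b d a \<or> cyc a d b \<and> cyc b c a"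
  unfolding crosses_def ex_pairs_iff by blast

lemma crosses_sym: "crosses e f \<Longrightarrow> crosses f e"
proof -
  assume "crosses e f"
  then obtain a b c d where e: "e = {a, b}" "f = {c, d}" "cyc a c b" "cyc b d a"
    unfolding crosses_def by blast
  then have "cyc c b d" "cyc d a c" unfolding cyc_def by (smt (verit))+
  then show "crosses f e" unfolding e(1,2) crosses_iff by blast
qed

text \<open>
  The pieces of a polygon with an arbitrary vertex set \<open>W\<close>. The vertices of the smaller polygons can thus
  keep the numbers that they have in the large one.
\<close>

definition gpieces :: "nat set \<Rightarrow> nat set set \<Rightarrow> nat set set" where
  "gpieces W D = {C. C \<subseteq> W \<and> 3 \<le> card C \<and>
     (\<forall>i\<in>C. \<forall>j\<in>C. i \<noteq> j \<longrightarrow> ({i, j} \<in> D \<union> sides W \<longleftrightarrow> {i, j} \<in> sides C))}"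

text \<open>
  For a chord \<open>{p, q}\<close> that no member of \<open>D\<close> crosses, these are the vertices that no member of \<open>D\<close> separates
  from it: the corners of the piece that contains the chord, if the chord is not itself in \<open>D\<close>.
\<close>

definition visible :: "nat set \<Rightarrow> nat set set \<Rightarrow> nat \<Rightarrow> nat \<Rightarrow> nat set" where
  "visible W D p q = {v \<in> W. \<forall>k l. {k, l} \<in> D \<longrightarrow> \<not> cyc k p l \<longrightarrow> \<not> cyc k q l \<longrightarrow> \<not> cyc k v l}"

text \<open>
  If there are vertices between \<open>u\<close> and \<open>v\<close>, then the first one after \<open>u\<close> is hidden by a chord, which has to
  start at \<open>u\<close>. The longest chord of this kind ends at a visible vertex: a chord hiding that end would cross
  it or be a longer one. Hence it ends at \<open>v\<close>.
\<close>

lemma visible_next: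
  assumes fin: "finite W" and chords: "\<And>k l. {k, l} \<in> D \<Longrightarrow> k \<in> W \<and> l \<in> W \<and> k \<noteq> l"
    and nc: "\<And>e f. e \<in> D \<Longrightarrow> f \<in> D \<Longrightarrow> \<not> crosses e f" and "p \<noteq> q"
    and u: "u \<in> visible W D p q" and v: "v \<in> visible W D p q" and "u \<noteq> v"
    and uv: "\<And>w. w \<in> visible W D p q \<Longrightarrow> \<not> cyc u w v"
  shows "{u, v} \<in> D \<or> (\<forall>w\<in>W. \<not> cyc u w v)"
proof (rule disjCI)
  let ?C = "visible W D p q"
  assume "\<not> (\<forall>w\<in>W. \<not> cyc u w v)"
  then have ne: "{w\<in>W. cyc u w v} \<noteq> {}" by blast
  have fW: "finite {w\<in>W. cyc u w v}" using fin by simp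
  obtain w where w': "w \<in> {w\<in>W. cyc u w v}"
    and wmin: "\<forall>x\<in>{w\<in>W. cyc u w v}. \<not> cyc u x w"
    by (rule cyc_nearest[OF fW ne])
  then have w: "w \<in> W" "cyc u w v" by auto
  have wmin': "\<not> cyc u x w" if "x \<in> W" for x
    using wmin that cyc_trans[of u x w v] w by blast
  have hid: "\<And>k l x. x \<in> ?C \<Longrightarrow> {k, l} \<in> D \<Longrightarrow> \<not> cyc k p l \<Longrightarrow> \<not> cyc k q l \<Longrightarrow> \<not> cyc k x l"
    unfolding visible_def by blast
  let ?L = "{l. {u, l} \<in> D \<and> \<not> cyc u p l \<and> \<not> cyc u q l \<and> cyc u w l}"
  have "w \<notin> ?C" using uv w by blast
  then obtain k l where kl: "{k, l} \<in> D" "\<not> cyc k p l" "\<not> cyc k q l" "cyc k w l"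
    using w unfolding visible_def by blast
  have nu: "\<not> cyc k u l" using hid[OF u kl(1-3)] .
  have "k = u"
  proof (rule ccontr)
    assume "k \<noteq> u"
    then have "cyc u k w" using nu kl(4) w(2) unfolding cyc_def by (smt (verit))
    then show False using wmin'[of k] chords[OF kl(1)] by blast
  qed
  with kl have neL: "?L \<noteq> {}" by blast
  have "?L \<subseteq> W" using chords[of u] by blast
  then have finL: "finite ?L" using fin by (rule finite_subset)
  obtain l where l: "l \<in> ?L" and lmax: "\<forall>l'\<in>?L. \<not> cyc u l l'"
    by (rule cyc_farthest[OF finL neL])
  from l have l': "{u, l} \<in> D" "\<not> cyc u p l" "\<not> cyc u q l" "cyc u w l" "l \<in> W" "u \<noteq> l"
    using chords[of u l] by blast+
  have "l \<in> ?C"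
  proof (rule ccontr)
    assume "l \<notin> ?C"
    then obtain k' l' where k: "{k', l'} \<in> D" "\<not> cyc k' p l'" "\<not> cyc k' q l'" "cyc k' l l'"
      using l'(5) unfolding visible_def by blast
    have nu: "\<not> cyc k' u l'" using hid[OF u k(1-3)] .
    have "\<not> crosses {k', l'} {u, l}" using nc[OF k(1) l'(1)] .
    then have "\<not> cyc l' u k'" using k(4) unfolding crosses_iff by blast
    then consider "u = k'" | "u = l'" using nu k(4) l'(6) unfolding cyc_def by (smt (verit))
    then show False
    proof cases
      case 1
      then have "l' \<in> ?L" using k l' cyc_trans[of u w l l'] by auto
      then show False using lmax k 1 by blast
    next
      case 2
      \<comment> \<open>The arcs from \<open>u\<close> to \<open>l\<close> and from \<open>k'\<close> to \<open>u\<close> cover all vertices except \<open>u\<close>.\<close>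
      have "p = u \<and> q = u"
        using k l' 2 unfolding cyc_def by (smt (verit))
      then show False using \<open>p \<noteq> q\<close> by simp
    qed
  qed
  then have "\<not> cyc u l v" using uv by blast
  moreover have "\<not> cyc u v l" using hid[OF v, of u l] l' by blast
  ultimately have "l = v" using l'(6) cyc_total[of u l v] \<open>u \<noteq> v\<close> by blast
  then show "{u, v} \<in> D" using l' by blast
qed

lemma visible_ends:
  assumes "p \<in> W" "q \<in> W"
  shows "p \<in> visible W D p q" "q \<in> visible W D p q"
  using assms by (simp_all add: visible_def)

lemma visible_piece:
  assumes fin: "finite W" and chords: "\<And>k l. {k, l} \<in> D \<Longrightarrow> k \<in> W \<and> l \<in> W \<and> k \<noteq> l"
    and nc: "\<And>e f. e \<in> D \<Longrightarrow> f \<in> D \<Longrightarrow> \<not> crosses e f" and "p \<noteq> q"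
    and pq: "p \<in> W" "q \<in> W" "\<And>e. e \<in> D \<Longrightarrow> \<not> crosses e {p, q}"
    and ne: "visible W D p q \<noteq> {p, q}"
  shows "visible W D p q \<in> gpieces W D"
proof -
  let ?C = "visible W D p q"
  have sub: "?C \<subseteq> W" unfolding visible_def by auto
  then have finC: "finite ?C" using fin finite_subset by blast
  have "p \<in> ?C" "q \<in> ?C" using pq(1,2) by (simp_all add: visible_ends)
  then obtain x where x: "x \<in> ?C" "x \<noteq> p" "x \<noteq> q" using ne by blast
  have "card {x, p, q} \<le> card ?C" using x \<open>p \<in> ?C\<close> \<open>q \<in> ?C\<close> finC by (intro card_mono) auto
  then have "3 \<le> card ?C" using x \<open>p \<noteq> q\<close> by simp
  moreover have "{i, j} \<in> D \<union> sides W \<longleftrightarrow> {i, j} \<in> sides ?C" if ij: "i \<in> ?C" "j \<in> ?C" "i \<noteq> j" for i j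
  proof
    assume "{i, j} \<in> D \<union> sides W"
    then show "{i, j} \<in> sides ?C"
    proof
      assume D: "{i, j} \<in> D"
      then have D': "{j, i} \<in> D" by (simp add: insert_commute)
      have "\<not> crosses {i, j} {p, q}" using pq D by blast
      then have "(\<not> cyc i p j \<and> \<not> cyc i q j) \<or> (\<not> cyc j p i \<and> \<not> cyc j q i)"
        unfolding crosses_iff cyc_def by (smt (verit))
      then have "(\<forall>w\<in>?C. \<not> cyc i w j) \<or> (\<forall>w\<in>?C. \<not> cyc j w i)"
        using D D' unfolding visible_def by blast
      then show ?thesis using ij finC by (simp add: sides_iff)
    next
      assume "{i, j} \<in> sides W"
      then show ?thesis using ij fin finC sub by (auto simp: sides_iff)
    qed
  next
    assume "{i, j} \<in> sides ?C"
    then consider "\<forall>w\<in>?C. \<not> cyc i w j" | "\<forall>w\<in>?C. \<not> cyc j w i"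
      using ij finC by (auto simp: sides_iff)
    then have "({i, j} \<in> D \<or> (\<forall>w\<in>W. \<not> cyc i w j)) \<or> ({j, i} \<in> D \<or> (\<forall>w\<in>W. \<not> cyc j w i))"
      using visible_next[OF fin chords nc \<open>p \<noteq> q\<close>] ij by cases blast+
    then show "{i, j} \<in> D \<union> sides W"
      using ij fin sub by (auto simp: sides_iff insert_commute)
  qed
  ultimately show ?thesis using sub unfolding gpieces_def by blast
qed

section \<open>Quadrangulations, compatibility and flips in terms of the cyclic order\<close>

text \<open>
  The colour of a vertex is its parity, so these are the chords with ends of different colours.
\<close>

definition odd_chords :: "nat set \<Rightarrow> nat set set" where
  "odd_chords W = {{a, b} | a b. a \<in> W \<and> b \<in> W \<and> odd (a + b)}"

text \<open>
  The red vertex \<open>a\<close>, the blue \<open>c\<close>, the red \<open>b\<close> and the blue \<open>d\<close> in clockwise order, with the blue vertex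
  \<open>k\<close> at the position \<open>2 * k\<close> and the red one just after it.
\<close>

definition alternate :: "nat \<Rightarrow> nat \<Rightarrow> nat \<Rightarrow> nat \<Rightarrow> bool" where
  "alternate a c b d \<longleftrightarrow> cyc (2 * a + 1) (2 * c) (2 * b + 1) \<and> cyc (2 * b + 1) (2 * d) (2 * a + 1)"

definition red_crosses :: "nat set \<Rightarrow> nat set \<Rightarrow> bool" where
  "red_crosses e f \<longleftrightarrow> (\<exists>a b c d. e = {a, b} \<and> f = {c, d} \<and> alternate a c b d)"

text \<open>
  A crossing is positively oriented iff going clockwise from a red end leads to a blue end of the other
  colour. Passing from \<open>a\<close> to \<open>b\<close> changes both colours, so it does not matter which red end is called \<open>a\<close>.
\<close>

definition red_compat :: "nat set \<Rightarrow> nat set \<Rightarrow> bool" where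
  "red_compat e f \<longleftrightarrow> (\<forall>a b c d. e = {a, b} \<longrightarrow> f = {c, d} \<longrightarrow> alternate a c b d \<longrightarrow> odd (a + c))"

definition quad :: "nat set \<Rightarrow> nat set set \<Rightarrow> bool" where
  "quad W D \<longleftrightarrow> D \<subseteq> odd_chords W - sides W \<and> (\<forall>e\<in>D. \<forall>f\<in>D. \<not> crosses e f) \<and>
     (\<forall>C\<in>gpieces W D. card C = 4)"

definition cquads :: "nat set \<Rightarrow> nat set set \<Rightarrow> nat set set set" where
  "cquads W E = {D. quad W D \<and> (\<forall>e\<in>D. \<forall>f\<in>E. red_compat e f)}"

text \<open>
  The vertices are in clockwise order. This form of the condition only relates \<open>c\<close> and \<open>f\<close> to the other four
  vertices, which allows either of them to be replaced.
\<close>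

definition hexagon :: "nat \<Rightarrow> nat \<Rightarrow> nat \<Rightarrow> nat \<Rightarrow> nat \<Rightarrow> nat \<Rightarrow> bool" where
  "hexagon a b c d e f \<longleftrightarrow> cyc b c a \<and> cyc a c d \<and> cyc a d e \<and> cyc e f a"

text \<open>
  A hexagon that consists of two squares with the common side \<open>{b, e}\<close> and has the long inner edge \<open>g\<close>.
\<close>

definition turn :: "nat set \<Rightarrow> nat set set \<Rightarrow> nat set \<Rightarrow>
    nat \<Rightarrow> nat \<Rightarrow> nat \<Rightarrow> nat \<Rightarrow> nat \<Rightarrow> nat \<Rightarrow> bool" where
  "turn W D g a b c d e f \<longleftrightarrow> hexagon a b c d e f \<and>
     {{a, b}, {b, c}, {c, d}, {d, e}, {e, f}, {f, a}} \<subseteq> D \<union> sides W \<and> {b, e} \<in> D \<and>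
     red_crosses {a, b} g \<and> red_crosses {d, e} g"

text \<open>
  Of the two diagonals joining the sides \<open>{a, b}\<close> and \<open>{d, e}\<close> that a long inner edge crosses,
  compatibility determines the kinds: \<open>{b, e}\<close> is (id) and \<open>{a, d}\<close> is (op), whichever of these sides the
  edge enters through.
\<close>

definition cflip :: "nat set \<Rightarrow> nat set set \<Rightarrow> nat set set \<Rightarrow> nat set set \<Rightarrow> bool" where
  "cflip W E D D' \<longleftrightarrow> D \<in> cquads W E \<and> D' \<in> cquads W E \<and>
     (\<exists>g\<in>E. \<exists>a b c d e f. turn W D g a b c d e f \<and> {a, d} \<notin> D \<and> D' = insert {a, d} (D - {{b, e}}))"

lemma turnD:
  assumes "turn W D g a b c d e f"
  shows "hexagon a b c d e f" "{b, e} \<in> D" "red_crosses {a, b} g" "red_crosses {d, e} g"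
    "{a, b} \<in> D \<union> sides W" "{b, c} \<in> D \<union> sides W" "{c, d} \<in> D \<union> sides W"
    "{d, e} \<in> D \<union> sides W" "{e, f} \<in> D \<union> sides W" "{f, a} \<in> D \<union> sides W"
  using assms unfolding turn_def by simp_all

lemma cflipE:
  assumes "cflip W E D D'"
  obtains g a b c d e f where "g \<in> E" "turn W D g a b c d e f" "{a, d} \<notin> D"
    "D' = insert {a, d} (D - {{b, e}})"
  using assms unfolding cflip_def by (elim conjE bexE exE) (rule that)

lemma cflipI:
  assumes "D \<in> cquads W E" "D' \<in> cquads W E" "turn W D g a b c d e f" "g \<in> E" "{a, d} \<notin> D"
    "D' = insert {a, d} (D - {{b, e}})"
  shows "cflip W E D D'"
  unfolding cflip_def using assms(1,2,4)
  by (intro conjI bexI[of _ g] exI[of _ a] exI[of _ b] exI[of _ c] exI[of _ d] exI[of _ e] exI[of _ f])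
    (rule assms)+

lemma alternate_sym: "alternate a c b d \<Longrightarrow> alternate b d a c"
  unfolding alternate_def by simp

text \<open>
  The blue vertices from red \<open>a\<close> to red \<open>b\<close> do not include \<open>a\<close>, which is just before, but include \<open>b\<close>.
\<close>

lemma red_arc_iff: "cyc (2 * a + 1) (2 * c) (2 * b + 1) \<longleftrightarrow> a \<noteq> b \<and> (c = b \<or> cyc a c b)"
proof -
  have "2 * x + 1 < 2 * y \<longleftrightarrow> x < y" "2 * y < 2 * x + 1 \<longleftrightarrow> y \<le> x" "2 * x + 1 < 2 * y + 1 \<longleftrightarrow> x < y"
    for x y :: nat by auto
  then show ?thesis unfolding cyc_def by (simp only:) (smt (verit))
qed

lemma alternate_iff:
  "alternate a c b d \<longleftrightarrow> a \<noteq> b \<and> (c = b \<or> cyc a c b) \<and> (d = a \<or> cyc b d a)"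
  unfolding alternate_def red_arc_iff by blast

lemma red_crosses_iff:
  "red_crosses {a, b} {c, d} \<longleftrightarrow> alternate a c b d \<or> alternate a d b c"
  unfolding red_crosses_def ex_pairs_iff using alternate_sym by blast

lemma red_compat_pair_iff:
  "red_compat {a, b} {c, d} \<longleftrightarrow>
    (alternate a c b d \<longrightarrow> odd (a + c)) \<and> (alternate a d b c \<longrightarrow> odd (a + d)) \<and>
    (alternate b c a d \<longrightarrow> odd (b + c)) \<and> (alternate b d a c \<longrightarrow> odd (b + d))"
proof -
  have "red_compat {a, b} {c, d} \<longleftrightarrow>
    \<not> (\<exists>a' b' c' d'. {a, b} = {a', b'} \<and> {c, d} = {c', d'} \<and> (alternate a' c' b' d' \<and> even (a' + c')))"
    unfolding red_compat_def by blast
  then show ?thesis unfolding ex_pairs_iff by blast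
qed

lemma red_compatD: "red_compat {a, b} {c, d} \<Longrightarrow> alternate a c b d \<Longrightarrow> odd (a + c)"
  unfolding red_compat_def by blast

lemma red_compat_if_not_red_crosses: "\<not> red_crosses e f \<Longrightarrow> red_compat e f"
  unfolding red_crosses_def red_compat_def by blast

lemma odd_chordsE:
  assumes "e \<in> odd_chords W"
  obtains a b where "e = {a, b}" "a \<in> W" "b \<in> W" "odd (a + b)" "a \<noteq> b"
proof -
  from assms obtain a b where "e = {a, b}" "a \<in> W" "b \<in> W" "odd (a + b)"
    unfolding odd_chords_def by blast
  moreover from this have "a \<noteq> b" by auto
  ultimately show thesis using that by blast
qed

lemma odd_chords_iff: "{a, b} \<in> odd_chords W \<longleftrightarrow> a \<in> W \<and> b \<in> W \<and> odd (a + b)"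
proof
  assume "{a, b} \<in> odd_chords W"
  then show "a \<in> W \<and> b \<in> W \<and> odd (a + b)"
    by (elim odd_chordsE) (auto simp: doubleton_eq_iff add.commute)
qed (auto simp: odd_chords_def)

lemma sidesE:
  assumes "e \<in> sides W" "2 \<le> card W" "finite W"
  obtains a b where "e = {a, b}" "a \<in> W" "b \<in> W" "a \<noteq> b" "\<forall>w\<in>W. \<not> cyc a w b"
proof -
  from assms obtain v where v: "v \<in> W" "e = {v, nxt W v}" unfolding sides_def by blast
  have "\<exists>u\<in>W. u \<noteq> v"
  proof (rule ccontr)
    assume "\<not> ?thesis"
    with v have "W = {v}" by blast
    with assms(2) show False by simp
  qed
  then obtain u where u: "u \<in> W" "u \<noteq> v" by blast
  from nxt_works[OF assms(3) v(1) u] v that show thesis by metis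
qed

definition arc :: "nat set \<Rightarrow> nat \<Rightarrow> nat \<Rightarrow> nat set" where
  "arc V p q = {v \<in> V. v = p \<or> v = q \<or> cyc p v q}"

section \<open>The two arcs cut off by a bridge\<close>

text \<open>
  Seen from the arc from \<open>p\<close> to \<open>q\<close>, all vertices strictly between \<open>q\<close> and \<open>p\<close> are in the same place.
\<close>

lemma far_cyc:
  assumes "i = p \<or> i = q \<or> cyc p i q" "j = p \<or> j = q \<or> cyc p j q" "cyc q y p" "cyc q y' p" "p \<noteq> q"
  shows "cyc i y j \<longleftrightarrow> cyc i y' j"
  using assms unfolding cyc_def by (smt (verit))

lemma gpiecesD:
  assumes "C \<in> gpieces W D"
  shows "C \<subseteq> W" "3 \<le> card C"
    "\<And>i j. i \<in> C \<Longrightarrow> j \<in> C \<Longrightarrow> i \<noteq> j \<Longrightarrow> {i, j} \<in> D \<union> sides W \<longleftrightarrow> {i, j} \<in> sides C"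
  using assms unfolding gpieces_def by blast+

text \<open>
  A bridge with the vertices \<open>p\<close>, \<open>p'\<close>, \<open>q\<close>, \<open>q'\<close> in clockwise order, where \<open>{p, p'}\<close> and \<open>{q, q'}\<close> are
  boundary edges, and \<open>E\<close> is the set of blue edges with the boundary edges included. Interchanging
  \<open>p\<close>, \<open>p'\<close> with \<open>q\<close>, \<open>q'\<close> gives the same situation (\<open>swapped\<close>), so statements need a proof for one of the two
  arcs only. \<open>W1\<close> and \<open>E1\<close> belong to the part that remains when everything beyond \<open>{q', p}\<close>
  is removed; of the vertices strictly between \<open>q\<close> and \<open>p\<close> it keeps \<open>q'\<close>.
\<close>

locale bridged =
  fixes V :: "nat set" and E :: "nat set set" and p p' q q' :: nat
  assumes finV: "finite V" and EV: "E \<subseteq> odd_chords V"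
    and mem: "p \<in> V" "p' \<in> V" "q \<in> V" "q' \<in> V"
    and around: "cyc p p' q" "cyc p' q q'" "cyc q q' p"
    and adj: "\<And>v. v \<in> V \<Longrightarrow> \<not> cyc p v p'" "\<And>v. v \<in> V \<Longrightarrow> \<not> cyc q v q'"
    and inner: "{p', q} \<in> E" "{q', p} \<in> E"
    and par: "odd (p + p')" "odd (q + q')"
    and E_split: "\<And>f. f \<in> E \<Longrightarrow> f \<subseteq> arc V p' q \<or> f \<subseteq> arc V q' p \<or> f = {p, p'} \<or> f = {q, q'}"
begin

lemma swapped: "bridged V E q q' p p'"
proof
  show "cyc q' p p'" using around unfolding cyc_def by (smt (verit))
  show "\<And>f. f \<in> E \<Longrightarrow> f \<subseteq> arc V q' p \<or> f \<subseteq> arc V p' q \<or> f = {q, q'} \<or> f = {p, p'}"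
    using E_split by blast
qed (use finV EV mem around adj inner par in blast)+

abbreviation "I1 \<equiv> arc V p q"
abbreviation "I2 \<equiv> arc V q p"
abbreviation "W1 \<equiv> arc V p q'"
abbreviation "W2 \<equiv> arc V q p'"
abbreviation "E1 \<equiv> {f \<in> E. f \<subseteq> W1}"
abbreviation "E2 \<equiv> {f \<in> E. f \<subseteq> W2}"

lemma distinct: "p \<noteq> q" "p \<noteq> q'" "p \<noteq> p'" "q \<noteq> p'" "q \<noteq> q'" "p' \<noteq> q'" "cyc q' p p'"
  using around unfolding cyc_def by (smt (verit))+

lemma par_pq: "even (p + q)"
proof -
  have "odd (p' + q)" using inner(1) EV odd_chords_iff by blast
  then show ?thesis using par by presburger
qed

lemma W1_eq: "W1 = insert q' I1"
proof -
  have "cyc p v q' \<longleftrightarrow> v = q \<or> cyc p v q" if "v \<in> V" for v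
    using adj(2)[OF that] around(3) distinct unfolding cyc_def by (smt (verit))
  moreover have "q \<in> V" "q' \<in> V" using mem by auto
  ultimately show ?thesis unfolding arc_def by blast
qed

lemma I_Un: "I1 \<union> I2 = V"
proof -
  have "v = p \<or> v = q \<or> cyc p v q \<or> cyc q v p" for v
    using cyc_total[of p v q] cyc_rotate[of p q v] distinct(1) by blast
  then show ?thesis unfolding arc_def by blast
qed

lemma I1_not_I2: "x \<in> I1 \<Longrightarrow> x \<notin> {p, q} \<Longrightarrow> x \<notin> I2"
  unfolding arc_def cyc_def by auto

lemma I2_inner: "x \<in> V \<Longrightarrow> x \<notin> I1 \<longleftrightarrow> cyc q x p"
  using distinct(1) unfolding arc_def cyc_def by auto

lemma I1_inner: "x \<in> V \<Longrightarrow> x \<notin> I2 \<longleftrightarrow> cyc p x q"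
  using distinct(1) unfolding arc_def cyc_def by auto

lemma W1_sub: "W1 \<subseteq> V" "finite W1"
  using finV unfolding arc_def by auto

lemma q'_far: "cyc q q' p" "q' \<notin> I1" "q' \<in> I2"
  using around(3) I2_inner[OF mem(4)] mem I1_not_I2 I_Un by auto

lemma no_odd_chord_in_both: "e \<in> odd_chords X \<Longrightarrow> e \<subseteq> I1 \<Longrightarrow> \<not> e \<subseteq> I2"
proof
  assume e: "e \<in> odd_chords X" "e \<subseteq> I1" "e \<subseteq> I2"
  then obtain a b where ab: "e = {a, b}" "odd (a + b)" by (elim odd_chordsE) blast
  with e I1_not_I2 have "a \<in> {p, q}" "b \<in> {p, q}" by blast+
  then show False using ab par_pq by (auto simp: add.commute)
qed

text \<open>
  A red edge with ends \<open>a\<close> strictly between \<open>p\<close> and \<open>q\<close> and \<open>b\<close> strictly between \<open>q\<close> and \<open>p\<close> crosses both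
  \<open>{p', q}\<close> and \<open>{q', p}\<close>. Compatibility would force \<open>a\<close> to differ in colour from both \<open>q\<close> and \<open>q'\<close>.
\<close>

lemma red_split:
  assumes e: "e \<in> odd_chords V" and c: "red_compat e {p', q}" "red_compat e {q', p}"
  shows "e \<subseteq> I1 \<or> e \<subseteq> I2"
proof (rule ccontr)
  assume n: "\<not> (e \<subseteq> I1 \<or> e \<subseteq> I2)"
  obtain x y where xy: "e = {x, y}" "x \<in> V" "y \<in> V" using e by (elim odd_chordsE)
  have "\<exists>a b. e = {a, b} \<and> a \<in> V \<and> b \<in> V \<and> cyc p a q \<and> cyc q b p"
  proof (cases "x \<in> I1")
    case True
    then have "y \<notin> I1" using n xy by blast
    then have "x \<notin> I2" using n xy I_Un by blast
    then show ?thesis using xy \<open>y \<notin> I1\<close> I2_inner I1_inner by blast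
  next
    case False
    then have "y \<notin> I2" using n xy I_Un by blast
    then have "e = {y, x} \<and> y \<in> V \<and> x \<in> V \<and> cyc p y q \<and> cyc q x p"
      using xy False I2_inner I1_inner by (simp add: insert_commute)
    then show ?thesis by blast
  qed
  then obtain a b where ab: "e = {a, b}" "a \<in> V" "b \<in> V" "cyc p a q" "cyc q b p" by blast
  have "alternate a q b p'"
    using ab adj(1)[OF ab(2)] around distinct unfolding alternate_iff cyc_def by (smt (verit))
  moreover have "alternate a q' b p"
    using ab adj(2)[OF ab(3)] around distinct unfolding alternate_iff cyc_def by (smt (verit))
  moreover have "{p', q} = {q, p'}" by (rule insert_commute)
  ultimately have "odd (a + q)" "odd (a + q')"
    using c red_compatD unfolding ab(1) by metis+
  then show False using par by presburger
qed

lemma sides_replace: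
  assumes X: "X \<subseteq> I1" and fin: "finite X" "finite Y" "finite Y'"
    and Y: "Y \<noteq> {}" "Y' \<noteq> {}" "\<And>y. y \<in> Y \<union> Y' \<Longrightarrow> cyc q y p" and ij: "i \<in> X" "j \<in> X" "i \<noteq> j"
  shows "{i, j} \<in> sides (X \<union> Y) \<longleftrightarrow> {i, j} \<in> sides (X \<union> Y')"
proof -
  obtain y0 where y0: "y0 \<in> Y" using Y by blast
  have i: "i = p \<or> i = q \<or> cyc p i q" and j: "j = p \<or> j = q \<or> cyc p j q"
    using ij X unfolding arc_def by auto
  have "cyc i y j \<longleftrightarrow> cyc i y0 j" "cyc j y i \<longleftrightarrow> cyc j y0 i" if "y \<in> Y \<union> Y'" for y
    using far_cyc[OF i j Y(3)[OF that] Y(3)[of y0] distinct(1)]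
      far_cyc[OF j i Y(3)[OF that] Y(3)[of y0] distinct(1)] y0 by auto
  then have "(\<forall>w\<in>Y. \<not> cyc i w j) \<longleftrightarrow> (\<forall>w\<in>Y'. \<not> cyc i w j)"
    "(\<forall>w\<in>Y. \<not> cyc j w i) \<longleftrightarrow> (\<forall>w\<in>Y'. \<not> cyc j w i)" using Y(1,2) by blast+
  then show ?thesis using ij fin by (simp add: sides_iff ball_Un)
qed

lemma sides_I1:
  assumes "i \<in> I1" "j \<in> I1" "i \<noteq> j"
  shows "{i, j} \<in> sides V \<longleftrightarrow> {i, j} \<in> sides W1"
proof -
  have "{i, j} \<in> sides (I1 \<union> (V - I1)) \<longleftrightarrow> {i, j} \<in> sides (I1 \<union> {q'})"
  proof (rule sides_replace)
    show "V - I1 \<noteq> {}" using q'_far mem by blast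
    show "\<And>y. y \<in> V - I1 \<union> {q'} \<Longrightarrow> cyc q y p" using I2_inner q'_far by blast
  qed (use assms finV finite_subset[of I1 V] I_Un in auto)
  moreover have "I1 \<union> (V - I1) = V" using I_Un by blast
  ultimately show ?thesis by (simp add: W1_eq)
qed

lemma sides_split:
  assumes "e \<in> sides V"
  shows "e \<subseteq> I1 \<or> e \<subseteq> I2"
proof -
  have "card {p, q} \<le> card V" using mem finV by (intro card_mono) auto
  then have "2 \<le> card V" using distinct by simp
  with assms finV obtain a b where ab: "e = {a, b}" "a \<in> V" "b \<in> V" "a \<noteq> b" "\<forall>w\<in>V. \<not> cyc a w b"
    by (elim sidesE)
  then have "\<not> cyc a p b" "\<not> cyc a q b" using mem by auto
  then have "(a = p \<or> a = q \<or> cyc p a q) \<and> (b = p \<or> b = q \<or> cyc p b q) \<or>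
    (a = p \<or> a = q \<or> cyc q a p) \<and> (b = p \<or> b = q \<or> cyc q b p)"
    using ab(4) distinct(1) unfolding cyc_def by (smt (verit))
  then show ?thesis using ab unfolding arc_def by blast
qed

lemma sides_at_q':
  "{x, q'} \<in> sides W1 \<longleftrightarrow> x \<in> {p, q}" if "x \<in> W1" "x \<noteq> q'"
proof -
  have x: "x = p \<or> x = q \<or> cyc p x q" using that W1_eq unfolding arc_def by auto
  have "{q, q'} \<in> sides W1" "{p, q'} \<in> sides W1"
  proof -
    have "\<forall>w\<in>W1. \<not> cyc q w q'" using adj W1_sub by blast
    then show "{q, q'} \<in> sides W1"
      using W1_eq W1_sub mem distinct(5) by (simp add: sides_iff) (simp add: arc_def)
    have "\<forall>w\<in>W1. \<not> cyc q' w p"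
      unfolding W1_eq using around distinct(1) unfolding arc_def cyc_def by (smt (verit) insert_iff mem_Collect_eq)
    then show "{p, q'} \<in> sides W1"
      using W1_eq W1_sub mem distinct(2) by (simp add: sides_iff) (simp add: arc_def)
  qed
  moreover have "x \<in> {p, q}" if s: "{x, q'} \<in> sides W1"
  proof (rule ccontr)
    assume "x \<notin> {p, q}"
    then have "cyc x q q'" "cyc q' p x" using x around unfolding cyc_def by (simp, smt (verit))+
    moreover have "p \<in> W1" "q \<in> W1" using W1_eq mem by (simp_all add: arc_def)
    ultimately show False using s W1_sub \<open>x \<noteq> q'\<close> by (auto simp: sides_iff)
  qed
  ultimately show ?thesis by blast
qed

lemma far_sides: "{p, q'} \<in> sides W1" "{q, q'} \<in> sides W1"
proof -
  have "p \<in> W1" "q \<in> W1" using W1_eq mem by (simp_all add: arc_def)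
  then show "{p, q'} \<in> sides W1" "{q, q'} \<in> sides W1" using sides_at_q' distinct(2,5) by blast+
qed

lemma sides_W1_cases:
  assumes "e \<in> sides W1"
  obtains x y where "e = {x, y}" "x \<in> I1" "y \<in> I1" "x \<noteq> y" | "e = {p, q'} \<or> e = {q, q'}"
proof -
  have "card {p, q} \<le> card W1" using W1_eq W1_sub mem by (intro card_mono) (simp_all add: arc_def)
  then have "2 \<le> card W1" using distinct by simp
  with assms W1_sub obtain a b where ab: "e = {a, b}" "a \<in> W1" "b \<in> W1" "a \<noteq> b"
    by (elim sidesE)
  consider "a = q'" | "b = q'" | "a \<in> I1" "b \<in> I1" using ab W1_eq by blast
  then show thesis
  proof cases
    case 1
    then have "b \<in> {p, q}" using sides_at_q'[of b] ab assms by (simp add: insert_commute)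
    then show thesis using ab(1) 1 that(2) by (auto simp: insert_commute)
  next
    case 2
    then have "a \<in> {p, q}" using sides_at_q'[of a] ab assms by simp
    then show thesis using ab(1) 2 that(2) by auto
  next
    case 3
    then show thesis using ab that(1) by blast
  qed
qed

lemma sides_split_W1: "e \<in> sides W1 \<Longrightarrow> e \<subseteq> I1 \<or> e \<subseteq> I2"
  using q'_far(3) mem by (elim sides_W1_cases) (auto simp: arc_def)

lemma far_edge:
  assumes e: "e \<in> odd_chords X" "e \<subseteq> W1" "e \<subseteq> I2"
  shows "e = {p, q'} \<or> e = {q, q'}"
proof -
  obtain x y where xy: "e = {x, y}" "odd (x + y)" "x \<noteq> y" using e(1) by (elim odd_chordsE)
  have "x \<in> {p, q, q'}" "y \<in> {p, q, q'}" using e(2,3) xy(1) W1_eq I1_not_I2 by blast+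
  moreover have "\<not> (x \<in> {p, q} \<and> y \<in> {p, q})" using xy(2) par_pq by (auto simp: add.commute)
  ultimately show ?thesis using xy(1,3) by blast
qed

end

context bridged
begin

text \<open>
  Otherwise the last vertex of the piece before \<open>p\<close> and the first one after it, which lie strictly on
  different sides, would be joined by an edge.
\<close>

lemma piece_through_p:
  assumes Z: "Z \<subseteq> V" and split: "\<And>e. e \<in> F \<union> sides Z \<Longrightarrow> e \<subseteq> I1 \<or> e \<subseteq> I2"
    and C: "C \<in> gpieces Z F" and a: "a \<in> C" "cyc p a q" and b: "b \<in> C" "cyc q b p"
  shows "p \<in> C"
proof (rule ccontr)
  assume pC: "p \<notin> C"
  note CD = gpiecesD[OF C]
  have fin: "finite C" using CD(1) Z finV by (meson finite_subset)
  have ne: "C \<noteq> {}" using a by blast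
  obtain v where v: "v \<in> C" "\<forall>w\<in>C. \<not> cyc p w v" by (rule cyc_nearest[OF fin ne])
  obtain u where u: "u \<in> C" "\<forall>w\<in>C. \<not> cyc p u w" by (rule cyc_farthest[OF fin ne])
  have vp: "v \<noteq> p" "u \<noteq> p" using u v pC by auto
  have "\<not> cyc p a v" "\<not> cyc p u b" using u(2) v(2) a(1) b(1) by blast+
  note near = this a(2) b(2) vp
  have va: "cyc p v q" using near unfolding cyc_def by (smt (verit))
  have ub: "cyc q u p" using near unfolding cyc_def by (smt (verit))
  have "u \<noteq> v" using va ub unfolding cyc_def by (smt (verit))
  have "\<not> cyc u w v" if "w \<in> C" for w
  proof -
    have "w \<noteq> p" "\<not> cyc p w v" "\<not> cyc p u w" using that u(2) v(2) pC by blast+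
    then show ?thesis using va ub unfolding cyc_def by (smt (verit))
  qed
  then have "{u, v} \<in> sides C" using sides_iff[OF fin \<open>u \<noteq> v\<close>] u v by blast
  then have "{u, v} \<in> F \<union> sides Z" using CD(3)[OF u(1) v(1) \<open>u \<noteq> v\<close>] by blast
  then have "{u, v} \<subseteq> I1 \<or> {u, v} \<subseteq> I2" by (rule split)
  moreover have "u \<in> V" "v \<in> V" using u(1) v(1) CD(1) Z by blast+
  ultimately show False using I2_inner[of u] I1_inner[of v] va ub by blast
qed

text \<open>
  The red vertices \<open>q\<close> and \<open>p\<close> lie beyond the blue arc from \<open>p'\<close> to \<open>q\<close> on both sides.
\<close>

lemma crossing_apart:
  assumes "e \<subseteq> I2" "g \<subseteq> arc V p' q"
  shows "\<not> red_crosses e g"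
proof
  assume "red_crosses e g"
  then obtain a b c d where abcd: "e = {a, b}" "g = {c, d}" "alternate a c b d"
    unfolding red_crosses_def by blast
  have "a = q \<or> a = p \<or> cyc q a p" "b = q \<or> b = p \<or> cyc q b p"
    "c = p' \<or> c = q \<or> cyc p' c q" "d = p' \<or> d = q \<or> cyc p' d q"
    using assms abcd unfolding arc_def by blast+
  then show False using abcd(3) around distinct unfolding alternate_iff cyc_def by (smt (verit))
qed

lemma piece_through_q:
  assumes Z: "Z \<subseteq> V" and split: "\<And>e. e \<in> F \<union> sides Z \<Longrightarrow> e \<subseteq> I1 \<or> e \<subseteq> I2"
    and C: "C \<in> gpieces Z F" and a: "a \<in> C" "cyc p a q" and b: "b \<in> C" "cyc q b p"
  shows "q \<in> C"
proof -
  interpret sw: bridged V E q q' p p' by (rule swapped)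
  show ?thesis using sw.piece_through_p[OF Z _ C b a] split by blast
qed

end

text \<open>
  Two polygons with edges that coincide on the arc \<open>I1\<close> and may differ beyond it, where in the second
  one \<open>y'\<close> is a vertex beyond the arc that is joined to \<open>p\<close> and \<open>q\<close>. The large polygon and the small one
  satisfy this in both directions, with \<open>q'\<close> respectively the fourth corner of the middle square as \<open>y'\<close>.
\<close>

locale agree = bridged +
  fixes Z F Z' F' y'
  assumes Z: "Z \<subseteq> V" "Z' \<subseteq> V" "I1 \<subseteq> Z" "I1 \<subseteq> Z'"
    and split: "\<And>e. e \<in> F \<union> sides Z \<Longrightarrow> e \<subseteq> I1 \<or> e \<subseteq> I2"
    and same: "\<And>i j. i \<in> I1 \<Longrightarrow> j \<in> I1 \<Longrightarrow> i \<noteq> j \<Longrightarrow> {i, j} \<in> F \<union> sides Z \<longleftrightarrow> {i, j} \<in> F' \<union> sides Z'"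
    and y': "y' \<in> Z'" "cyc q y' p" "{q, y'} \<in> F' \<union> sides Z'" "{p, y'} \<in> F' \<union> sides Z'"
    and y'_only: "\<And>x. x \<in> I1 \<Longrightarrow> {x, y'} \<in> F' \<union> sides Z' \<Longrightarrow> x \<in> {p, q}"
begin

lemma piece_inside:
  assumes "C \<in> gpieces Z F" "C \<subseteq> I1"
  shows "C \<in> gpieces Z' F'"
proof -
  note C = gpiecesD[OF assms(1)]
  have "{i, j} \<in> F' \<union> sides Z' \<longleftrightarrow> {i, j} \<in> sides C" if "i \<in> C" "j \<in> C" "i \<noteq> j" for i j
    using same[of i j] C(3)[OF that] that assms(2) by blast
  then show ?thesis using C(2) Z assms(2) unfolding gpieces_def by blast
qed

text \<open>
  In a piece that lies on both sides, the whole section \<open>Y\<close> beyond \<open>I1\<close> can be replaced by \<open>y'\<close>.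
\<close>

lemma piece_exchange:
  assumes C: "X \<union> Y \<in> gpieces Z F" and X: "X \<subseteq> I1" "p \<in> X" "q \<in> X"
    and Y: "Y \<noteq> {}" "\<And>y. y \<in> Y \<Longrightarrow> cyc q y p"
  shows "insert y' X \<in> gpieces Z' F'"
proof -
  note CD = gpiecesD[OF C]
  have fin: "finite X" "finite Y" using CD(1) Z(1) finV by (meson finite_subset le_supE)+
  have yX: "y' \<notin> X" using X(1) y'(2) I2_inner[of y'] y'(1) Z(2) by blast
  have "{i, j} \<in> F' \<union> sides Z' \<longleftrightarrow> {i, j} \<in> sides (insert y' X)"
    if ij: "i \<in> X" "j \<in> X" "i \<noteq> j" for i j
  proof -
    have "{i, j} \<in> sides (X \<union> Y) \<longleftrightarrow> {i, j} \<in> sides (X \<union> {y'})"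
      by (rule sides_replace) (use X Y fin ij y'(2) in auto)
    then show ?thesis using same[of i j] CD(3)[of i j] ij X(1) by auto
  qed
  moreover have "{i, y'} \<in> F' \<union> sides Z' \<longleftrightarrow> {i, y'} \<in> sides (insert y' X)" if i: "i \<in> X" for i
  proof -
    have iy: "i \<noteq> y'" using i yX by blast
    have pos: "w = y' \<or> w = p \<or> w = q \<or> cyc p w q" if "w \<in> insert y' X" for w
      using that X(1) unfolding arc_def by blast
    show ?thesis
    proof (cases "i \<in> {p, q}")
      case True
      have "\<not> cyc y' w p" "\<not> cyc q w y'" if "w \<in> insert y' X" for w
        using pos[OF that] y'(2) unfolding cyc_def by (smt (verit))+
      then have "{i, y'} \<in> sides (insert y' X)"
        using True fin i iy by (auto simp: sides_iff)
      moreover have "{i, y'} \<in> F' \<union> sides Z'" using True y'(3,4) by blast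
      ultimately show ?thesis by blast
    next
      case False
      then have "cyc p i q" using pos[of i] i iy by blast
      then have "cyc i q y'" "cyc y' p i" using y'(2) unfolding cyc_def by (smt (verit))+
      then have "{i, y'} \<notin> sides (insert y' X)"
        using X fin iy by (auto simp: sides_iff)
      moreover have "{i, y'} \<notin> F' \<union> sides Z'" using False y'_only i X(1) by blast
      ultimately show ?thesis by blast
    qed
  qed
  moreover have "3 \<le> card (insert y' X)"
  proof -
    have "card {y', p, q} \<le> card (insert y' X)" using X fin by (intro card_mono) auto
    moreover have "y' \<noteq> p" "y' \<noteq> q" using X yX by blast+
    then have "card {y', p, q} = 3" using distinct(1) by simp
    ultimately show ?thesis by simp
  qed
  moreover have "insert y' X \<subseteq> Z'" using X Z y' by blast
  ultimately show ?thesis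
    unfolding gpieces_def by (auto simp: insert_commute)
qed

text \<open>
  A vertex \<open>c\<close> beyond \<open>I1\<close> that is joined to two vertices of \<open>I1\<close> must be joined to \<open>p\<close> and \<open>q\<close>. So is \<open>y'\<close>,
  and \<open>y'\<close> is in the same place as \<open>c\<close> when seen from \<open>I1\<close>.
\<close>

lemma detour:
  assumes bd: "b \<in> I1" "d \<in> I1" "b \<noteq> d"
    and edges: "{b, c} \<in> F \<union> sides Z" "{c, d} \<in> F \<union> sides Z"
    and ne: "c \<noteq> b" "c \<noteq> d"
  obtains c' where "{b, c'} \<in> F' \<union> sides Z'" "{c', d} \<in> F' \<union> sides Z'"
    "\<And>x z. x \<in> I1 \<Longrightarrow> z \<in> I1 \<Longrightarrow> cyc x c z \<Longrightarrow> cyc x c' z"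
proof (cases "c \<in> I1")
  case True
  then have "{b, c} \<in> F' \<union> sides Z'" "{c, d} \<in> F' \<union> sides Z'"
    using same[of b c] same[of c d] bd edges ne True by blast+
  then show thesis by (rule that)
next
  case False
  then have c_far: "cyc q c p" using I2_inner[of c] split[OF edges(1)] I_Un by blast
  have "{b, c} \<subseteq> I2" "{c, d} \<subseteq> I2" using split[OF edges(1)] split[OF edges(2)] False by blast+
  then have "b \<in> {p, q}" "d \<in> {p, q}" using I1_not_I2 bd by blast+
  then have "{b, y'} \<in> F' \<union> sides Z'" "{y', d} \<in> F' \<union> sides Z'"
    using y'(3,4) insert_commute[of q y'] insert_commute[of p y'] by auto
  moreover have "cyc x y' z" if "x \<in> I1" "z \<in> I1" "cyc x c z" for x z
    using far_cyc[of x p q z c y'] that c_far y'(2) distinct(1) unfolding arc_def by blast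
  ultimately show thesis by (rule that)
qed

lemma crossing_inside:
  assumes g: "g \<subseteq> arc V p' q" and e: "e \<in> F \<union> sides Z" "red_crosses e g"
  shows "e \<subseteq> I1"
  using split[OF e(1)] crossing_apart[OF _ g] e(2) by blast

lemma turn_inside:
  assumes g: "g \<subseteq> arc V p' q" and t: "turn Z F g a b c d e f"
  shows "a \<in> I1" "b \<in> I1" "d \<in> I1" "e \<in> I1"
proof -
  have "{a, b} \<subseteq> I1" "{d, e} \<subseteq> I1"
    using crossing_inside[OF g, of "{a, b}"] crossing_inside[OF g, of "{d, e}"] t
    unfolding turn_def by blast+
  then show "a \<in> I1" "b \<in> I1" "d \<in> I1" "e \<in> I1" by blast+
qed

lemma turn_transfer:
  assumes g: "g \<subseteq> arc V p' q" and t: "turn Z F g a b c d e f"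
    and chord: "{b, e} \<in> F' \<longleftrightarrow> {b, e} \<in> F"
  shows "\<exists>c f. turn Z' F' g a b c d e f"
proof -
  note ed = turnD(5-10)[OF t]
  note I = turn_inside[OF g t]
  have hex: "cyc b c a" "cyc a c d" "cyc a d e" "cyc e f a"
    using turnD(1)[OF t] unfolding hexagon_def by blast+
  then have ne: "a \<noteq> b" "b \<noteq> d" "c \<noteq> b" "c \<noteq> d" "d \<noteq> e" "e \<noteq> a" "f \<noteq> e" "f \<noteq> a"
    unfolding cyc_def by (smt (verit))+
  obtain c' where c': "{b, c'} \<in> F' \<union> sides Z'" "{c', d} \<in> F' \<union> sides Z'"
    "\<And>x z. x \<in> I1 \<Longrightarrow> z \<in> I1 \<Longrightarrow> cyc x c z \<Longrightarrow> cyc x c' z"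
    using detour[OF I(2,3) ne(2) ed(2,3) ne(3,4)] by metis
  obtain f' where f': "{e, f'} \<in> F' \<union> sides Z'" "{f', a} \<in> F' \<union> sides Z'"
    "\<And>x z. x \<in> I1 \<Longrightarrow> z \<in> I1 \<Longrightarrow> cyc x f z \<Longrightarrow> cyc x f' z"
    using detour[OF I(4,1) ne(6) ed(5,6) ne(7,8)] by metis
  have "hexagon a b c' d e f'" using hex c'(3) f'(3) I unfolding hexagon_def by blast
  moreover have "{a, b} \<in> F' \<union> sides Z'" "{d, e} \<in> F' \<union> sides Z'"
    using same[of a b] same[of d e] I ne ed by blast+
  ultimately have "turn Z' F' g a b c' d e f'"
    using c'(1,2) f'(1,2) chord turnD(2-4)[OF t] unfolding turn_def by blast
  then show ?thesis by blast
qed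

end

section \<open>Restricting and joining compatible quadrangulations\<close>

lemma quad_chord:
  assumes "quad W D" "{k, l} \<in> D"
  shows "k \<in> W \<and> l \<in> W \<and> k \<noteq> l" "odd (k + l)"
proof -
  have "{k, l} \<in> odd_chords W" using assms unfolding quad_def by blast
  then have "k \<in> W \<and> l \<in> W \<and> odd (k + l)" by (simp add: odd_chords_iff)
  moreover from this have "k \<noteq> l" by auto
  ultimately show "k \<in> W \<and> l \<in> W \<and> k \<noteq> l" "odd (k + l)" by blast+
qed

context bridged
begin

lemma cquads_split:
  assumes "D \<in> cquads V E" "e \<in> D"
  shows "e \<subseteq> I1 \<or> e \<subseteq> I2"
proof (rule red_split)
  show "e \<in> odd_chords V" using assms unfolding cquads_def quad_def by blast
  show "red_compat e {p', q}" "red_compat e {q', p}" using assms inner unfolding cquads_def by blast+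
qed

lemma pq_not_side: "{p, q} \<notin> sides V" "{p, q} \<notin> sides W1"
proof -
  have pq: "p \<in> I1" "q \<in> I1" using mem by (simp_all add: arc_def)
  have "cyc q q' p" "cyc p p' q" using around by blast+
  then show "{p, q} \<notin> sides V" using finV mem distinct(1) by (auto simp: sides_iff)
  then show "{p, q} \<notin> sides W1" using sides_I1[OF pq distinct(1)] by blast
qed

text \<open>
  The chord \<open>{p, q}\<close> is crossed by no member of \<open>D\<close>, so it lies in a piece. The chord is not a side of the
  piece, as it joins vertices of the same colour; being a square, the piece has one further corner on
  each side of the chord.
\<close>

lemma middle_square:
  assumes quad: "quad V D" and split: "\<And>e. e \<in> D \<Longrightarrow> e \<subseteq> I1 \<or> e \<subseteq> I2"
  obtains a b where "a \<in> V" "cyc p a q" "{p, a} \<in> D \<union> sides V" "{q, a} \<in> D \<union> sides V"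
    "b \<in> V" "cyc q b p" "{q, b} \<in> D \<union> sides V" "{p, b} \<in> D \<union> sides V"
proof -
  let ?C = "visible V D p q"
  note chord = quad_chord[OF quad]
  have nc: "\<And>e f. e \<in> D \<Longrightarrow> f \<in> D \<Longrightarrow> \<not> crosses e f" using quad unfolding quad_def by blast
  have pqD: "{p, q} \<notin> D" using chord(2)[of p q] par_pq by blast
  have npq: "\<not> crosses e {p, q}" if e: "e \<in> D" for e
  proof
    assume "crosses e {p, q}"
    then obtain x y c d where xy: "e = {x, y}" "{p, q} = {c, d}" "cyc x c y" "cyc y d x"
      unfolding crosses_def by blast
    then have xpy: "crosses {x, y} {p, q}" using e unfolding crosses_def by blast
    have "(x = p \<or> x = q \<or> cyc p x q) \<and> (y = p \<or> y = q \<or> cyc p y q) \<or>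
      (x = p \<or> x = q \<or> cyc q x p) \<and> (y = p \<or> y = q \<or> cyc q y p)"
      using split[OF e] xy(1) unfolding arc_def by blast
    then show False using xpy unfolding crosses_iff cyc_def by (smt (verit))
  qed
  have ends: "p \<in> ?C" "q \<in> ?C" using visible_ends mem by blast+
  have sub: "?C \<subseteq> V" unfolding visible_def by blast
  then have finC: "finite ?C" using finV by (rule finite_subset)
  have "?C \<noteq> {p, q}"
  proof
    assume C: "?C = {p, q}"
    have "\<not> cyc p w q" if "w \<in> ?C" for w using that unfolding C cyc_def by auto
    then have "{p, q} \<in> D \<or> (\<forall>w\<in>V. \<not> cyc p w q)"
      using visible_next[OF finV chord(1) nc distinct(1) ends distinct(1)] by blast
    then show False using pqD around mem by blast
  qed
  then have piece: "?C \<in> gpieces V D"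
    using visible_piece[OF finV chord(1) nc distinct(1) mem(1,3) npq] by blast
  then have card4: "card ?C = 4" using quad unfolding quad_def by blast
  note edge = gpiecesD(3)[OF piece]
  have "{p, q} \<notin> sides ?C" using edge[OF ends distinct(1)] pqD pq_not_side by blast
  then have "(\<exists>a\<in>?C. cyc p a q) \<and> (\<exists>b\<in>?C. cyc q b p)"
    unfolding sides_iff[OF finC distinct(1)] using ends by blast
  then obtain a b where a: "a \<in> ?C" "cyc p a q" and b: "b \<in> ?C" "cyc q b p" by blast
  have ne: "a \<noteq> p" "a \<noteq> q" "b \<noteq> p" "b \<noteq> q" "a \<noteq> b" using a(2) b(2) unfolding cyc_def by (smt (verit))+
  have "{p, a, q, b} = ?C"
  proof (rule card_subset_eq[OF finC])
    show "{p, a, q, b} \<subseteq> ?C" using a b ends by blast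
    show "card {p, a, q, b} = card ?C" using card4 ne distinct(1) by simp
  qed
  then have C: "w = p \<or> w = a \<or> w = q \<or> w = b" if "w \<in> ?C" for w using that by blast
  have "\<not> cyc p w a" "\<not> cyc a w q" "\<not> cyc q w b" "\<not> cyc b w p" if "w \<in> ?C" for w
    using C[OF that] a(2) b(2) unfolding cyc_def by (smt (verit))+
  then have "{p, a} \<in> sides ?C" "{q, a} \<in> sides ?C" "{q, b} \<in> sides ?C" "{p, b} \<in> sides ?C"
    using a b ends ne finC by (simp_all add: sides_iff)
  then have "{p, a} \<in> D \<union> sides V" "{q, a} \<in> D \<union> sides V" "{q, b} \<in> D \<union> sides V" "{p, b} \<in> D \<union> sides V"
    using edge a(1) b(1) ends ne by metis+
  then show thesis using that a b sub by blast
qed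

lemma pq_I1: "p \<in> I1" "q \<in> I1" "p \<in> I2" "q \<in> I2"
  using mem by (simp_all add: arc_def)

lemma same_edges:
  assumes "i \<in> I1" "j \<in> I1" "i \<noteq> j"
  shows "{i, j} \<in> D \<union> sides V \<longleftrightarrow> {i, j} \<in> (D \<inter> Pow I1) \<union> sides W1"
  using sides_I1[OF assms] assms by blast

lemma I1_sub: "I1 \<subseteq> V" "I1 \<subseteq> W1" "W1 \<subseteq> V"
  using W1_eq W1_sub by auto

lemma agree_down:
  assumes "\<And>e. e \<in> D \<Longrightarrow> e \<subseteq> I1 \<or> e \<subseteq> I2"
  shows "agree V E p p' q q' V D W1 (D \<inter> Pow I1) q'"
proof
  show "V \<subseteq> V" "W1 \<subseteq> V" "I1 \<subseteq> V" "I1 \<subseteq> W1" using I1_sub by blast+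
  show "\<And>e. e \<in> D \<union> sides V \<Longrightarrow> e \<subseteq> I1 \<or> e \<subseteq> I2" using assms sides_split by blast
  show "\<And>i j. i \<in> I1 \<Longrightarrow> j \<in> I1 \<Longrightarrow> i \<noteq> j \<Longrightarrow>
    ({i, j} \<in> D \<union> sides V) = ({i, j} \<in> D \<inter> Pow I1 \<union> sides W1)" by (rule same_edges)
  show "q' \<in> W1" "cyc q q' p" using W1_eq q'_far by blast+
  have q: "q \<in> W1" "p \<in> W1" "q \<noteq> q'" "p \<noteq> q'" using pq_I1 I1_sub distinct by blast+
  show "{q, q'} \<in> D \<inter> Pow I1 \<union> sides W1" "{p, q'} \<in> D \<inter> Pow I1 \<union> sides W1"
    using sides_at_q'[of q] sides_at_q'[of p] q by blast+
  fix x assume x: "x \<in> I1" "{x, q'} \<in> D \<inter> Pow I1 \<union> sides W1"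
  then have "{x, q'} \<in> sides W1" using q'_far(2) by blast
  moreover have "x \<in> W1" "x \<noteq> q'" using x(1) I1_sub q'_far(2) by blast+
  ultimately show "x \<in> {p, q}" using sides_at_q' by blast
qed

lemma agree_up:
  assumes split: "\<And>e. e \<in> D \<Longrightarrow> e \<subseteq> I1 \<or> e \<subseteq> I2"
    and b: "b \<in> V" "cyc q b p" "{q, b} \<in> D \<union> sides V" "{p, b} \<in> D \<union> sides V"
  shows "agree V E p p' q q' W1 (D \<inter> Pow I1) V D b"
proof
  show "V \<subseteq> V" "W1 \<subseteq> V" "I1 \<subseteq> V" "I1 \<subseteq> W1" using I1_sub by blast+
  show "\<And>e. e \<in> D \<inter> Pow I1 \<union> sides W1 \<Longrightarrow> e \<subseteq> I1 \<or> e \<subseteq> I2" using sides_split_W1 by blast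
  show "\<And>i j. i \<in> I1 \<Longrightarrow> j \<in> I1 \<Longrightarrow> i \<noteq> j \<Longrightarrow>
    ({i, j} \<in> D \<inter> Pow I1 \<union> sides W1) = ({i, j} \<in> D \<union> sides V)" using same_edges by blast
  fix x assume x: "x \<in> I1" "{x, b} \<in> D \<union> sides V"
  have "b \<notin> I1" using b(1,2) I2_inner by blast
  then have "{x, b} \<subseteq> I2" using x(2) split[of "{x, b}"] sides_split[of "{x, b}"] by blast
  then show "x \<in> {p, q}" using I1_not_I2[OF x(1)] by blast
qed (use b in blast)+

text \<open>
  A piece of the small polygon that has \<open>q'\<close> as a corner contains \<open>p\<close> and \<open>q\<close>. Exchanging \<open>q'\<close> for the
  corner \<open>b\<close> of the middle square turns it into a piece of the large polygon.
\<close>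

lemma restrict:
  assumes D: "D \<in> cquads V E"
  shows "D \<inter> Pow I1 \<in> cquads W1 E1"
proof -
  let ?U = "D \<inter> Pow I1"
  have quad: "quad V D" and compat: "\<And>e f. e \<in> D \<Longrightarrow> f \<in> E \<Longrightarrow> red_compat e f"
    using D unfolding cquads_def by blast+
  note split = cquads_split[OF D]
  obtain b where b: "b \<in> V" "cyc q b p" "{q, b} \<in> D \<union> sides V" "{p, b} \<in> D \<union> sides V"
    using middle_square[OF quad split] by metis
  interpret up: agree V E p p' q q' W1 ?U V D b by (rule agree_up[OF split b])
  interpret down: agree V E p p' q q' V D W1 ?U q' by (rule agree_down[OF split])
  have "card C = 4" if C: "C \<in> gpieces W1 ?U" for C
  proof (cases "C \<subseteq> I1")
    case True
    then have "C \<in> gpieces V D" using up.piece_inside C by blast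
    then show ?thesis using quad unfolding quad_def by blast
  next
    case False
    have CW: "C \<subseteq> W1" "3 \<le> card C" using gpiecesD[OF C] by blast+
    have fin: "finite C" using CW(1) W1_sub(2) by (rule finite_subset)
    have q'C: "q' \<in> C" using False CW(1) unfolding W1_eq by blast
    have "\<exists>a\<in>C. cyc p a q"
    proof (rule ccontr)
      assume "\<not> ?thesis"
      then have sub: "C \<subseteq> {p, q, q'}" using CW(1) W1_eq unfolding arc_def by blast
      have "card {p, q, q'} = 3" using distinct by simp
      then have "C = {p, q, q'}" using CW(2) sub by (metis card_seteq finite.emptyI finite.insertI)
      moreover have "\<not> cyc p w q" if "w \<in> {p, q, q'}" for w
        using that around unfolding cyc_def by auto
      ultimately have "{p, q} \<in> sides C" "p \<in> C" "q \<in> C"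
        using sides_iff[OF fin distinct(1)] by blast+
      then have "{p, q} \<in> ?U \<union> sides W1" using gpiecesD(3)[OF C, of p q] distinct(1) by blast
      then show False using pq_not_side quad_chord(2)[OF quad, of p q] par_pq by blast
    qed
    then obtain a where a: "a \<in> C" "cyc p a q" by blast
    have pq: "p \<in> C" "q \<in> C"
      using piece_through_p[OF up.Z(1) up.split C a q'C q'_far(1)]
        piece_through_q[OF up.Z(1) up.split C a q'C q'_far(1)] by simp_all
    let ?X = "C - {q'}"
    have CX: "?X \<union> {q'} \<in> gpieces W1 ?U" using C q'C by (simp add: insert_absorb)
    have X: "?X \<subseteq> I1" "p \<in> ?X" "q \<in> ?X" using CW(1) W1_eq pq distinct by blast+
    have "insert b ?X \<in> gpieces V D" using up.piece_exchange[OF CX X] q'_far(1) by blast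
    then have "card (insert b ?X) = 4" using quad unfolding quad_def by blast
    moreover have "b \<notin> ?X" using X(1) b(1,2) I2_inner by blast
    ultimately show ?thesis using fin q'C by simp
  qed
  moreover have "?U \<subseteq> odd_chords W1 - sides W1"
  proof
    fix e assume e: "e \<in> ?U"
    then have "e \<in> odd_chords V" "e \<notin> sides V" using quad unfolding quad_def by blast+
    then obtain x y where xy: "e = {x, y}" "odd (x + y)" "x \<noteq> y" by (elim odd_chordsE)
    then have I: "x \<in> I1" "y \<in> I1" using e by blast+
    then have "e \<notin> sides W1" using sides_I1[OF I xy(3)] xy(1) \<open>e \<notin> sides V\<close> by blast
    moreover have "e \<in> odd_chords W1" using I I1_sub(2) xy by (auto simp: odd_chords_iff)
    ultimately show "e \<in> odd_chords W1 - sides W1" by blast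
  qed
  moreover have "\<forall>e\<in>?U. \<forall>f\<in>?U. \<not> crosses e f" using quad unfolding quad_def by blast
  ultimately have "quad W1 ?U" unfolding quad_def by blast
  then show ?thesis using compat unfolding cquads_def by blast
qed

text \<open>
  The inner edges of the bridge remain edges of the small polygon, one of them as a boundary edge. So
  \<open>red_split\<close> applies to the small polygon as well; beyond \<open>I1\<close> it only leaves the sides at \<open>q'\<close>.
\<close>

lemma cquads_W1_inside:
  assumes U: "U \<in> cquads W1 E1"
  shows "U \<subseteq> Pow I1"
proof
  fix e assume e: "e \<in> U"
  then have oe: "e \<in> odd_chords W1" "e \<notin> sides W1" using U unfolding cquads_def quad_def by blast+
  have "{p', q} \<in> E1" "{q', p} \<in> E1"
  proof -
    have "p' \<in> I1" using mem around unfolding arc_def by blast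
    then show "{p', q} \<in> E1" "{q', p} \<in> E1" using inner pq_I1 W1_eq by blast+
  qed
  then have "red_compat e {p', q}" "red_compat e {q', p}" using U e unfolding cquads_def by blast+
  moreover have "e \<in> odd_chords V" using oe(1) I1_sub(3) unfolding odd_chords_def by blast
  ultimately have "e \<subseteq> I1 \<or> e \<subseteq> I2" by (rule red_split[rotated])
  moreover have "e \<subseteq> W1" using oe(1) by (elim odd_chordsE) simp
  then have "e \<in> sides W1" if "e \<subseteq> I2"
    using far_edge[OF oe(1) _ that] far_sides by metis
  ultimately show "e \<in> Pow I1" using oe(2) by blast
qed

lemma chord_in_V:
  assumes U: "U \<in> cquads W1 E1" and e: "e \<in> U"
  shows "e \<in> odd_chords V - sides V"
proof -
  have oe: "e \<in> odd_chords W1" "e \<notin> sides W1" using U e unfolding cquads_def quad_def by blast+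
  then obtain x y where xy: "e = {x, y}" "odd (x + y)" "x \<noteq> y" by (elim odd_chordsE)
  then have I: "x \<in> I1" "y \<in> I1" using e cquads_W1_inside[OF U] by blast+
  then show ?thesis using sides_I1[OF I xy(3)] xy I1_sub(1) oe(2) by (auto simp: odd_chords_iff)
qed

text \<open>
  A piece that lies on both sides passes through \<open>p\<close> and \<open>q\<close>. Its section on either arc, completed by \<open>q'\<close> or
  \<open>p'\<close>, is a piece of a small polygon and thus has three vertices on that arc. Two of them are \<open>p\<close> and \<open>q\<close>.
\<close>

lemma join:
  assumes U: "U \<in> cquads W1 E1" and U': "U' \<in> cquads W2 E2"
  shows "U \<union> U' \<in> cquads V E" "(U \<union> U') \<inter> Pow I1 = U" "(U \<union> U') \<inter> Pow I2 = U'"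
proof -
  interpret sw: bridged V E q q' p p' by (rule swapped)
  let ?D = "U \<union> U'"
  have sub: "U \<subseteq> Pow I1" "U' \<subseteq> Pow I2" using cquads_W1_inside[OF U] sw.cquads_W1_inside[OF U'] .
  have odd: "U \<subseteq> odd_chords W1" "U' \<subseteq> odd_chords W2"
    using U U' unfolding cquads_def quad_def by blast+
  have "e \<notin> Pow I1" if "e \<in> U'" for e
    using no_odd_chord_in_both[of e W2] that sub(2) odd(2) by blast
  then show eq1: "?D \<inter> Pow I1 = U" using sub(1) by blast
  have "e \<notin> Pow I2" if "e \<in> U" for e
    using no_odd_chord_in_both[of e W1] that sub(1) odd(1) by blast
  then show eq2: "?D \<inter> Pow I2 = U'" using sub(2) by blast
  have split: "\<And>e. e \<in> ?D \<Longrightarrow> e \<subseteq> I1 \<or> e \<subseteq> I2" using sub by blast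
  then have split': "\<And>e. e \<in> ?D \<Longrightarrow> e \<subseteq> I2 \<or> e \<subseteq> I1" by blast
  have "agree V E p p' q q' V ?D W1 (?D \<inter> Pow I1) q'" by (rule agree_down) (rule split)
  then interpret d1: agree V E p p' q q' V ?D W1 U q' unfolding eq1 .
  have "agree V E q q' p p' V ?D W2 (?D \<inter> Pow I2) p'" by (rule sw.agree_down) (rule split')
  then interpret d2: agree V E q q' p p' V ?D W2 U' p' unfolding eq2 .
  have four1: "\<And>C. C \<in> gpieces W1 U \<Longrightarrow> card C = 4" using U unfolding cquads_def quad_def by blast
  have four2: "\<And>C. C \<in> gpieces W2 U' \<Longrightarrow> card C = 4" using U' unfolding cquads_def quad_def by blast
  have "card C = 4" if C: "C \<in> gpieces V ?D" for C
  proof -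
    have CV: "C \<subseteq> V" using gpiecesD(1)[OF C] .
    then have fin: "finite C" using finV by (rule finite_subset)
    consider "C \<subseteq> I1" | "C \<subseteq> I2" | a b where "a \<in> C" "cyc p a q" "b \<in> C" "cyc q b p"
      using CV I1_inner I2_inner by blast
    then show ?thesis
    proof cases
      case 1
      then show ?thesis using d1.piece_inside[OF C] four1 by blast
    next
      case 2
      then show ?thesis using d2.piece_inside[OF C] four2 by blast
    next
      case 3
      have pq: "p \<in> C" "q \<in> C"
        using piece_through_p[OF d1.Z(1) d1.split C 3] piece_through_q[OF d1.Z(1) d1.split C 3]
        by simp_all
      let ?X = "C \<inter> I1" and ?X' = "C \<inter> I2"
      have CX: "?X \<union> (C - I1) \<in> gpieces V ?D" "?X' \<union> (C - I2) \<in> gpieces V ?D"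
        using C by (simp_all add: Int_Diff_Un)
      have far: "cyc q y p" if "y \<in> C - I1" for y using that CV I2_inner by blast
      have far': "cyc p y q" if "y \<in> C - I2" for y using that CV I1_inner by blast
      have ne: "C - I1 \<noteq> {}" "C - I2 \<noteq> {}" using 3 CV I1_inner I2_inner by blast+
      have "insert q' ?X \<in> gpieces W1 U"
        by (rule d1.piece_exchange[OF CX(1) _ _ _ ne(1) far]) (use pq pq_I1 in auto)
      then have "card (insert q' ?X) = 4" by (rule four1)
      moreover have "q' \<notin> ?X" using q'_far by blast
      ultimately have c1: "card ?X = 3" using fin by simp
      have "insert p' ?X' \<in> gpieces W2 U'"
        by (rule d2.piece_exchange[OF CX(2) _ _ _ ne(2) far']) (use pq pq_I1 in auto)
      then have "card (insert p' ?X') = 4" by (rule four2)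
      moreover have "p' \<notin> ?X'" using sw.q'_far by blast
      ultimately have c2: "card ?X' = 3" using fin by simp
      have "?X \<inter> ?X' = {p, q}" using pq pq_I1 I1_not_I2 by blast
      then have "card (?X \<inter> ?X') = 2" using distinct(1) by simp
      moreover have "?X \<union> ?X' = C" using CV I_Un by blast
      ultimately show ?thesis using card_Un_Int[of ?X ?X'] fin c1 c2 by simp
    qed
  qed
  moreover have "?D \<subseteq> odd_chords V - sides V"
    using chord_in_V[OF U] sw.chord_in_V[OF U'] by blast
  moreover have "\<forall>e\<in>?D. \<forall>f\<in>?D. \<not> crosses e f"
  proof -
    have apart: "\<not> crosses e f" if ef: "e \<subseteq> I1" "f \<subseteq> I2" for e f
    proof
      assume "crosses e f"
      then obtain x y c d where xy: "e = {x, y}" "f = {c, d}" "cyc x c y" "cyc y d x"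
        unfolding crosses_def by blast
      then have "x = p \<or> x = q \<or> cyc p x q" "y = p \<or> y = q \<or> cyc p y q"
        "c = p \<or> c = q \<or> cyc q c p" "d = p \<or> d = q \<or> cyc q d p"
        using ef unfolding arc_def by blast+
      then show False using xy(3,4) unfolding cyc_def by (smt (verit))
    qed
    have own: "\<forall>e\<in>U. \<forall>f\<in>U. \<not> crosses e f" "\<forall>e\<in>U'. \<forall>f\<in>U'. \<not> crosses e f"
      using U U' unfolding cquads_def quad_def by blast+
    show ?thesis
    proof (intro ballI)
      fix e f assume "e \<in> ?D" "f \<in> ?D"
      then consider "e \<in> U" "f \<in> U" | "e \<in> U'" "f \<in> U'"
        | "e \<subseteq> I1" "f \<subseteq> I2" | "e \<subseteq> I2" "f \<subseteq> I1" using sub by blast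
      then show "\<not> crosses e f"
        using own apart[of e f] apart[of f e] crosses_sym[of e f] by cases blast+
    qed
  qed
  ultimately have "quad V ?D" unfolding quad_def by blast
  moreover have "red_compat e f" if e: "e \<in> ?D" and f: "f \<in> E" for e f
  proof -
    have ends: "p \<in> W1" "p' \<in> W1" "q \<in> W1" "q' \<in> W1" "p \<in> W2" "p' \<in> W2" "q \<in> W2" "q' \<in> W2"
      using W1_eq sw.W1_eq pq_I1 mem around by (auto simp: arc_def)
    have J: "arc V p' q \<subseteq> W1" "arc V q' p \<subseteq> W2"
    proof -
      show "arc V p' q \<subseteq> W1" using around unfolding arc_def cyc_def by auto
      show "arc V q' p \<subseteq> W2" using around unfolding arc_def cyc_def by auto
    qed
    have own: "red_compat e f" if "e \<in> U \<and> f \<subseteq> W1 \<or> e \<in> U' \<and> f \<subseteq> W2"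
      using that U U' f unfolding cquads_def by blast
    have apart: "red_compat e f" if "e \<subseteq> I1 \<and> f \<subseteq> arc V q' p \<or> e \<subseteq> I2 \<and> f \<subseteq> arc V p' q"
    proof (rule red_compat_if_not_red_crosses, rule notI)
      assume "red_crosses e f"
      then show False using that crossing_apart sw.crossing_apart by blast
    qed
    consider "f \<subseteq> W1 \<and> f \<subseteq> W2" | "f \<subseteq> arc V p' q" | "f \<subseteq> arc V q' p"
      using E_split[OF f] ends by blast
    then show ?thesis
    proof cases
      case 1
      then show ?thesis using own e by blast
    next
      case 2
      then show ?thesis using own apart e J sub by blast
    next
      case 3
      then show ?thesis using own apart e J sub by blast
    qed
  qed
  ultimately show "?D \<in> cquads V E" unfolding cquads_def by blast
qed

end

section \<open>Flips stay on one side of the bridge\<close>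

text \<open>
  Only the red vertex \<open>u\<close> is between the blue vertices \<open>u\<close> and \<open>u'\<close>.
\<close>

lemma cross_side:
  assumes "x \<in> Z" "y \<in> Z" "\<And>v. v \<in> Z \<Longrightarrow> \<not> cyc u v u'" "red_crosses {x, y} {u, u'}"
  shows "u \<in> {x, y}"
proof -
  have "\<not> cyc u x u'" "\<not> cyc u y u'" using assms by blast+
  then have "u = x \<or> u = y"
    using assms(4) unfolding red_crosses_iff alternate_iff cyc_def by (smt (verit))
  then show ?thesis by blast
qed

text \<open>
  The two sides of the hexagon that \<open>g\<close> crosses would both end at \<open>u\<close>.
\<close>

lemma turn_not_at_side:
  assumes t: "turn Y D g a b c d e f" and Z: "{a, b, d, e} \<subseteq> Z" and u: "\<And>v. v \<in> Z \<Longrightarrow> \<not> cyc u v u'"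
  shows "g \<noteq> {u, u'}"
proof
  assume g: "g = {u, u'}"
  have r: "red_crosses {a, b} {u, u'}" "red_crosses {d, e} {u, u'}" and hex: "hexagon a b c d e f"
    using t g unfolding turn_def by blast+
  have "a \<in> Z" "b \<in> Z" "d \<in> Z" "e \<in> Z" using Z by blast+
  then have "u \<in> {a, b}" "u \<in> {d, e}" using cross_side[OF _ _ u r(1)] cross_side[OF _ _ u r(2)] by simp_all
  then show False using hex unfolding hexagon_def cyc_def by auto
qed

context bridged
begin

lemma J_sub: "arc V p' q \<subseteq> W1"
  using around unfolding arc_def cyc_def by auto

lemma turn_one_side:
  assumes g: "g \<in> E" and t: "turn Z D g a b c d e f" and Z: "{a, b, d, e} \<subseteq> V"
  shows "g \<subseteq> arc V p' q \<or> g \<subseteq> arc V q' p"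
  using E_split[OF g] turn_not_at_side[OF t Z, of p p'] turn_not_at_side[OF t Z, of q q'] adj by blast

text \<open>
  All four ends of the exchanged diagonals are ends of the sides that \<open>g\<close> crosses, so they lie on \<open>I1\<close>.
\<close>

lemma flip_down:
  assumes D: "D \<in> cquads V E" and D': "D' \<in> cquads V E" and g: "g \<in> E" "g \<subseteq> arc V p' q"
    and t: "turn V D g a b c d e f" and ad: "{a, d} \<notin> D" "D' = insert {a, d} (D - {{b, e}})"
  shows "cflip W1 E1 (D \<inter> Pow I1) (D' \<inter> Pow I1)" "D \<inter> Pow I2 = D' \<inter> Pow I2"
proof -
  have "agree V E p p' q q' V D W1 (D \<inter> Pow I1) q'" by (rule agree_down) (rule cquads_split[OF D])
  then interpret ag: agree V E p p' q q' V D W1 "D \<inter> Pow I1" q' .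
  note I = ag.turn_inside[OF g(2) t]
  have "\<exists>c f. turn W1 (D \<inter> Pow I1) g a b c d e f"
    by (rule ag.turn_transfer[OF g(2) t]) (use I in simp)
  moreover have "g \<in> E1" using g J_sub by blast
  moreover have "D' \<inter> Pow I1 = insert {a, d} (D \<inter> Pow I1 - {{b, e}})"
    using ad(2) I by auto
  ultimately show "cflip W1 E1 (D \<inter> Pow I1) (D' \<inter> Pow I1)"
    unfolding cflip_def using restrict[OF D] restrict[OF D'] ad(1) by blast
  have "{b, e} \<in> D" "{a, d} \<in> D'" using t ad(2) unfolding turn_def by blast+
  then have odd: "{b, e} \<in> odd_chords V" "{a, d} \<in> odd_chords V"
    using D D' unfolding cquads_def quad_def by blast+
  then have "\<not> {b, e} \<subseteq> I2" "\<not> {a, d} \<subseteq> I2"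
    using no_odd_chord_in_both[OF odd(1)] no_odd_chord_in_both[OF odd(2)] I by blast+
  then show "D \<inter> Pow I2 = D' \<inter> Pow I2" using ad(2) by blast
qed

text \<open>
  In the small polygon \<open>g\<close> cannot be the edge \<open>{q', p}\<close>, at which the polygon was cut, since this is a
  boundary edge there.
\<close>

lemma flip_up:
  assumes D: "D \<in> cquads V E" and D': "D' \<in> cquads V E"
    and fl: "cflip W1 E1 (D \<inter> Pow I1) (D' \<inter> Pow I1)" and eq: "D \<inter> Pow I2 = D' \<inter> Pow I2"
  shows "cflip V E D D'"
proof -
  let ?U = "D \<inter> Pow I1" and ?U' = "D' \<inter> Pow I1"
  obtain g a b c d e f where g: "g \<in> E1" and t: "turn W1 ?U g a b c d e f"
    and ad: "{a, d} \<notin> ?U" "?U' = insert {a, d} (?U - {{b, e}})"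
    using fl by (elim cflipE)
  from g have g: "g \<in> E" "g \<subseteq> W1" by simp_all
  have quad: "quad V D" using D unfolding cquads_def by blast
  obtain m where m: "m \<in> V" "cyc q m p" "{q, m} \<in> D \<union> sides V" "{p, m} \<in> D \<union> sides V"
    using middle_square[OF quad cquads_split[OF D]] by metis
  have "agree V E p p' q q' W1 ?U V D m" by (rule agree_up[OF _ m]) (rule cquads_split[OF D])
  then interpret ag: agree V E p p' q q' W1 ?U V D m .
  have be: "{b, e} \<in> ?U" using t unfolding turn_def by (elim conjE)
  have "{a, d} \<in> ?U'" unfolding ad(2) by simp
  then have tI: "{a, d} \<subseteq> I1" "{b, e} \<subseteq> I1" using be by simp_all
  then have W: "{a, b, d, e} \<subseteq> W1" "{a, b, d, e} \<subseteq> V" using I1_sub by blast+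
  have gJ: "g \<subseteq> arc V p' q"
  proof (rule ccontr)
    assume "\<not> g \<subseteq> arc V p' q"
    then have "g \<subseteq> arc V q' p" using turn_one_side[OF g(1) t W(2)] by blast
    moreover have far: "\<not> cyc q' v p" if "v \<in> W1" for v
    proof -
      have "v = q' \<or> v = p \<or> v = q \<or> cyc p v q" using that[unfolded W1_eq] unfolding arc_def by blast
      then show ?thesis using around unfolding cyc_def by (smt (verit))
    qed
    then have "arc V q' p \<inter> W1 \<subseteq> {q', p}" unfolding arc_def[of V q' p] by blast
    ultimately have "g \<subseteq> {q', p}" using g(2) by blast
    moreover obtain x y where "g = {x, y}" "x \<noteq> y"
      using subsetD[OF EV g(1)] by (elim odd_chordsE)
    ultimately have "g = {q', p}" by blast
    then show False using turn_not_at_side[OF t W(1), of q' p] far by blast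
  qed
  have "\<exists>c f. turn V D g a b c d e f"
    by (rule ag.turn_transfer[OF gJ t]) (use tI in simp)
  moreover have "{a, d} \<notin> D" using ad(1) tI by blast
  moreover have "D' = insert {a, d} (D - {{b, e}})"
  proof -
    have "{b, e} \<in> odd_chords V" using be quad unfolding quad_def by blast
    then have "\<not> {b, e} \<subseteq> I2" using tI(2) by (rule no_odd_chord_in_both)
    then have be2: "{b, e} \<notin> D \<inter> Pow I2" by simp
    have "D' = ?U' \<union> D' \<inter> Pow I2" using cquads_split[OF D'] by blast
    then have "D' = insert {a, d} (?U - {{b, e}}) \<union> D \<inter> Pow I2" unfolding ad(2) eq .
    also have "\<dots> = insert {a, d} ((?U \<union> D \<inter> Pow I2) - {{b, e}})" using be2 by blast
    also have "?U \<union> D \<inter> Pow I2 = D" using cquads_split[OF D] by blast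
    finally show ?thesis .
  qed
  ultimately show ?thesis unfolding cflip_def using D D' g(1) by (intro conjI bexI[of _ g]) blast+
qed

lemma flip_split:
  assumes D: "D \<in> cquads V E" and D': "D' \<in> cquads V E"
  shows "cflip V E D D' \<longleftrightarrow>
    cflip W1 E1 (D \<inter> Pow I1) (D' \<inter> Pow I1) \<and> D \<inter> Pow I2 = D' \<inter> Pow I2 \<or>
    cflip W2 E2 (D \<inter> Pow I2) (D' \<inter> Pow I2) \<and> D \<inter> Pow I1 = D' \<inter> Pow I1" (is "_ \<longleftrightarrow> ?R")
proof
  interpret sw: bridged V E q q' p p' by (rule swapped)
  show "cflip V E D D'" if ?R
    using that flip_up[OF D D'] sw.flip_up[OF D D'] by blast
  assume "cflip V E D D'"
  then obtain g a b c d e f where g: "g \<in> E" and t: "turn V D g a b c d e f"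
    and ad: "{a, d} \<notin> D" "D' = insert {a, d} (D - {{b, e}})"
    by (elim cflipE)
  have "{b, e} \<in> D" "{a, d} \<in> D'" using t ad(2) unfolding turn_def by blast+
  then have odd: "{b, e} \<in> odd_chords V" "{a, d} \<in> odd_chords V"
    using D D' unfolding cquads_def quad_def by blast+
  from odd have "{a, b, d, e} \<subseteq> V" by (simp add: odd_chords_iff)
  from turn_one_side[OF g t this] show ?R
    using flip_down[OF D D' g _ t ad] sw.flip_down[OF D D' g _ t ad] by blast
qed

lemma cquads_parts: "D \<in> cquads V E \<Longrightarrow> D = D \<inter> Pow I1 \<union> D \<inter> Pow I2"
  using cquads_split by blast

lemma restrict2: "D \<in> cquads V E \<Longrightarrow> D \<inter> Pow I2 \<in> cquads W2 E2"
proof -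
  interpret sw: bridged V E q q' p p' by (rule swapped)
  show "D \<in> cquads V E \<Longrightarrow> D \<inter> Pow I2 \<in> cquads W2 E2" by (rule sw.restrict)
qed

end

section \<open>Chords of a circle\<close>

text \<open>
  The determinant of \<open>(b - a, c - a)\<close>: positive iff \<open>a\<close>, \<open>b\<close>, \<open>c\<close> is a counterclockwise triangle.
\<close>

definition orient :: "complex \<Rightarrow> complex \<Rightarrow> complex \<Rightarrow> real" where
  "orient a b c = Im (cnj (b - a) * (c - a))"

lemma orient_swap: "orient a c b = - orient a b c"
  by (simp add: orient_def algebra_simps)

lemma orient_affine:
  "orient a b ((1 - t) *\<^sub>R c + t *\<^sub>R d) = (1 - t) * orient a b c + t * orient a b d"
  by (simp add: orient_def algebra_simps)

lemma orient_cis: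
  "orient (cis x) (cis y) (cis z) = 4 * sin ((y - x) / 2) * sin ((z - x) / 2) * sin ((z - y) / 2)"
proof -
  let ?P = "(x + y) / 2" and ?R = "(x + z) / 2"
  have "orient (cis x) (cis y) (cis z) =
      (cos y - cos x) * (sin z - sin x) - (sin y - sin x) * (cos z - cos x)"
    by (simp add: orient_def algebra_simps)
  also have "cos y - cos x = - 2 * sin ?P * sin ((y - x) / 2)"
    using cos_diff_cos[of y x] sin_minus[of "(y - x) / 2"] by (simp add: add.commute minus_divide_left)
  also have "sin y - sin x = 2 * cos ?P * sin ((y - x) / 2)"
    using sin_diff_sin[of y x] by (simp add: add.commute)
  also have "cos z - cos x = - 2 * sin ?R * sin ((z - x) / 2)"
    using cos_diff_cos[of z x] sin_minus[of "(z - x) / 2"] by (simp add: add.commute minus_divide_left)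
  also have "sin z - sin x = 2 * cos ?R * sin ((z - x) / 2)"
    using sin_diff_sin[of z x] by (simp add: add.commute)
  finally have "orient (cis x) (cis y) (cis z) =
      4 * sin ((y - x) / 2) * sin ((z - x) / 2) * (sin ?R * cos ?P - cos ?R * sin ?P)"
    by (simp add: algebra_simps)
  also have "sin ?R * cos ?P - cos ?R * sin ?P = sin (?R - ?P)" by (simp add: sin_diff)
  also have "?R - ?P = (z - y) / 2" by (simp add: field_simps)
  finally show ?thesis .
qed

definition pt :: "nat \<Rightarrow> nat \<Rightarrow> complex" where
  "pt N x = cis (- (2 * pi * real x / real N))"

lemma blue_eq: "blue n k = pt (4 * n + 4) (2 * k)"
  unfolding blue_def pt_def by (rule arg_cong[where f = cis]) (simp add: field_simps)

lemma red_eq: "red n k = pt (4 * n + 4) (2 * k + 1)"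
proof -
  have "- (2 * pi / M) + - (2 * pi * x / M) = - (2 * pi * (x + 1) / M)" for x M :: real
    by (simp add: add_divide_distrib distrib_left)
  note sum = this[of "real (4 * n + 4)" "real (2 * k)"]
  have "real (2 * k + 1) = real (2 * k) + 1" by simp
  then show ?thesis unfolding red_def blue_eq pt_def cis_mult sum by (simp only:)
qed

lemma sin_gap: "x < y \<Longrightarrow> y < N \<Longrightarrow> 0 < sin (pi * (real y - real x) / real N)"
proof -
  assume xy: "x < y" "y < N"
  then have "0 < (real y - real x) / real N" "(real y - real x) / real N < 1"
    by (auto simp: field_simps)
  then have "0 < pi * ((real y - real x) / real N)" "pi * ((real y - real x) / real N) < pi"
    using mult_strict_left_mono[of "(real y - real x) / real N" 1 pi]
      mult_pos_pos[OF pi_gt_zero, of "(real y - real x) / real N"] by simp_all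
  then show ?thesis using sin_gt_zero[of "pi * ((real y - real x) / real N)"]
    by (simp only: times_divide_eq_right)
qed

text \<open>
  For points on a circle the determinant is a product of sines of half the differences of the angles.
\<close>

lemma orient_pt:
  assumes "x < N" "y < N" "z < N"
  shows "orient (pt N x) (pt N y) (pt N z) < 0 \<longleftrightarrow> cyc x y z"
    and "orient (pt N x) (pt N y) (pt N z) > 0 \<longleftrightarrow> cyc x z y"
proof -
  define S where "S x y = sin (pi * (real y - real x) / real N)" for x y :: nat
  have S_pos: "x < y \<Longrightarrow> y < N \<Longrightarrow> 0 < S x y" for x y unfolding S_def by (rule sin_gap)
  have S_swap: "S y x = - S x y" for x y
  proof -
    have "pi * (real x - real y) = - (pi * (real y - real x))" by (simp add: algebra_simps)
    then show ?thesis unfolding S_def by (metis minus_divide_left sin_minus)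
  qed
  have eq: "orient (pt N x) (pt N y) (pt N z) = - (4 * S x y * S x z * S y z)" for x y z
  proof -
    have "(- (2 * pi * real y / real N) - - (2 * pi * real x / real N)) / 2
        = - (pi * (real y - real x) / real N)" for x y
      by (simp add: diff_divide_distrib right_diff_distrib)
    then show ?thesis unfolding pt_def orient_cis S_def by simp
  qed
  have neg: "orient (pt N x) (pt N y) (pt N z) < 0" if c: "cyc x y z" and N: "x < N" "y < N" "z < N" for x y z
  proof -
    consider "x < y" "y < z" | "y < z" "z < x" | "z < x" "x < y" using c unfolding cyc_def by blast
    then have "0 < S x y * S x z * S y z"
    proof cases
      case 1
      then show ?thesis using S_pos[of x y] S_pos[of y z] S_pos[of x z] N by simp
    next
      case 2
      then show ?thesis
        using S_pos[of y x] S_pos[of y z] S_pos[of z x] N S_swap[of x y] S_swap[of x z] by simp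
    next
      case 3
      then show ?thesis
        using S_pos[of x y] S_pos[of z y] S_pos[of z x] N S_swap[of y z] S_swap[of x z]
        by (simp add: zero_less_mult_iff)
    qed
    then show ?thesis unfolding eq by simp
  qed
  have zero: "orient (pt N x) (pt N y) (pt N z) = 0" if "x = y \<or> y = z \<or> x = z"
    using that unfolding eq S_def by auto
  have pos: "orient (pt N x) (pt N y) (pt N z) > 0" if "cyc x z y"
    using neg[OF that] assms orient_swap[of "pt N x" "pt N z" "pt N y"] by simp
  consider "cyc x y z" | "cyc x z y" | "x = y \<or> y = z \<or> x = z" using cyc_total by blast
  then have "(orient (pt N x) (pt N y) (pt N z) < 0 \<longleftrightarrow> cyc x y z) \<and>
    (orient (pt N x) (pt N y) (pt N z) > 0 \<longleftrightarrow> cyc x z y)"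
  proof cases
    case 1
    then have "\<not> cyc x z y" unfolding cyc_def by auto
    then show ?thesis using 1 neg[OF 1] assms by simp
  next
    case 2
    then have "\<not> cyc x y z" unfolding cyc_def by auto
    then show ?thesis using 2 pos[OF 2] by simp
  next
    case 3
    then have "\<not> cyc x y z" "\<not> cyc x z y" unfolding cyc_def by auto
    then show ?thesis using zero[OF 3] by simp
  qed
  then show "orient (pt N x) (pt N y) (pt N z) < 0 \<longleftrightarrow> cyc x y z"
    "orient (pt N x) (pt N y) (pt N z) > 0 \<longleftrightarrow> cyc x z y" by blast+
qed

lemma on_open_segment: "x \<in> open_segment a b \<longleftrightarrow> a \<noteq> b \<and> (\<exists>t. 0 < t \<and> t < 1 \<and> x = linepath a b t)"
  by (simp add: in_segment linepath_def)

lemma orient_linepath: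
  "orient a b (linepath c d t) = (1 - t) * orient a b c + t * orient a b d"
  unfolding linepath_def by (rule orient_affine)

lemma orient_ends: "orient a b a = 0" "orient a b b = 0"
  by (simp_all add: orient_def algebra_simps)

lemma orient_open_segment: "x \<in> open_segment a b \<Longrightarrow> orient a b x = 0"
  by (auto simp: on_open_segment orient_linepath orient_ends)

text \<open>
  The common point divides both segments in the ratio of the distances of their ends from the other line.
\<close>

lemma open_segments_meet:
  assumes "orient a b c * orient a b d < 0" "orient c d a * orient c d b < 0"
  shows "open_segment a b \<inter> open_segment c d \<noteq> {}"
proof -
  define K where "K = orient a b d - orient a b c"
  define s where "s = orient a b c / (orient a b c - orient a b d)"
  define t where "t = orient c d a / (orient c d a - orient c d b)"
  have unit: "0 < u / (u - v) \<and> u / (u - v) < 1" if "u * v < 0" for u v :: real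
    using that by (cases "u > 0") (auto simp: mult_less_0_iff divide_simps)
  have K0: "K \<noteq> 0" using assms(1) unfolding K_def by (auto simp: mult_less_0_iff)
  have "orient c d a - orient c d b = K"
    unfolding K_def by (simp add: orient_def algebra_simps)
  then have tK: "t * K = orient c d a" unfolding t_def using K0 by simp
  have "s = orient a b c / (- K)" unfolding s_def K_def by simp
  then have sK: "s * K = - orient a b c" using K0 by simp
  have "K * (Re c - Re a) = t * K * (Re b - Re a) - s * K * (Re d - Re c)"
    "K * (Im c - Im a) = t * K * (Im b - Im a) - s * K * (Im d - Im c)"
    unfolding tK sK unfolding K_def by (simp_all add: orient_def algebra_simps)
  then have "K * (Re c - Re a) = K * (t * (Re b - Re a) - s * (Re d - Re c))"
    "K * (Im c - Im a) = K * (t * (Im b - Im a) - s * (Im d - Im c))"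
    by (simp_all add: algebra_simps)
  then have "Re c - Re a = t * (Re b - Re a) - s * (Re d - Re c)"
    "Im c - Im a = t * (Im b - Im a) - s * (Im d - Im c)"
    using K0 by (simp_all only: mult_cancel_left simp_thms)
  then have eq: "linepath a b t = linepath c d s"
    by (simp add: linepath_def complex_eq_iff algebra_simps)
  have ne: "a \<noteq> b" "c \<noteq> d" using assms by (auto simp: orient_def)
  have "0 < s \<and> s < 1" "0 < t \<and> t < 1" unfolding s_def t_def using unit assms by blast+
  then have "linepath a b t \<in> open_segment a b" "linepath c d s \<in> open_segment c d"
    unfolding on_open_segment using ne by blast+
  then show ?thesis using eq by auto
qed

text \<open>
  If they meet, then the signed distances of the ends of the second chord from the line of the first one
  have opposite signs or both vanish, and in the latter case the chords have the same ends.
\<close>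

lemma chords_meet_iff:
  assumes "x < N" "y < N" "z < N" "w < N" "x \<noteq> y" "z \<noteq> w" "{x, y} \<noteq> {z, w}"
  shows "open_segment (pt N x) (pt N y) \<inter> open_segment (pt N z) (pt N w) \<noteq> {} \<longleftrightarrow>
    cyc x z y \<and> cyc y w x \<or> cyc x w y \<and> cyc y z x" (is "?L \<longleftrightarrow> ?R")
proof
  assume ?L
  then obtain v where v: "v \<in> open_segment (pt N x) (pt N y)" "v \<in> open_segment (pt N z) (pt N w)"
    by blast
  then obtain t where t: "0 < t" "t < 1"
    and "linepath (pt N z) (pt N w) t \<in> open_segment (pt N x) (pt N y)"
    unfolding on_open_segment[of v "pt N z"] by blast
  then have 0: "(1 - t) * orient (pt N x) (pt N y) (pt N z) + t * orient (pt N x) (pt N y) (pt N w) = 0"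
    using orient_open_segment orient_linepath by metis
  note oz = orient_pt[OF assms(1,2,3)] and ow = orient_pt[OF assms(1,2,4)]
  consider "orient (pt N x) (pt N y) (pt N z) = 0" "orient (pt N x) (pt N y) (pt N w) = 0"
    | "orient (pt N x) (pt N y) (pt N z) < 0" "orient (pt N x) (pt N y) (pt N w) > 0"
    | "orient (pt N x) (pt N y) (pt N z) > 0" "orient (pt N x) (pt N y) (pt N w) < 0"
    using 0 t by (smt (verit) mult_pos_pos mult_pos_neg mult_eq_0_iff)
  then show ?R
  proof cases
    case 1
    then have "\<not> cyc x y z" "\<not> cyc x z y" "\<not> cyc x y w" "\<not> cyc x w y" using oz ow by auto
    then have "z \<in> {x, y}" "w \<in> {x, y}" using assms(5) cyc_total[of x y z] cyc_total[of x y w] by blast+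
    then show ?thesis using assms(6,7) by auto
  next
    case 2
    then show ?thesis using oz ow unfolding cyc_def by auto
  next
    case 3
    then show ?thesis using oz ow unfolding cyc_def by auto
  qed
next
  assume R: ?R
  have "cyc x y w \<and> cyc x z y \<or> cyc x y z \<and> cyc x w y" "cyc z w y \<and> cyc z x w \<or> cyc z w x \<and> cyc z y w"
    using R unfolding cyc_def by (smt (verit))+
  then have "orient (pt N x) (pt N y) (pt N z) * orient (pt N x) (pt N y) (pt N w) < 0"
    "orient (pt N z) (pt N w) (pt N x) * orient (pt N z) (pt N w) (pt N y) < 0"
    unfolding mult_less_0_iff orient_pt[OF assms(1,2,3)] orient_pt[OF assms(1,2,4)]
      orient_pt[OF assms(3,4,1)] orient_pt[OF assms(3,4,2)] by blast+
  then show ?L by (rule open_segments_meet)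
qed

lemma chord_pair: "chord P {a, b} = open_segment (P a) (P b)"
proof (cases "a \<le> b")
  case True
  then show ?thesis by (simp add: chord_def)
next
  case False
  then show ?thesis by (simp add: chord_def open_segment_commute)
qed

lemma blue_chords_meet:
  assumes "{a, b} \<subseteq> verts_of n" "{c, d} \<subseteq> verts_of n" "a \<noteq> b" "c \<noteq> d" "{a, b} \<noteq> {c, d}"
  shows "chord (blue n) {a, b} \<inter> chord (blue n) {c, d} = {} \<longleftrightarrow> \<not> crosses {a, b} {c, d}"
proof -
  have "{2 * a, 2 * b} \<noteq> {2 * c, 2 * d}" using assms(5) by (auto simp: doubleton_eq_iff)
  moreover have "cyc (2 * x) (2 * y) (2 * z) \<longleftrightarrow> cyc x y z" for x y z unfolding cyc_def by simp
  ultimately have "chord (blue n) {a, b} \<inter> chord (blue n) {c, d} \<noteq> {} \<longleftrightarrow> crosses {a, b} {c, d}"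
    unfolding chord_pair blue_eq crosses_iff
    using chords_meet_iff[of "2 * a" "4 * n + 4" "2 * b" "2 * c" "2 * d"] assms(1-4)
    by (simp add: verts_of_def)
  then show ?thesis by blast
qed

lemma red_blue_chords_meet:
  assumes "{a, b} \<subseteq> verts_of n" "{c, d} \<subseteq> verts_of n" "a \<noteq> b" "c \<noteq> d"
  shows "chord (red n) {a, b} \<inter> chord (blue n) {c, d} = {} \<longleftrightarrow> \<not> red_crosses {a, b} {c, d}"
proof -
  have "2 * a + 1 \<noteq> 2 * c" "2 * a + 1 \<noteq> 2 * d" by presburger+
  then have "{2 * a + 1, 2 * b + 1} \<noteq> {2 * c, 2 * d}" by auto
  then have "chord (red n) {a, b} \<inter> chord (blue n) {c, d} \<noteq> {} \<longleftrightarrow> red_crosses {a, b} {c, d}"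
    unfolding chord_pair blue_eq red_eq red_crosses_iff alternate_def
    using chords_meet_iff[of "2 * a + 1" "4 * n + 4" "2 * b + 1" "2 * c" "2 * d"] assms
    by (simp add: verts_of_def)
  then show ?thesis by blast
qed

lemma white_black:
  assumes "even a" "odd b"
  shows "white_end {a, b} = a" "black_end {a, b} = b"
  unfolding white_end_def black_end_def using assms by (auto intro!: the_equality)

lemma white_blackE:
  assumes "e \<in> odd_chords W"
  obtains a b where "e = {a, b}" "a \<in> W" "b \<in> W" "even a" "odd b" "a \<noteq> b"
proof -
  obtain a b where ab: "e = {a, b}" "a \<in> W" "b \<in> W" "odd (a + b)" "a \<noteq> b"
    using assms by (elim odd_chordsE)
  show thesis
  proof (cases "even a")
    case True
    then show thesis using ab that by auto
  next
    case False
    then have "e = {b, a}" "even b" using ab by auto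
    then show thesis using ab False that by auto
  qed
qed

text \<open>
  With white ends \<open>a\<close>, \<open>c\<close> and black ends \<open>b\<close>, \<open>d\<close>, the determinant of the two directions is the signed
  distance of \<open>d\<close> minus that of \<open>c\<close> from the red line, up to a positive factor. At a crossing the two
  distances have different signs, so it is positive iff \<open>d\<close> is on the left of the red edge.
\<close>

lemma compatible_iff:
  assumes "e \<in> odd_chords (verts_of n)" "f \<in> odd_chords (verts_of n)"
  shows "compatible n e f \<longleftrightarrow> red_compat e f"
proof -
  obtain a b where e: "e = {a, b}" "a \<in> verts_of n" "b \<in> verts_of n" "even a" "odd b" "a \<noteq> b"
    using assms(1) by (elim white_blackE)
  obtain c d where f: "f = {c, d}" "c \<in> verts_of n" "d \<in> verts_of n" "even c" "odd d" "c \<noteq> d"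
    using assms(2) by (elim white_blackE)
  let ?A = "pt (4 * n + 4) (2 * a + 1)" and ?B = "pt (4 * n + 4) (2 * b + 1)"
  let ?C = "pt (4 * n + 4) (2 * c)" and ?D = "pt (4 * n + 4) (2 * d)"
  have meet: "chord (red n) e \<inter> chord (blue n) f = {} \<longleftrightarrow> \<not> (alternate a c b d \<or> alternate a d b c)"
    unfolding e(1) f(1) red_crosses_iff[symmetric] using e f by (intro red_blue_chords_meet) auto
  have "Im (cnj (direction (red n) e) * direction (blue n) f) = orient ?A ?B ?D - orient ?A ?B ?C"
    unfolding direction_def e(1) f(1) white_black[OF e(4,5)] white_black[OF f(4,5)] red_eq blue_eq
    by (simp add: orient_def algebra_simps)
  then have pos: "positive_basis (direction (red n) e) (direction (blue n) f) \<longleftrightarrow>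
      0 < orient ?A ?B ?D - orient ?A ?B ?C"
    unfolding positive_basis_def by simp
  have bd: "2 * a + 1 < 4 * n + 4" "2 * b + 1 < 4 * n + 4" "2 * c < 4 * n + 4" "2 * d < 4 * n + 4"
    using e f by (auto simp: verts_of_def)
  note oC = orient_pt[OF bd(1,2,3)] and oD = orient_pt[OF bd(1,2,4)]
  have 1: "0 < orient ?A ?B ?D - orient ?A ?B ?C" if "alternate a d b c"
  proof -
    have "0 < orient ?A ?B ?D" "orient ?A ?B ?C < 0"
      using that cyc_rotate unfolding alternate_def oC oD by blast+
    then show ?thesis by simp
  qed
  have 2: "\<not> 0 < orient ?A ?B ?D - orient ?A ?B ?C" if "alternate a c b d"
  proof -
    have "0 < orient ?A ?B ?C" "orient ?A ?B ?D < 0"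
      using that cyc_rotate unfolding alternate_def oC oD by blast+
    then show ?thesis by simp
  qed
  have "red_compat e f \<longleftrightarrow> \<not> alternate a c b d"
    unfolding e(1) f(1) red_compat_pair_iff
    using e(4,5) f(4,5) alternate_sym[of a c b d] alternate_sym[of b d a c] by auto
  then show ?thesis unfolding compatible_def meet pos using 1 2 by blast
qed

text \<open>
  Along the blue segment the signed distance from the line of \<open>{a, b}\<close> is an affine function of the
  parameter. It vanishes at \<open>s\<close> and has the sign of \<open>{d, e}\<close> at \<open>t\<close>. So \<open>{a, b}\<close> comes first iff the segment
  starts on the other side of this line.
\<close>

lemma entering_side:
  assumes V: "{a, b, d, e, w, z} \<subseteq> verts_of n" and cyc: "cyc a b d" "cyc a b e" and "w \<noteq> z"
    and s: "0 < s" "s < 1" "linepath (blue n w) (blue n z) s \<in> chord (red n) {a, b}"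
    and t: "0 < t" "t < 1" "linepath (blue n w) (blue n z) t \<in> chord (red n) {d, e}"
  shows "s < t \<longleftrightarrow> cyc (2 * a + 1) (2 * w) (2 * b + 1)"
proof -
  let ?o = "\<lambda>x. orient (pt (4 * n + 4) (2 * a + 1)) (pt (4 * n + 4) (2 * b + 1)) (pt (4 * n + 4) x)"
  have bd: "2 * a + 1 < 4 * n + 4" "2 * b + 1 < 4 * n + 4" "2 * d + 1 < 4 * n + 4"
    "2 * e + 1 < 4 * n + 4" "2 * w < 4 * n + 4" "2 * z < 4 * n + 4"
    using V by (auto simp: verts_of_def)
  note o = orient_pt[OF bd(1,2)]
  have "cyc (2 * a + 1) (2 * b + 1) (2 * d + 1)" "cyc (2 * a + 1) (2 * b + 1) (2 * e + 1)"
    using cyc unfolding cyc_def by auto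
  then have neg: "?o (2 * d + 1) < 0" "?o (2 * e + 1) < 0" using o(1) bd by blast+
  have 0: "(1 - s) * ?o (2 * w) + s * ?o (2 * z) = 0"
    using orient_open_segment[OF s(3)[unfolded chord_pair red_eq blue_eq]] by (simp add: orient_linepath)
  obtain u where u: "0 < u" "u < 1"
    "linepath (blue n w) (blue n z) t = linepath (red n d) (red n e) u"
    using t(3) unfolding chord_pair on_open_segment by blast
  have "(1 - t) * ?o (2 * w) + t * ?o (2 * z) = (1 - u) * ?o (2 * d + 1) + u * ?o (2 * e + 1)"
    using u(3) orient_linepath unfolding red_eq blue_eq by metis
  also have "\<dots> < 0" using neg u(1,2) by (intro add_neg_neg mult_pos_neg) auto
  finally have t0: "(1 - t) * ?o (2 * w) + t * ?o (2 * z) < 0" .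
  define D where "D = ?o (2 * w) - ?o (2 * z)"
  have w: "?o (2 * w) = s * D" using 0 unfolding D_def by (simp add: algebra_simps)
  have "(s - t) * D < 0" using t0 w unfolding D_def by (simp add: algebra_simps)
  then have "s < t \<longleftrightarrow> 0 < D" by (auto simp: mult_less_0_iff)
  also have "\<dots> \<longleftrightarrow> 0 < ?o (2 * w)" using w s(1) by (simp add: zero_less_mult_iff)
  also have "\<dots> \<longleftrightarrow> cyc (2 * a + 1) (2 * w) (2 * b + 1)" using o(2) bd by blast
  finally show ?thesis .
qed

lemma enters_through:
  assumes V: "{a, b, w, z} \<subseteq> verts_of n" "a \<noteq> b" "w \<noteq> z" and r: "red_crosses {a, b} {w, z}"
  obtains s where "0 < s" "s < 1" "linepath (blue n w) (blue n z) s \<in> chord (red n) {a, b}"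
proof -
  have "chord (red n) {a, b} \<inter> chord (blue n) {w, z} \<noteq> {}"
    using red_blue_chords_meet[of a b n w z] assms by blast
  then obtain v where v: "v \<in> chord (red n) {a, b}" "v \<in> open_segment (blue n w) (blue n z)"
    unfolding chord_pair[of "blue n"] by blast
  then show thesis using that unfolding on_open_segment by blast
qed

section \<open>Quadrangulations of regular polygons\<close>

lemma finite_verts_of [simp]: "finite (verts_of n)"
  by (simp add: verts_of_def)

lemma sides_verts_ofE:
  assumes "e \<in> sides (verts_of n)"
  obtains a b where "e = {a, b}" "a \<in> verts_of n" "b \<in> verts_of n" "odd (a + b)" "\<forall>w\<in>verts_of n. \<not> cyc a w b"
proof -
  have "2 \<le> card (verts_of n)" by (simp add: verts_of_def)
  then obtain a b where ab: "e = {a, b}" "a \<in> verts_of n" "b \<in> verts_of n" "a \<noteq> b"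
    "\<forall>w\<in>verts_of n. \<not> cyc a w b"
    using assms by (elim sidesE) simp_all
  have "odd (a + b)"
  proof (cases "a < b")
    case True
    have "a + 1 \<in> verts_of n" using True ab(3) by (simp add: verts_of_def)
    then have "\<not> cyc a (a + 1) b" using ab(5) by blast
    then have "b = a + 1" using True unfolding cyc_def by auto
    then show ?thesis by simp
  next
    case False
    then have "b < a" using ab(4) by simp
    have "0 \<in> verts_of n" by (simp add: verts_of_def)
    then have "\<not> cyc a 0 b" using ab(5) by blast
    then have "b = 0" using \<open>b < a\<close> unfolding cyc_def by auto
    have "a = 2 * n + 1"
    proof (rule ccontr)
      assume "a \<noteq> 2 * n + 1"
      then have "a + 1 \<in> verts_of n" using ab(2) by (simp add: verts_of_def)
      then have "\<not> cyc a (a + 1) b" using ab(5) by blast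
      then show False using \<open>b < a\<close> unfolding cyc_def by auto
    qed
    then show ?thesis using \<open>b = 0\<close> by simp
  qed
  then show thesis using that ab by blast
qed

lemma sides_odd: "sides (verts_of n) \<subseteq> odd_chords (verts_of n)"
  by (auto elim!: sides_verts_ofE simp: odd_chords_iff)

lemma pieces_eq: "pieces n D = gpieces (verts_of n) D"
  unfolding pieces_def gpieces_def edges_def ..

lemma not_crosses_self: "\<not> crosses e e"
proof
  assume "crosses e e"
  then obtain a b c d where "e = {a, b}" "{a, b} = {c, d}" "cyc a c b" unfolding crosses_def by metis
  then show False by (auto simp: doubleton_eq_iff cyc_def)
qed

lemma sides_uncrossed:
  assumes "e \<in> sides (verts_of n)" "f \<subseteq> verts_of n"
  shows "\<not> crosses e f" "\<not> crosses f e"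
proof -
  obtain a b where ab: "e = {a, b}" "\<forall>w\<in>verts_of n. \<not> cyc a w b" using assms(1) by (elim sides_verts_ofE)
  have *: "\<not> (cyc a c b \<or> cyc a d b)" if "f = {c, d}" for c d using ab(2) assms(2) that by auto
  show "\<not> crosses e f"
  proof
    assume "crosses e f"
    then obtain x y c d where xy: "f = {c, d}" "{a, b} = {x, y}" "cyc x c y" "cyc y d x"
      unfolding crosses_def ab(1) by blast
    then show False using *[OF xy(1)] by (auto simp: doubleton_eq_iff)
  qed
  then show "\<not> crosses f e" using crosses_sym by blast
qed

lemma quadrangulation_uncrossed:
  assumes "quadrangulation n D" "e \<in> D" "f \<in> D"
  shows "\<not> crosses e f"
proof (cases "e = f")
  case True
  then show ?thesis using not_crosses_self by simp
next
  case False
  have dia: "D \<subseteq> diagonals n" using assms(1) unfolding quadrangulation_def by blast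
  then have "card e = 2" "card f = 2" using assms(2,3) unfolding diagonals_def by blast+
  then obtain a b c d where "e = {a, b}" "a \<noteq> b" "f = {c, d}" "c \<noteq> d"
    by (auto simp: card_2_iff)
  moreover have "e \<subseteq> verts_of n" "f \<subseteq> verts_of n" using dia assms(2,3) unfolding diagonals_def by blast+
  moreover have "chord (blue n) e \<inter> chord (blue n) f = {}"
    using assms False unfolding quadrangulation_def pairwise_def by blast
  ultimately show ?thesis using blue_chords_meet[of a b n c d] False by simp
qed

lemma consecutive_side:
  assumes "finite C" "x \<in> C" "y \<in> C" "x < y" "x + 1 \<in> C"
    and out: "i \<in> C" "j \<in> C" "i \<le> x" "y \<le> j" "x \<noteq> i \<or> y \<noteq> j"
  shows "{x, y} \<in> sides C \<longleftrightarrow> y = x + 1"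
proof
  assume "{x, y} \<in> sides C"
  then have "(\<forall>w\<in>C. \<not> cyc x w y) \<or> (\<forall>w\<in>C. \<not> cyc y w x)" using assms by (simp add: sides_iff)
  then have "\<not> cyc x (x + 1) y \<or> \<not> cyc y i x \<and> \<not> cyc y j x" using assms by blast
  then show "y = x + 1" using assms unfolding cyc_def by auto
next
  assume "y = x + 1"
  then show "{x, y} \<in> sides C" using assms by (auto simp: sides_iff cyc_def)
qed

text \<open>
  By induction on the length of the diagonal. The vertices of the square on its inner side (seen from \<open>i\<close>
  to \<open>j\<close>) give three shorter edges, each joining vertices of different colours.
\<close>

lemma diagonal_odd:
  assumes quad: "quadrangulation n D"
  shows "{i, j} \<in> D \<Longrightarrow> i < j \<Longrightarrow> odd (i + j)"
proof (induction "j - i" arbitrary: i j rule: less_induct)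
  case less
  let ?W = "{i..j}" and ?V = "verts_of n"
  \<comment> \<open>On the inner side \<open>{i, j}\<close> itself becomes a boundary edge of the polygon \<open>?W\<close>.\<close>
  let ?D = "{e \<in> D. e \<subseteq> ?W \<and> e \<noteq> {i, j}}"
  let ?C = "visible ?W ?D i j"
  have dia: "{x, y} \<subseteq> ?V \<and> x \<noteq> y \<and> {x, y} \<notin> sides ?V" if "{x, y} \<in> D" for x y
  proof -
    have "{x, y} \<in> diagonals n" using quad that unfolding quadrangulation_def by blast
    then show ?thesis unfolding diagonals_def by auto
  qed
  have ij: "i \<in> ?V" "j \<in> ?V" "i \<noteq> j" "{i, j} \<notin> sides ?V" using dia[OF less(2)] by blast+
  have WV: "?W \<subseteq> ?V" using ij by (auto simp: verts_of_def)
  have chords: "k \<in> ?W \<and> l \<in> ?W \<and> k \<noteq> l" if "{k, l} \<in> ?D" for k l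
  proof -
    have "{k, l} \<subseteq> ?W" "{k, l} \<in> D" using that by simp_all
    then show ?thesis using dia[of k l] by blast
  qed
  have nc: "\<not> crosses e f" if "e \<in> ?D" "f \<in> ?D" for e f
    using quadrangulation_uncrossed[OF quad] that by blast
  have npq: "\<not> crosses e {i, j}" if "e \<in> ?D" for e
    using quadrangulation_uncrossed[OF quad _ less(2)] that by blast
  have ends: "i \<in> ?C" "j \<in> ?C" using visible_ends[of i ?W j] less(3) by simp_all
  have fin: "finite ?C" by (rule finite_subset[of _ ?W]) (auto simp: visible_def)
  have j: "j \<noteq> i + 1"
  proof
    assume "j = i + 1"
    then have "\<forall>w\<in>?V. \<not> cyc i w j" by (auto simp: cyc_def)
    then show False using ij by (simp add: sides_iff)
  qed
  have "?C \<noteq> {i, j}"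
  proof
    assume C: "?C = {i, j}"
    have "\<not> cyc i w j" if "w \<in> ?C" for w using that unfolding C cyc_def by auto
    then have "{i, j} \<in> ?D \<or> (\<forall>w\<in>?W. \<not> cyc i w j)"
      using visible_next[OF _ chords nc ij(3) ends ij(3)] by blast
    then have "\<not> cyc i (i + 1) j" using less(3) by simp
    then show False using j less(3) unfolding cyc_def by auto
  qed
  note two = this
  have piece: "?C \<in> gpieces ?W ?D"
  proof (rule visible_piece)
    show "i \<in> ?W" "j \<in> ?W" using less(3) by simp_all
    show "k \<in> ?W \<and> l \<in> ?W \<and> k \<noteq> l" if "{k, l} \<in> ?D" for k l using that by (rule chords)
    show "\<not> crosses e f" if "e \<in> ?D" "f \<in> ?D" for e f using that by (rule nc)
    show "\<not> crosses e {i, j}" if "e \<in> ?D" for e using that by (rule npq)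
  qed (rule finite_atLeastAtMost ij(3) two)+
  have sub: "?C \<subseteq> ?W" unfolding visible_def by blast
  have same: "{x, y} \<in> ?D \<union> sides ?W \<longleftrightarrow> {x, y} \<in> D \<union> sides ?V" if xy: "x \<in> ?W" "y \<in> ?W" "x < y" for x y
  proof (cases "{x, y} = {i, j}")
    case True
    have "{i, j} \<in> sides ?W" using ij(3) less(3) by (auto simp: sides_iff cyc_def)
    then show ?thesis unfolding True using less(2) by blast
  next
    case False
    then have ne: "x \<noteq> i \<or> y \<noteq> j" by blast
    have "{x, y} \<in> sides ?W \<longleftrightarrow> y = x + 1" "{x, y} \<in> sides ?V \<longleftrightarrow> y = x + 1"
      by (rule consecutive_side[of _ x y i j]; use xy ne ij(1,2) less(3) WV in \<open>auto simp: verts_of_def\<close>)+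
    moreover have "{x, y} \<in> ?D \<longleftrightarrow> {x, y} \<in> D" using False xy by auto
    ultimately show ?thesis by blast
  qed
  have same': "{x, y} \<in> ?D \<union> sides ?W \<longleftrightarrow> {x, y} \<in> D \<union> sides ?V"
    if xy: "x \<in> ?C" "y \<in> ?C" "x \<noteq> y" for x y
  proof (cases "x < y")
    case True
    then show ?thesis using same[of x y] xy sub by blast
  next
    case False
    then have "y < x" using xy by simp
    then show ?thesis using same[of y x] xy sub unfolding insert_commute[of x y] by blast
  qed
  have "{x, y} \<in> D \<union> sides ?V \<longleftrightarrow> {x, y} \<in> sides ?C" if "x \<in> ?C" "y \<in> ?C" "x \<noteq> y" for x y
    by (rule trans[OF sym[OF same'[OF that]] gpiecesD(3)[OF piece that]])
  moreover have "?C \<subseteq> ?V" using sub WV by (rule order_trans)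
  ultimately have "?C \<in> pieces n D"
    unfolding pieces_eq gpieces_def using gpiecesD(2)[OF piece] by simp
  then have card4: "card ?C = 4" using quad unfolding quadrangulation_def by blast
  have "card (?C - {i, j}) = 2" using card4 ends fin ij(3) by (simp add: card_Diff_subset)
  then obtain x y where xy: "?C - {i, j} = {x, y}" "x \<noteq> y" by (auto simp: card_2_iff)
  then obtain a b where ab: "?C - {i, j} = {a, b}" "a < b" by (metis insert_commute nat_neq_iff)
  have C: "?C = {i, a, b, j}" using ab(1) ends by blast
  have "a \<in> ?C - {i, j}" "b \<in> ?C - {i, j}" unfolding ab(1) by blast+
  then have iab: "i < a" "b < j" using sub by fastforce+
  have "odd (u + v)" if uv: "(u, v) \<in> {(i, a), (a, b), (b, j)}" for u v
  proof -
    have uC: "u \<in> ?C" "v \<in> ?C" "u < v" "v - u < j - i" using uv C iab ab(2) by auto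
    have "\<forall>w\<in>?C. \<not> cyc u w v" using uv iab ab(2) unfolding C by (auto simp: cyc_def)
    then have "{u, v} \<in> sides ?C" using uC fin by (simp add: sides_iff)
    then have "{u, v} \<in> ?D \<union> sides ?W" using gpiecesD(3)[OF piece uC(1,2)] uC(3) by blast
    then have "{u, v} \<in> D \<or> {u, v} \<in> sides ?V" using same'[OF uC(1,2)] uC(3) by blast
    then show ?thesis
    proof
      assume "{u, v} \<in> D"
      then show ?thesis using less(1)[OF uC(4)] uC(3) by blast
    next
      assume "{u, v} \<in> sides ?V"
      then show ?thesis using sides_odd odd_chords_iff by blast
    qed
  qed
  then have "odd (i + a)" "odd (a + b)" "odd (b + j)" by blast+
  then show ?case by presburger
qed

lemma quadrangulation_iff: "quadrangulation n D \<longleftrightarrow> quad (verts_of n) D"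
proof
  assume q: "quadrangulation n D"
  have "e \<in> odd_chords (verts_of n) - sides (verts_of n)" if e: "e \<in> D" for e
  proof -
    have d: "e \<in> diagonals n" using q e unfolding quadrangulation_def by blast
    then have "card e = 2" unfolding diagonals_def by blast
    then obtain x y where xy: "e = {x, y}" "x \<noteq> y" by (auto simp: card_2_iff)
    have "odd (x + y)"
    proof (cases "x < y")
      case True
      then show ?thesis using diagonal_odd[OF q] e xy by blast
    next
      case False
      then have "{y, x} \<in> D" "y < x" using e xy by (simp_all add: insert_commute)
      then have "odd (y + x)" using diagonal_odd[OF q] by blast
      then show ?thesis by (simp add: add.commute)
    qed
    then show ?thesis using d unfolding diagonals_def xy(1) by (simp add: odd_chords_iff)
  qed
  moreover have "\<forall>e\<in>D. \<forall>f\<in>D. \<not> crosses e f" using quadrangulation_uncrossed[OF q] by blast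
  moreover have "\<forall>C\<in>gpieces (verts_of n) D. card C = 4"
    using q unfolding quadrangulation_def pieces_eq by blast
  ultimately show "quad (verts_of n) D" unfolding quad_def by blast
next
  assume q: "quad (verts_of n) D"
  have e: "e \<subseteq> verts_of n \<and> card e = 2 \<and> e \<notin> sides (verts_of n)" if "e \<in> D" for e
  proof -
    have "e \<in> odd_chords (verts_of n)" "e \<notin> sides (verts_of n)" using q that unfolding quad_def by blast+
    then show ?thesis by (elim odd_chordsE) simp
  qed
  moreover have "chord (blue n) e \<inter> chord (blue n) f = {}" if ef: "e \<in> D" "f \<in> D" "e \<noteq> f" for e f
  proof -
    obtain a b where "e = {a, b}" "a \<noteq> b" using e[OF ef(1)] by (auto simp: card_2_iff)
    moreover obtain c d where "f = {c, d}" "c \<noteq> d" using e[OF ef(2)] by (auto simp: card_2_iff)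
    ultimately show ?thesis using blue_chords_meet[of a b n c d] ef e[OF ef(1)] e[OF ef(2)] q
      unfolding quad_def by simp
  qed
  ultimately show "quadrangulation n D"
    using q unfolding quadrangulation_def quad_def pieces_eq diagonals_def pairwise_def by blast
qed

text \<open>
  There is only one blue vertex between consecutive red ones, and it has the colour of the second.
\<close>

lemma sides_red_compat:
  assumes "e \<in> sides (verts_of n)" "f \<in> odd_chords (verts_of n)"
  shows "red_compat e f"
  unfolding red_compat_def
proof (intro allI impI)
  fix a b c d assume eq: "e = {a, b}" "f = {c, d}" and alt: "alternate a c b d"
  obtain k k' where k: "e = {k, k'}" "odd (k + k')" "\<forall>w\<in>verts_of n. \<not> cyc k w k'"
    using assms(1) by (elim sides_verts_ofE)
  have cd: "c \<in> verts_of n" "d \<in> verts_of n" "odd (c + d)" using assms(2) eq(2) by (simp_all add: odd_chords_iff)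
  consider "a = k" "b = k'" | "a = k'" "b = k" using k(1) eq(1) by (auto simp: doubleton_eq_iff)
  then show "odd (a + c)"
  proof cases
    case 1
    then have "c = k'" using alt k(3) cd unfolding alternate_iff by blast
    then show ?thesis using k(2) 1 by simp
  next
    case 2
    then have "d = k'" using alt k(3) cd unfolding alternate_iff by blast
    then show ?thesis using cd(3) 2 by (simp add: add.commute)
  qed
qed

lemma compatible_quadrangulations_eq:
  assumes Q: "Q \<subseteq> odd_chords (verts_of n)"
  shows "compatible_quadrangulations n Q = cquads (verts_of n) (edges n Q)"
proof -
  have E: "edges n Q \<subseteq> odd_chords (verts_of n)" using Q sides_odd unfolding edges_def by blast
  have "(\<forall>e\<in>edges n D. \<forall>f\<in>edges n Q. compatible n e f) \<longleftrightarrow> (\<forall>e\<in>D. \<forall>f\<in>edges n Q. red_compat e f)"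
    if "quad (verts_of n) D" for D
  proof -
    have ED: "edges n D \<subseteq> odd_chords (verts_of n)"
      using that sides_odd unfolding edges_def quad_def by blast
    have "(\<forall>e\<in>edges n D. \<forall>f\<in>edges n Q. compatible n e f) \<longleftrightarrow>
        (\<forall>e\<in>edges n D. \<forall>f\<in>edges n Q. red_compat e f)"
      using compatible_iff ED E by (meson subsetD)
    also have "\<dots> \<longleftrightarrow> (\<forall>e\<in>D. \<forall>f\<in>edges n Q. red_compat e f)"
      unfolding edges_def[of n D] using sides_red_compat E by blast
    finally show ?thesis .
  qed
  then show ?thesis unfolding compatible_quadrangulations_def cquads_def quadrangulation_iff by blast
qed

section \<open>Flips in regular polygons\<close>

definition quadrilateral :: "nat \<Rightarrow> nat \<Rightarrow> nat \<Rightarrow> nat \<Rightarrow> bool" where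
  "quadrilateral a b c d \<longleftrightarrow> cyc a b c \<and> cyc a c d"

lemma sides_image: "sides C = (\<lambda>v. {v, nxt C v}) ` C"
  unfolding sides_def by blast

lemma quadrilateral_nxt:
  assumes q: "quadrilateral a b c d"
  shows "nxt {a, b, c, d} a = b" "nxt {a, b, c, d} b = c" "nxt {a, b, c, d} c = d" "nxt {a, b, c, d} d = a"
    "card {a, b, c, d} = 4"
proof -
  note q' = q[unfolded quadrilateral_def]
  have "\<not> cyc a w b \<and> \<not> cyc b w c \<and> \<not> cyc c w d \<and> \<not> cyc d w a" if "w \<in> {a, b, c, d}" for w
  proof -
    have "w = a \<or> w = b \<or> w = c \<or> w = d" using that by blast
    then show ?thesis using q' unfolding cyc_def by (smt (verit))
  qed
  moreover have "a \<noteq> b \<and> a \<noteq> c \<and> a \<noteq> d \<and> b \<noteq> c \<and> b \<noteq> d \<and> c \<noteq> d"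
    using q' unfolding cyc_def by (smt (verit))
  ultimately show "nxt {a, b, c, d} a = b" "nxt {a, b, c, d} b = c" "nxt {a, b, c, d} c = d"
    "nxt {a, b, c, d} d = a" "card {a, b, c, d} = 4"
    by (auto intro!: nxt_eqI)
qed

lemma quadrilateral_sides:
  "quadrilateral a b c d \<Longrightarrow> sides {a, b, c, d} = {{a, b}, {b, c}, {c, d}, {d, a}}"
  unfolding sides_image by (simp add: quadrilateral_nxt)

lemma hexagon_nxt:
  assumes h: "hexagon a b c d e f"
  defines "H \<equiv> {a, b, c, d, e, f}"
  shows "nxt H a = b" "nxt H b = c" "nxt H c = d" "nxt H d = e" "nxt H e = f" "nxt H f = a" "card H = 6"
proof -
  note h' = h[unfolded hexagon_def]
  have "\<not> cyc a w b \<and> \<not> cyc b w c \<and> \<not> cyc c w d \<and> \<not> cyc d w e \<and> \<not> cyc e w f \<and> \<not> cyc f w a"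
    if "w \<in> H" for w
  proof -
    have "w = a \<or> w = b \<or> w = c \<or> w = d \<or> w = e \<or> w = f" using that unfolding H_def by blast
    then show ?thesis using h' unfolding cyc_def by (smt (verit))
  qed
  note nx = this
  have ne: "a \<noteq> b" "a \<noteq> c" "a \<noteq> d" "a \<noteq> e" "a \<noteq> f" "b \<noteq> c" "b \<noteq> d" "b \<noteq> e" "b \<noteq> f"
    "c \<noteq> d" "c \<noteq> e" "c \<noteq> f" "d \<noteq> e" "d \<noteq> f" "e \<noteq> f"
    using h' unfolding cyc_def by (smt (verit))+
  have H: "finite H" "a \<in> H" "b \<in> H" "c \<in> H" "d \<in> H" "e \<in> H" "f \<in> H" unfolding H_def by simp_all
  show "nxt H a = b" "nxt H b = c" "nxt H c = d" "nxt H d = e" "nxt H e = f" "nxt H f = a"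
    by (rule nxt_eqI; use H ne nx in blast)+
  show "card H = 6" unfolding H_def using ne by simp
qed

lemma hexagon_sides:
  "hexagon a b c d e f \<Longrightarrow>
    sides {a, b, c, d, e, f} = {{a, b}, {b, c}, {c, d}, {d, e}, {e, f}, {f, a}}"
  unfolding sides_image by (simp add: hexagon_nxt)

lemma hexagon_opposite_sides:
  assumes "hexagon a b c d e f"
  shows "opposite_sides {a, b, c, d, e, f} \<sigma> \<tau> \<longleftrightarrow> (\<sigma>, \<tau>) \<in>
    {({a, b}, {d, e}), ({b, c}, {e, f}), ({c, d}, {f, a}), ({d, e}, {a, b}), ({e, f}, {b, c}), ({f, a}, {c, d})}"
proof -
  note nx = hexagon_nxt[OF assms]
  let ?G = "\<lambda>\<rho>. (nxt {a, b, c, d, e, f} ^^ 3) ` \<rho>"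
  have G: "?G {a, b} = {d, e}" "?G {b, c} = {e, f}" "?G {c, d} = {f, a}"
    "?G {d, e} = {a, b}" "?G {e, f} = {b, c}" "?G {f, a} = {c, d}"
    by (simp_all add: numeral_3_eq_3 nx)
  have six: "card {a, b, c, d, e, f} div 2 = 3" unfolding nx(7) by simp
  have graph: "\<sigma> \<in> {A, B, C, A', B', C'} \<and> \<tau> = F \<sigma> \<longleftrightarrow>
      (\<sigma>, \<tau>) \<in> {(A, F A), (B, F B), (C, F C), (A', F A'), (B', F B'), (C', F C')}"
    for A B C A' B' C' :: "nat set" and F by blast
  show ?thesis
    unfolding opposite_sides_def six hexagon_sides[OF assms] graph[of _ _ _ _ _ _ ?G] G ..
qed

lemma hexagon_rotate: "hexagon a b c d e f \<Longrightarrow> hexagon b c d e f a"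
  unfolding hexagon_def cyc_def by (smt (verit))

lemma hexagon_split:
  "hexagon x a b y c d \<longleftrightarrow> quadrilateral x a b y \<and> quadrilateral y c d x"
  unfolding hexagon_def quadrilateral_def cyc_def by (smt (verit))

text \<open>
  The two cases tell on which side of \<open>{x, y}\<close> the square lies.
\<close>

lemma square_along_side:
  assumes "finite S" "card S = 4" "{x, y} \<in> sides S" "x \<noteq> y"
  obtains a b where "S = {x, a, b, y}" "quadrilateral x a b y"
    | a b where "S = {y, a, b, x}" "quadrilateral y a b x"
proof -
  have S: "x \<in> S" "y \<in> S" "(\<forall>w\<in>S. \<not> cyc x w y) \<or> (\<forall>w\<in>S. \<not> cyc y w x)"
    using assms by (simp_all add: sides_iff)
  then have "card (S - {x, y}) = 2" using assms by (simp add: card_Diff_subset)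
  then obtain a b where ab: "S - {x, y} = {a, b}" "a \<noteq> b" by (auto simp: card_2_iff)
  have "a \<in> S - {x, y}" "b \<in> S - {x, y}" unfolding ab by blast+
  then have m: "a \<in> S" "b \<in> S" "a \<noteq> x" "a \<noteq> y" "b \<noteq> x" "b \<noteq> y" by blast+
  have Sab: "S = {x, a, b, y}" using ab(1) S(1,2) by blast
  have dec: "S = {y, a, b, x}" "S = {x, b, a, y}" "S = {y, b, a, x}" using Sab by blast+
  have "quadrilateral x a b y \<or> quadrilateral x b a y \<or> quadrilateral y a b x \<or> quadrilateral y b a x"
  proof -
    have "(\<not> cyc x a y \<and> \<not> cyc x b y) \<or> (\<not> cyc y a x \<and> \<not> cyc y b x)" using S(3) m by blast
    then show ?thesis using m ab(2) assms(4) unfolding quadrilateral_def cyc_def by (smt (verit))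
  qed
  then show thesis using that Sab dec by blast
qed

text \<open>
  The first corner after \<open>x\<close> where two distinct squares on the same side of \<open>{x, y}\<close> differ would lead to
  crossing edges or to an edge that is a diagonal of one of the squares.
\<close>

lemma squares_on_same_arc:
  assumes S: "{x, a, b, y} \<in> gpieces V D" "quadrilateral x a b y"
    and T: "{x, a', b', y} \<in> gpieces V D" "quadrilateral x a' b' y"
    and nc: "\<And>e f. e \<in> D \<union> sides V \<Longrightarrow> f \<in> D \<union> sides V \<Longrightarrow> \<not> crosses e f"
  shows "a = a' \<and> b = b'"
proof -
  have ed: "{x, a} \<in> D \<union> sides V \<and> {a, b} \<in> D \<union> sides V \<and> {b, y} \<in> D \<union> sides V \<and>
    {x, b} \<notin> D \<union> sides V \<and> {a, y} \<notin> D \<union> sides V"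
    if P: "{x, a, b, y} \<in> gpieces V D" and q: "quadrilateral x a b y" for a b
  proof -
    have ne: "x \<noteq> a" "x \<noteq> b" "x \<noteq> y" "a \<noteq> b" "a \<noteq> y" "b \<noteq> y"
      using q unfolding quadrilateral_def cyc_def by (smt (verit))+
    note iff = gpiecesD(3)[OF P, unfolded quadrilateral_sides[OF q]]
    have "{x, b} \<noteq> {x, a}" "{x, b} \<noteq> {a, b}" "{x, b} \<noteq> {b, y}" "{x, b} \<noteq> {y, x}"
      "{a, y} \<noteq> {x, a}" "{a, y} \<noteq> {a, b}" "{a, y} \<noteq> {b, y}" "{a, y} \<noteq> {y, x}"
      using ne by (simp_all add: doubleton_eq_iff)
    then have "{x, b} \<notin> D \<union> sides V" "{a, y} \<notin> D \<union> sides V"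
      using iff[of x b] iff[of a y] ne by simp_all
    moreover have "{x, a} \<in> D \<union> sides V" "{a, b} \<in> D \<union> sides V" "{b, y} \<in> D \<union> sides V"
      using iff[of x a] iff[of a b] iff[of b y] ne by simp_all
    ultimately show ?thesis by blast
  qed
  note e = ed[OF S] and e' = ed[OF T]
  have "\<not> crosses {x, a'} {a, b}" "\<not> crosses {x, a'} {b, y}" "\<not> crosses {x, a} {a', b'}"
    "\<not> crosses {x, a} {b', y}" "\<not> crosses {a, b} {b', y}" "\<not> crosses {a', b'} {b, y}"
    using e e' nc by blast+
  moreover have "b \<noteq> a'" "a \<noteq> b'" using e e' by blast+
  ultimately show ?thesis
    using S(2) T(2) unfolding crosses_iff quadrilateral_def cyc_def by (smt (verit))
qed

lemma pt_eq_iff: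
  assumes "x < N" "y < N" "3 \<le> N"
  shows "pt N x = pt N y \<longleftrightarrow> x = y"
proof
  assume eq: "pt N x = pt N y"
  show "x = y"
  proof (rule ccontr)
    assume "x \<noteq> y"
    \<comment> \<open>A third point of the circle would form a degenerate triangle with two equal ones.\<close>
    have "\<not> (\<forall>z\<in>{0, 1, 2 :: nat}. z = x \<or> z = y)" by auto
    then obtain z :: nat where z: "z \<in> {0, 1, 2}" "z \<noteq> x" "z \<noteq> y" by blast
    then have "z < N" using assms(3) by auto
    have "cyc x y z \<or> cyc x z y" using cyc_total[of x y z] \<open>x \<noteq> y\<close> z by blast
    then have "orient (pt N x) (pt N y) (pt N z) \<noteq> 0"
      using orient_pt[OF assms(1,2) \<open>z < N\<close>] by linarith
    then show False unfolding eq by (simp add: orient_def)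
  qed
qed simp

lemma linepath_meets_red_crosses:
  assumes V: "{a, b, w, z} \<subseteq> verts_of n" "a \<noteq> b" "w \<noteq> z"
    and s: "0 < s" "s < 1" "linepath (blue n w) (blue n z) s \<in> chord (red n) {a, b}"
  shows "red_crosses {a, b} {w, z}"
proof -
  have "blue n w \<noteq> blue n z" unfolding blue_eq using V by (simp add: pt_eq_iff verts_of_def)
  then have "linepath (blue n w) (blue n z) s \<in> chord (blue n) {w, z}"
    unfolding chord_pair on_open_segment using s by blast
  then have "chord (red n) {a, b} \<inter> chord (blue n) {w, z} \<noteq> {}" using s(3) by blast
  then show ?thesis using red_blue_chords_meet[of a b n w z] V by blast
qed

text \<open>
  A blue edge that crosses two opposite sides of a hexagon and starts beyond one of them ends beyond the
  other.
\<close>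

lemma crossing_order:
  assumes "hexagon a b c d e f" "red_crosses {a, b} {w, z}" "red_crosses {d, e} {w, z}"
    "cyc (2 * a + 1) (2 * w) (2 * b + 1)"
  shows "alternate b z e w" "alternate a w d z" "cyc (2 * d + 1) (2 * z) (2 * e + 1)"
proof -
  have 1: "alternate a w b z \<and> alternate d z e w"
    using assms unfolding red_crosses_iff alternate_iff red_arc_iff unfolding hexagon_def cyc_def by (smt (verit))
  show "alternate b z e w" "alternate a w d z" "cyc (2 * d + 1) (2 * z) (2 * e + 1)"
    using 1 assms(1) unfolding alternate_iff red_arc_iff unfolding hexagon_def cyc_def by (smt (verit))+
qed

lemma square_piece:
  assumes q: "quadrilateral a b c d" and odd: "D \<union> sides V \<subseteq> odd_chords V"
    and ed: "{a, b} \<in> D \<union> sides V" "{b, c} \<in> D \<union> sides V" "{c, d} \<in> D \<union> sides V" "{d, a} \<in> D \<union> sides V"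
  shows "{a, b, c, d} \<in> gpieces V D"
proof -
  have O: "{x, y} \<in> D \<union> sides V \<Longrightarrow> x \<in> V \<and> y \<in> V \<and> odd (x + y)" for x y
    using subsetD[OF odd, of "{x, y}"] by (simp add: odd_chords_iff)
  note Oe = O[OF ed(1)] O[OF ed(2)] O[OF ed(3)] O[OF ed(4)]
  have nd: "{a, c} \<notin> D \<union> sides V" "{b, d} \<notin> D \<union> sides V"
    using O[of a c] O[of b d] Oe by auto
  have "{i, j} \<in> D \<union> sides V \<longleftrightarrow> {i, j} \<in> {{a, b}, {b, c}, {c, d}, {d, a}}"
    if ij: "i \<in> {a, b, c, d}" "j \<in> {a, b, c, d}" "i \<noteq> j" for i j
  proof
    assume "{i, j} \<in> {{a, b}, {b, c}, {c, d}, {d, a}}"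
    then show "{i, j} \<in> D \<union> sides V" using ed by (elim insertE emptyE) simp_all
  next
    assume e: "{i, j} \<in> D \<union> sides V"
    then have "{i, j} \<noteq> {a, c}" "{i, j} \<noteq> {b, d}" using nd by metis+
    then show "{i, j} \<in> {{a, b}, {b, c}, {c, d}, {d, a}}" using ij by (auto simp: insert_commute)
  qed
  then show ?thesis
    unfolding gpieces_def using quadrilateral_sides[OF q] quadrilateral_nxt(5)[OF q] Oe by simp
qed

lemma cquads_edges_odd:
  "D \<in> cquads (verts_of n) E \<Longrightarrow> D \<union> sides (verts_of n) \<subseteq> odd_chords (verts_of n)"
  using sides_odd unfolding cquads_def quad_def by blast

lemma cquads_edge:
  assumes "D \<in> cquads (verts_of n) E" "{x, y} \<in> D \<union> sides (verts_of n)"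
  shows "x \<in> verts_of n \<and> y \<in> verts_of n \<and> odd (x + y)"
  using subsetD[OF cquads_edges_odd[OF assms(1)] assms(2)] by (simp add: odd_chords_iff)

lemma cquads_edges_uncrossed:
  assumes "D \<in> cquads (verts_of n) E" "e \<in> D \<union> sides (verts_of n)" "f \<in> D \<union> sides (verts_of n)"
  shows "\<not> crosses e f"
proof -
  have "e \<in> odd_chords (verts_of n)" "f \<in> odd_chords (verts_of n)"
    using cquads_edges_odd[OF assms(1)] assms(2,3) by blast+
  then have sub: "e \<subseteq> verts_of n" "f \<subseteq> verts_of n" by (auto elim!: odd_chordsE)
  have "\<forall>e\<in>D. \<forall>f\<in>D. \<not> crosses e f" using assms(1) unfolding cquads_def quad_def by simp
  then show ?thesis using assms(2,3) sides_uncrossed sub by blast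
qed

lemma flipI:
  assumes "D \<in> compatible_quadrangulations n Q" "D' \<in> compatible_quadrangulations n Q"
    "i \<in> D" "j \<notin> D" "D' = insert j (D - {i})" "S \<in> pieces n D" "T \<in> pieces n D"
    "S \<noteq> T" "i \<subseteq> S" "i \<subseteq> T" "H = S \<union> T" "long_inner_edge n Q H \<sigma> \<tau> f"
    "white_end i \<in> \<sigma>" "white_end j \<in> \<tau>"
  shows "flip n Q D D'"
  unfolding flip_def
  by (rule conjI[OF assms(1) conjI[OF assms(2)]], rule exI[of _ i], rule exI[of _ j], rule exI[of _ S],
      rule exI[of _ T], rule exI[of _ H], rule exI[of _ \<sigma>], rule exI[of _ \<tau>], rule exI[of _ f],
      intro conjI) (rule assms)+

text \<open>
  Compatibility with the long inner edge forces \<open>b\<close> to be white. So \<open>{b, e}\<close> has its white end on the side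
  \<open>{a, b}\<close>, through which the edge enters, and \<open>{a, d}\<close> has it on \<open>{d, e}\<close>.
\<close>

lemma flip_if_turn:
  assumes Q: "Q \<subseteq> odd_chords (verts_of n)"
    and D: "D \<in> cquads (verts_of n) (edges n Q)" "D' \<in> cquads (verts_of n) (edges n Q)"
    and t: "turn (verts_of n) D {w, z} a b c d e f" and ad: "{a, d} \<notin> D" "D' = insert {a, d} (D - {{b, e}})"
    and g: "{w, z} \<in> Q" "even w" "odd z" and w: "cyc (2 * a + 1) (2 * w) (2 * b + 1)"
  shows "flip n Q D D'"
proof -
  let ?V = "verts_of n" and ?H = "{a, b, c, d, e, f}"
  note hex = turnD(1)[OF t] and be = turnD(2)[OF t] and cr = turnD(3,4)[OF t] and ed = turnD(5-10)[OF t]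
  note odd = cquads_edges_odd[OF D(1)]
  note O = cquads_edge[OF D(1)]
  note Oe = O[OF ed(1)] O[OF ed(2)] O[OF ed(3)] O[OF ed(4)] O[OF ed(5)]
  have wz: "w \<in> ?V" "z \<in> ?V" "w \<noteq> z" using subsetD[OF Q g(1)] g by (auto simp: odd_chords_iff)
  note ord = crossing_order[OF hex cr w]
  have gE: "{w, z} \<in> edges n Q" using g(1) unfolding edges_def by blast
  then have "red_compat {b, e} {w, z}" using D(1) be unfolding cquads_def by blast
  then have "odd (b + z)" using red_compatD[of b e z w] ord(1) by (simp add: insert_commute)
  then have "even b" using g(3) by simp
  then have par: "even b" "odd a" "even d" "odd e" using Oe by simp_all
  have quads: "quadrilateral b c d e" "quadrilateral e f a b"
    using hexagon_rotate[OF hex] unfolding hexagon_split by blast+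
  have S: "{b, c, d, e} \<in> pieces n D"
    unfolding pieces_eq by (rule square_piece[OF quads(1) odd ed(2-4)]) (use be in \<open>simp add: insert_commute\<close>)
  have T: "{e, f, a, b} \<in> pieces n D"
    unfolding pieces_eq by (rule square_piece[OF quads(2) odd ed(5,6,1)]) (use be in simp)
  have ne: "a \<noteq> b" "d \<noteq> e" "c \<noteq> e" "c \<noteq> f" "c \<noteq> a" "c \<noteq> b"
    using hex unfolding hexagon_def cyc_def by (smt (verit))+
  have ST: "{b, c, d, e} \<noteq> {e, f, a, b}" using ne by blast
  have H: "?H = {b, c, d, e} \<union> {e, f, a, b}" by blast
  obtain s where s: "0 < s" "s < 1" "linepath (blue n w) (blue n z) s \<in> chord (red n) {a, b}"
    by (rule enters_through[of a b w z n]) (use Oe wz ne cr in simp_all)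
  obtain t where t: "0 < t" "t < 1" "linepath (blue n w) (blue n z) t \<in> chord (red n) {d, e}"
    by (rule enters_through[of d e w z n]) (use Oe wz ne cr in simp_all)
  have "s < t"
  proof (subst entering_side[OF _ _ _ wz(3) s t])
    show "{a, b, d, e, w, z} \<subseteq> ?V" using Oe wz by blast
    show "cyc a b d" "cyc a b e" using hex unfolding hexagon_def cyc_def by (smt (verit))+
  qed (rule w)
  then have long: "long_inner_edge n Q ?H {a, b} {d, e} {w, z}"
    unfolding long_inner_edge_def hexagon_opposite_sides[OF hex] white_black[OF g(2,3)]
    using g(1) s t by (intro conjI exI[of _ s] exI[of _ t]) simp_all
  have white: "white_end {b, e} \<in> {a, b}" "white_end {a, d} \<in> {d, e}"
    using white_black[OF par(1,4)] white_black[OF par(3,2)] by (simp_all add: insert_commute)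
  have sub: "{b, e} \<subseteq> {b, c, d, e}" "{b, e} \<subseteq> {e, f, a, b}" by blast+
  have DC: "D \<in> compatible_quadrangulations n Q" "D' \<in> compatible_quadrangulations n Q"
    unfolding compatible_quadrangulations_eq[OF Q] using D .
  show ?thesis by (rule flipI[OF DC be ad S T ST sub H long white])
qed

lemma flip_if_cflip:
  assumes Q: "Q \<subseteq> odd_chords (verts_of n)" and fl: "cflip (verts_of n) (edges n Q) D D'"
  shows "flip n Q D D'"
proof -
  let ?V = "verts_of n"
  have D: "D \<in> cquads ?V (edges n Q)" "D' \<in> cquads ?V (edges n Q)" using fl by (simp_all only: cflip_def)
  obtain g a b c d e f where g: "g \<in> edges n Q" and t: "turn ?V D g a b c d e f"
    and ad: "{a, d} \<notin> D" "D' = insert {a, d} (D - {{b, e}})"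
    using fl by (elim cflipE)
  note hex = turnD(1)[OF t] and be = turnD(2)[OF t] and cr = turnD(3,4)[OF t] and ed = turnD(5-10)[OF t]
  note O = cquads_edge[OF D(1)]
  have V: "a \<in> ?V" "b \<in> ?V" "d \<in> ?V" "e \<in> ?V" using O[OF ed(1)] O[OF ed(4)] by blast+
  have gQ: "g \<in> Q"
  proof (rule ccontr)
    assume "g \<notin> Q"
    then have "g \<in> sides ?V" using g unfolding edges_def by blast
    then obtain u u' where u: "g = {u, u'}" "\<forall>w\<in>?V. \<not> cyc u w u'" by (elim sides_verts_ofE)
    then show False using turn_not_at_side[OF t, of ?V u u'] V by blast
  qed
  obtain w z where wz: "g = {w, z}" "even w" "odd z"
    using subsetD[OF Q gQ] by (elim white_blackE)
  have "cyc (2 * a + 1) (2 * w) (2 * b + 1) \<or> cyc (2 * d + 1) (2 * w) (2 * e + 1)"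
    using hex cr unfolding wz(1) red_crosses_iff alternate_iff red_arc_iff unfolding hexagon_def cyc_def by (smt (verit))
  then show ?thesis
  proof
    assume "cyc (2 * a + 1) (2 * w) (2 * b + 1)"
    then show ?thesis using flip_if_turn[OF Q D _ ad] t gQ wz by simp
  next
    assume w: "cyc (2 * d + 1) (2 * w) (2 * e + 1)"
    have "hexagon d e f a b c" using hexagon_rotate[OF hexagon_rotate[OF hexagon_rotate[OF hex]]] .
    moreover have "{e, b} \<in> D" using be by (simp add: insert_commute)
    ultimately have "turn ?V D {w, z} d e f a b c"
      using cr ed unfolding turn_def wz(1) by simp
    moreover have "{d, a} \<notin> D" "D' = insert {d, a} (D - {{e, b}})"
      using ad by (simp_all add: insert_commute)
    ultimately show ?thesis using flip_if_turn[OF Q D, of w z d e f a b c] gQ wz w by simp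
  qed
qed

text \<open>
  Removing the diagonal \<open>{x, y}\<close> merges the two squares next to it, and \<open>j\<close> does not divide the hexagon.
\<close>

lemma hexagon_piece:
  assumes hex: "hexagon x a b y c d" and D: "D \<in> cquads (verts_of n) E" and xy: "{x, y} \<in> D"
    and S: "{x, a, b, y} \<in> gpieces (verts_of n) D" and T: "{y, c, d, x} \<in> gpieces (verts_of n) D"
    and j: "\<not> j \<subseteq> {x, a, b, y, c, d}"
  shows "{x, a, b, y, c, d} \<in> gpieces (verts_of n) (insert j (D - {{x, y}}))"
proof -
  let ?V = "verts_of n" and ?H = "{x, a, b, y, c, d}"
  let ?D' = "insert j (D - {{x, y}})"
  have quads: "quadrilateral x a b y" "quadrilateral y c d x" using hex unfolding hexagon_split by blast+
  note SD = gpiecesD[OF S, unfolded quadrilateral_sides[OF quads(1)]]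
    and TD = gpiecesD[OF T, unfolded quadrilateral_sides[OF quads(2)]]
  have ne: "x \<noteq> a" "x \<noteq> b" "x \<noteq> y" "a \<noteq> b" "a \<noteq> y" "b \<noteq> y" "x \<noteq> c" "x \<noteq> d" "c \<noteq> d" "c \<noteq> y" "d \<noteq> y"
    "a \<noteq> c" "a \<noteq> d" "b \<noteq> c" "b \<noteq> d"
    using hex unfolding hexagon_def cyc_def by (smt (verit))+
  have xyside: "{x, y} \<notin> sides ?V" using D xy unfolding cquads_def quad_def by blast
  have six: "sides ?H = {{x, a}, {a, b}, {b, y}, {y, c}, {c, d}, {d, x}}" by (rule hexagon_sides[OF hex])
  have edge: "e \<in> ?D' \<union> sides ?V \<longleftrightarrow> e \<in> D \<union> sides ?V \<and> e \<noteq> {x, y}" if "e \<subseteq> ?H" for e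
    using that j xyside by blast
  have across: "{u, v} \<notin> D \<union> sides ?V \<and> {u, v} \<notin> sides ?H" if "u \<in> {a, b}" "v \<in> {c, d}" for u v
  proof -
    have "crosses {x, y} {u, v}"
      using that hex unfolding hexagon_def crosses_iff cyc_def by (smt (verit) insertE emptyE)
    then have "{u, v} \<notin> D \<union> sides ?V" using cquads_edges_uncrossed[OF D, of "{x, y}" "{u, v}"] xy by blast
    moreover have "{u, v} \<notin> sides ?H" unfolding six using that ne by (auto simp: doubleton_eq_iff)
    ultimately show ?thesis by blast
  qed
  have "{u, v} \<in> ?D' \<union> sides ?V \<longleftrightarrow> {u, v} \<in> sides ?H" if uv: "u \<in> ?H" "v \<in> ?H" "u \<noteq> v" for u v
  proof -
    have sub: "{u, v} \<subseteq> ?H" using uv by blast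
    consider "u \<in> {x, a, b, y}" "v \<in> {x, a, b, y}" | "u \<in> {y, c, d, x}" "v \<in> {y, c, d, x}"
      | "u \<in> {a, b}" "v \<in> {c, d}" | "u \<in> {c, d}" "v \<in> {a, b}" using uv by blast
    then show ?thesis
    proof cases
      case 1
      then show ?thesis unfolding edge[OF sub] SD(3)[OF 1 uv(3)] six using ne by (auto simp: doubleton_eq_iff)
    next
      case 2
      then show ?thesis unfolding edge[OF sub] TD(3)[OF 2 uv(3)] six using ne by (auto simp: doubleton_eq_iff)
    next
      case 3
      then show ?thesis unfolding edge[OF sub] using across[of u v] by blast
    next
      case 4
      then show ?thesis unfolding edge[OF sub] unfolding insert_commute[of u v] using across[of v u] by blast
    qed
  qed
  moreover have "?H \<subseteq> ?V" using SD(1) TD(1) by blast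
  moreover have "3 \<le> card ?H" using hexagon_nxt(7)[OF hex] by simp
  ultimately show ?thesis unfolding gpieces_def by simp
qed

text \<open>
  The new diagonal \<open>j\<close> has to be a diagonal of the hexagon, since otherwise the hexagon would be a piece of
  the new quadrangulation. Of the two sides at \<open>x\<close> through which the long inner edge might enter, only
  \<open>{d, x}\<close> makes \<open>{x, y}\<close> compatible with it. The white end of \<open>j\<close> is then \<open>b\<close>, the even corner of the
  opposite side, and its other end cannot be a neighbour of \<open>b\<close>, as \<open>j\<close> would be an edge already.
\<close>

lemma cflip_if_hexagon:
  assumes Q: "Q \<subseteq> odd_chords (verts_of n)"
    and D: "D \<in> cquads (verts_of n) (edges n Q)" "D' \<in> cquads (verts_of n) (edges n Q)"
    and hex: "hexagon x a b y c d" and par: "even x" "odd y" and xy: "{x, y} \<in> D"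
    and S: "{x, a, b, y} \<in> gpieces (verts_of n) D" and T: "{y, c, d, x} \<in> gpieces (verts_of n) D"
    and j: "j \<notin> D" "D' = insert j (D - {{x, y}})"
    and long: "long_inner_edge n Q {x, a, b, y, c, d} \<sigma> \<tau> g" and ends: "x \<in> \<sigma>" "white_end j \<in> \<tau>"
  shows "cflip (verts_of n) (edges n Q) D D'"
proof -
  let ?V = "verts_of n" and ?H = "{x, a, b, y, c, d}"
  have quads: "quadrilateral x a b y" "quadrilateral y c d x" using hex unfolding hexagon_split by blast+
  note SD = gpiecesD[OF S, unfolded quadrilateral_sides[OF quads(1)]]
    and TD = gpiecesD[OF T, unfolded quadrilateral_sides[OF quads(2)]]
  have ne: "x \<noteq> a" "x \<noteq> b" "x \<noteq> y" "a \<noteq> b" "a \<noteq> y" "b \<noteq> y" "x \<noteq> c" "x \<noteq> d" "c \<noteq> d" "c \<noteq> y" "d \<noteq> y"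
    using hex unfolding hexagon_def cyc_def by (smt (verit))+
  have ed: "{x, a} \<in> D \<union> sides ?V" "{a, b} \<in> D \<union> sides ?V" "{b, y} \<in> D \<union> sides ?V"
    "{y, c} \<in> D \<union> sides ?V" "{c, d} \<in> D \<union> sides ?V" "{d, x} \<in> D \<union> sides ?V"
    using SD(3)[of x a] SD(3)[of a b] SD(3)[of b y] TD(3)[of y c] TD(3)[of c d] TD(3)[of d x] ne by simp_all
  note O = cquads_edge[OF D(1)]
  note Oe = O[OF ed(1)] O[OF ed(2)] O[OF ed(3)] O[OF ed(4)] O[OF ed(5)] O[OF ed(6)]
  have par': "odd a" "even b" "even c" "odd d" using Oe par by simp_all
  have gQ: "g \<in> Q" and opp: "opposite_sides ?H \<sigma> \<tau>" using long unfolding long_inner_edge_def by blast+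
  have gE: "g \<in> edges n Q" using gQ unfolding edges_def by blast
  obtain w z where g: "g = {w, z}" "w \<in> ?V" "z \<in> ?V" "even w" "odd z" "w \<noteq> z"
    using subsetD[OF Q gQ] by (elim white_blackE)
  obtain s t where st: "0 < s" "s < t" "t < 1"
    and s: "linepath (blue n w) (blue n z) s \<in> chord (red n) \<sigma>"
    and t: "linepath (blue n w) (blue n z) t \<in> chord (red n) \<tau>"
    using long unfolding long_inner_edge_def g(1) white_black[OF g(4,5)] by blast
  have st': "s < 1" "0 < t" using st by simp_all
  have enter: "red_crosses {h0, h1} g \<and> red_crosses {h3, h4} g \<and> cyc (2 * h0 + 1) (2 * w) (2 * h1 + 1)"
    if h: "hexagon h0 h1 h2 h3 h4 h5" "\<sigma> = {h0, h1}" "\<tau> = {h3, h4}" "{h0, h1, h3, h4} \<subseteq> ?V"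
    for h0 h1 h2 h3 h4 h5
  proof -
    have hh: "h0 \<noteq> h1" "h3 \<noteq> h4" "cyc h0 h1 h3" "cyc h0 h1 h4"
      using h(1) unfolding hexagon_def cyc_def by (smt (verit))+
    have "red_crosses {h0, h1} g" unfolding g(1)
      by (rule linepath_meets_red_crosses[OF _ hh(1) g(6) st(1) st'(1)]) (use h g s in auto)
    moreover have "red_crosses {h3, h4} g" unfolding g(1)
      by (rule linepath_meets_red_crosses[OF _ hh(2) g(6) st'(2) st(3)]) (use h g t in auto)
    moreover have "cyc (2 * h0 + 1) (2 * w) (2 * h1 + 1)"
      using entering_side[OF _ hh(3,4) g(6) st(1) st'(1) _ st'(2) st(3), of n] h(2-4) g(2,3) s t st(2) by simp
    ultimately show ?thesis by blast
  qed
  have V: "x \<in> ?V" "a \<in> ?V" "b \<in> ?V" "y \<in> ?V" "c \<in> ?V" "d \<in> ?V" using Oe by blast+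
  have hex': "hexagon d x a b y c" using hex unfolding hexagon_def cyc_def by (smt (verit))
  from opp consider "\<sigma> = {x, a}" "\<tau> = {y, c}" | "\<sigma> = {d, x}" "\<tau> = {b, y}"
    unfolding hexagon_opposite_sides[OF hex] using ends(1) ne by auto
  then show ?thesis
  proof cases
    case 1
    then have r: "red_crosses {x, a} g" "red_crosses {y, c} g" "cyc (2 * x + 1) (2 * w) (2 * a + 1)"
      using enter[OF hex] V by blast+
    then have "alternate x w y z" using crossing_order(2)[OF hex] unfolding g(1) by blast
    moreover have "red_compat {x, y} {w, z}" using D(1) xy gE unfolding cquads_def g(1) by blast
    ultimately have "odd (x + w)" by (rule red_compatD[rotated])
    then show ?thesis using par g(4) by simp
  next
    case 2
    then have r: "red_crosses {d, x} g" "red_crosses {b, y} g" using enter[OF hex'] V by blast+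
    have turn: "turn ?V D g d x a b y c"
      unfolding turn_def using hex' ed xy r by (simp add: insert_commute)
    have q': "quad ?V D'" using D(2) unfolding cquads_def by blast
    have jD': "j \<in> D'" unfolding j(2) by blast
    then have jo: "j \<in> odd_chords ?V" "j \<notin> sides ?V" using q' unfolding quad_def by blast+
    have jH: "j \<subseteq> ?H"
    proof (rule ccontr)
      assume "\<not> j \<subseteq> ?H"
      then have "?H \<in> gpieces ?V D'" unfolding j(2) by (rule hexagon_piece[OF hex D(1) xy S T])
      then have "card ?H = 4" using q' unfolding quad_def by blast
      then show False using hexagon_nxt(7)[OF hex] by simp
    qed
    obtain u v where uv: "j = {u, v}" "even u" "odd v" using jo(1) by (elim white_blackE)
    have "u \<in> {b, y}" using ends(2) 2(2) unfolding uv(1) white_black[OF uv(2,3)] by simp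
    then have ub: "u = b" using uv(2) par(2) by auto
    have "v \<in> ?H" using jH uv(1) by blast
    then have "v = a \<or> v = y \<or> v = d" using uv(3) par par' by auto
    moreover have "v \<noteq> a" "v \<noteq> y" using ed(2,3) j(1) jo(2) uv(1) ub by (auto simp: insert_commute)
    ultimately have jdb: "j = {d, b}" using uv(1) ub by (simp add: insert_commute)
    show ?thesis
      by (rule cflipI[OF D turn gE]) (use j in \<open>simp_all add: jdb\<close>)
  qed
qed

lemma cflip_if_flip:
  assumes Q: "Q \<subseteq> odd_chords (verts_of n)" and fl: "flip n Q D D'"
  shows "cflip (verts_of n) (edges n Q) D D'"
proof -
  let ?V = "verts_of n"
  note fl' = fl[unfolded flip_def compatible_quadrangulations_eq[OF Q]]
  have D: "D \<in> cquads ?V (edges n Q)" "D' \<in> cquads ?V (edges n Q)"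
    using fl'[THEN conjunct1] fl'[THEN conjunct2, THEN conjunct1] .
  obtain i j S T H \<sigma> \<tau> g where long: "long_inner_edge n Q H \<sigma> \<tau> g" and H: "H = S \<union> T"
    and j: "j \<notin> D" "D' = insert j (D - {i})" and i: "i \<in> D" and ends: "white_end i \<in> \<sigma>" "white_end j \<in> \<tau>"
    and ST: "S \<noteq> T" "i \<subseteq> S" "i \<subseteq> T" and S: "S \<in> pieces n D" and T: "T \<in> pieces n D"
    using fl'[THEN conjunct2, THEN conjunct2] by (elim conjE exE) (rule that)
  have SP: "S \<in> gpieces ?V D" and TP: "T \<in> gpieces ?V D" using S T unfolding pieces_eq .
  have q: "quad ?V D" using D(1) unfolding cquads_def by blast
  then have card: "card S = 4" "card T = 4" using SP TP unfolding quad_def by blast+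
  then have fin: "finite S" "finite T" using card_ge_0_finite by force+
  have "i \<in> odd_chords ?V" using q i unfolding quad_def by blast
  then obtain x y where xy: "i = {x, y}" "even x" "odd y" "x \<noteq> y" by (elim white_blackE)
  have wx: "white_end i = x" unfolding xy(1) by (rule white_black[OF xy(2,3)])
  have "{x, y} \<in> D \<union> sides ?V" using i xy(1) by blast
  then have side: "{x, y} \<in> sides S" "{x, y} \<in> sides T"
    using gpiecesD(3)[OF SP, of x y] gpiecesD(3)[OF TP, of x y] ST(2,3) xy(1,4) by simp_all
  have core: "cflip ?V (edges n Q) D D'"
    if P: "P \<in> gpieces ?V D" "R \<in> gpieces ?V D" "H = P \<union> R"
      and PR: "P = {x, a, b, y}" "quadrilateral x a b y" "R = {y, c, d, x}" "quadrilateral y c d x" for P R a b c d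
  proof (rule cflip_if_hexagon[OF Q D _ xy(2,3) _ _ _ j(1)])
    show "hexagon x a b y c d" using PR hexagon_split by blast
    show "{x, y} \<in> D" "D' = insert j (D - {{x, y}})" using i j(2) xy(1) by simp_all
    show "{x, a, b, y} \<in> gpieces ?V D" "{y, c, d, x} \<in> gpieces ?V D" using P PR by simp_all
    have "H = {x, a, b, y, c, d}" unfolding P(3) PR by blast
    then show "long_inner_edge n Q {x, a, b, y, c, d} \<sigma> \<tau> g" using long by simp
    show "x \<in> \<sigma>" "white_end j \<in> \<tau>" using ends wx by simp_all
  qed
  have nc: "\<not> crosses e f" if "e \<in> D \<union> sides ?V" "f \<in> D \<union> sides ?V" for e f
    by (rule cquads_edges_uncrossed[OF D(1) that])
  show ?thesis
  proof (rule square_along_side[OF fin(1) card(1) side(1) xy(4)];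
      rule square_along_side[OF fin(2) card(2) side(2) xy(4)])
    fix a b c d
    assume S': "S = {x, a, b, y}" "quadrilateral x a b y" and T': "T = {x, c, d, y}" "quadrilateral x c d y"
    have "a = c \<and> b = d"
      by (rule squares_on_same_arc[OF SP[unfolded S'(1)] S'(2) TP[unfolded T'(1)] T'(2) nc])
    then show ?thesis using ST(1) S'(1) T'(1) by simp
  next
    fix a b c d
    assume "S = {x, a, b, y}" "quadrilateral x a b y" "T = {y, c, d, x}" "quadrilateral y c d x"
    then show ?thesis using core[OF SP TP H] by blast
  next
    fix a b c d
    assume "S = {y, a, b, x}" "quadrilateral y a b x" "T = {x, c, d, y}" "quadrilateral x c d y"
    then show ?thesis using core[OF TP SP H[unfolded Un_commute[of S T]]] by blast
  next
    fix a b c d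
    assume S': "S = {y, a, b, x}" "quadrilateral y a b x" and T': "T = {y, c, d, x}" "quadrilateral y c d x"
    have "a = c \<and> b = d"
      by (rule squares_on_same_arc[OF SP[unfolded S'(1)] S'(2) TP[unfolded T'(1)] T'(2) nc])
    then show ?thesis using ST(1) S'(1) T'(1) by simp
  qed
qed

lemma flip_graph_eq:
  assumes "Q \<subseteq> odd_chords (verts_of n)"
  shows "pverts (flip_graph n Q) = cquads (verts_of n) (edges n Q)"
    "parcs (flip_graph n Q) = {(D, D'). cflip (verts_of n) (edges n Q) D D'}"
  unfolding flip_graph_def
  using compatible_quadrangulations_eq[OF assms] cflip_if_flip[OF assms] flip_if_cflip[OF assms] by auto

section \<open>Renumbering the vertices\<close>

text \<open>
  An increasing renumbering preserves the cyclic order. It may change the parities, but only all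
  of them at once.
\<close>

locale relabelling =
  fixes W :: "nat set" and \<phi> :: "nat \<Rightarrow> nat"
  assumes fin: "finite W"
    and mono: "\<And>a b. a \<in> W \<Longrightarrow> b \<in> W \<Longrightarrow> a < b \<Longrightarrow> \<phi> a < \<phi> b"
    and par: "\<And>a b. a \<in> W \<Longrightarrow> b \<in> W \<Longrightarrow> odd (\<phi> a + \<phi> b) \<longleftrightarrow> odd (a + b)"
begin

lemma less_iff: "a \<in> W \<Longrightarrow> b \<in> W \<Longrightarrow> \<phi> a < \<phi> b \<longleftrightarrow> a < b"
  using mono[of a b] mono[of b a] by (cases a b rule: linorder_cases) auto

lemma eq_iff: "a \<in> W \<Longrightarrow> b \<in> W \<Longrightarrow> \<phi> a = \<phi> b \<longleftrightarrow> a = b"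
  using less_iff[of a b] less_iff[of b a] by auto

lemma inj: "inj_on \<phi> W"
  using eq_iff by (auto intro: inj_onI)

lemma cyc_iff: "a \<in> W \<Longrightarrow> b \<in> W \<Longrightarrow> c \<in> W \<Longrightarrow> cyc (\<phi> a) (\<phi> b) (\<phi> c) \<longleftrightarrow> cyc a b c"
  unfolding cyc_def by (simp add: less_iff)

lemma alternate_map:
  "a \<in> W \<Longrightarrow> b \<in> W \<Longrightarrow> c \<in> W \<Longrightarrow> d \<in> W \<Longrightarrow> alternate (\<phi> a) (\<phi> c) (\<phi> b) (\<phi> d) \<longleftrightarrow> alternate a c b d"
  unfolding alternate_iff by (simp add: cyc_iff eq_iff)

lemma sides_map:
  assumes "C \<subseteq> W" "a \<in> C" "b \<in> C" "a \<noteq> b"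
  shows "{\<phi> a, \<phi> b} \<in> sides (\<phi> ` C) \<longleftrightarrow> {a, b} \<in> sides C"
proof -
  have "finite C" using assms(1) fin by (rule finite_subset)
  moreover have "cyc (\<phi> a) (\<phi> w) (\<phi> b) \<longleftrightarrow> cyc a w b" "cyc (\<phi> b) (\<phi> w) (\<phi> a) \<longleftrightarrow> cyc b w a"
    if "w \<in> C" for w using cyc_iff that assms by blast+
  moreover have "\<phi> a \<noteq> \<phi> b" using eq_iff assms by blast
  ultimately show ?thesis using assms by (simp add: sides_iff)
qed

lemma sides_image_eq:
  assumes "2 \<le> card W"
  shows "sides (\<phi> ` W) = image \<phi> ` sides W"
proof
  have card: "card (\<phi> ` W) = card W" using inj by (rule card_image)
  show "sides (\<phi> ` W) \<subseteq> image \<phi> ` sides W"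
  proof
    fix e assume e: "e \<in> sides (\<phi> ` W)"
    have "2 \<le> card (\<phi> ` W)" "finite (\<phi> ` W)" using assms card fin by simp_all
    with e obtain a b where ab: "e = {a, b}" "a \<in> \<phi> ` W" "b \<in> \<phi> ` W" "a \<noteq> b" by (elim sidesE)
    then obtain x y where xy: "x \<in> W" "y \<in> W" "a = \<phi> x" "b = \<phi> y" by blast
    have "x \<noteq> y" using ab(4) xy by blast
    then have "{x, y} \<in> sides W" using sides_map[OF order_refl xy(1,2)] e unfolding ab(1) xy(3,4) by simp
    moreover have "e = \<phi> ` {x, y}" unfolding ab(1) xy(3,4) by simp
    ultimately show "e \<in> image \<phi> ` sides W" by blast
  qed
  show "image \<phi> ` sides W \<subseteq> sides (\<phi> ` W)"
  proof
    fix e' assume "e' \<in> image \<phi> ` sides W"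
    then obtain e where e: "e \<in> sides W" "e' = \<phi> ` e" by blast
    from e(1) assms fin obtain a b where ab: "e = {a, b}" "a \<in> W" "b \<in> W" "a \<noteq> b" by (elim sidesE)
    then show "e' \<in> sides (\<phi> ` W)" using sides_map[OF order_refl ab(2-4)] e by simp
  qed
qed

lemma chord_map:
  assumes "D \<subseteq> Pow W" "a \<in> W" "b \<in> W"
  shows "{\<phi> a, \<phi> b} \<in> image \<phi> ` D \<longleftrightarrow> {a, b} \<in> D"
proof
  assume "{\<phi> a, \<phi> b} \<in> image \<phi> ` D"
  then obtain e where e: "e \<in> D" "\<phi> ` {a, b} = \<phi> ` e" by auto
  then have "{a, b} = e" using inj_on_image_eq_iff[OF inj, of "{a, b}" e] assms by blast
  then show "{a, b} \<in> D" using e by simp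
next
  assume "{a, b} \<in> D"
  then have "\<phi> ` {a, b} \<in> image \<phi> ` D" by (rule imageI)
  then show "{\<phi> a, \<phi> b} \<in> image \<phi> ` D" by simp
qed

lemma edge_map:
  assumes "D \<subseteq> Pow W" "a \<in> W" "b \<in> W" "a \<noteq> b"
  shows "{\<phi> a, \<phi> b} \<in> image \<phi> ` D \<union> sides (\<phi> ` W) \<longleftrightarrow> {a, b} \<in> D \<union> sides W"
  using chord_map[OF assms(1-3)] sides_map[OF order_refl assms(2-4)] by blast

lemma red_compat_map:
  assumes "e \<in> odd_chords W" "f \<in> odd_chords W" "red_compat e f"
  shows "red_compat (\<phi> ` e) (\<phi> ` f)"
proof -
  obtain a b where ab: "e = {a, b}" "a \<in> W" "b \<in> W" using assms(1) by (elim odd_chordsE)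
  obtain c d where cd: "f = {c, d}" "c \<in> W" "d \<in> W" using assms(2) by (elim odd_chordsE)
  show ?thesis
    using assms(3) ab(2,3) cd(2,3)
    unfolding ab(1) cd(1) image_insert image_empty red_compat_pair_iff by (simp only: alternate_map par)
qed

lemma red_crosses_map:
  assumes "a \<in> W" "b \<in> W" "f \<in> odd_chords W" "red_crosses {a, b} f"
  shows "red_crosses {\<phi> a, \<phi> b} (\<phi> ` f)"
proof -
  obtain c d where cd: "f = {c, d}" "c \<in> W" "d \<in> W" using assms(3) by (elim odd_chordsE)
  show ?thesis
    using assms cd(2,3) unfolding cd(1) image_insert image_empty red_crosses_iff by (simp add: alternate_map)
qed

lemma odd_chords_Pow: "odd_chords W \<subseteq> Pow W"
  unfolding odd_chords_def by auto

lemma quad_Pow: "quad W D \<Longrightarrow> D \<subseteq> Pow W"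
  using odd_chords_Pow unfolding quad_def by blast

lemma cquads_Pow: "D \<in> cquads W E \<Longrightarrow> D \<subseteq> Pow W"
  unfolding cquads_def by (simp add: quad_Pow)

lemma quad_map:
  assumes q: "quad W D"
  shows "quad (\<phi> ` W) (image \<phi> ` D)"
proof -
  have DW: "D \<subseteq> Pow W" using quad_Pow[OF q] .
  have odd: "e \<in> odd_chords W" "e \<notin> sides W" if "e \<in> D" for e using q that unfolding quad_def by blast+
  have "\<phi> ` e \<in> odd_chords (\<phi> ` W) - sides (\<phi> ` W)" if e: "e \<in> D" for e
  proof -
    obtain a b where ab: "e = {a, b}" "a \<in> W" "b \<in> W" "odd (a + b)" "a \<noteq> b"
      using odd(1)[OF e] by (elim odd_chordsE)
    then have "{\<phi> a, \<phi> b} \<notin> sides (\<phi> ` W)" using sides_map[of W a b] odd(2)[OF e] by simp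
    then show ?thesis using ab par[of a b] by (simp add: odd_chords_iff)
  qed
  moreover have "\<not> crosses (\<phi> ` e) (\<phi> ` f)" if ef: "e \<in> D" "f \<in> D" for e f
  proof -
    obtain a b where ab: "e = {a, b}" "a \<in> W" "b \<in> W" using odd(1)[OF ef(1)] by (elim odd_chordsE)
    obtain c d where cd: "f = {c, d}" "c \<in> W" "d \<in> W" using odd(1)[OF ef(2)] by (elim odd_chordsE)
    have "\<not> crosses {a, b} {c, d}" using q ef ab cd unfolding quad_def by blast
    then show ?thesis
      using ab(2,3) cd(2,3) unfolding ab(1) cd(1) image_insert image_empty crosses_iff by (simp add: cyc_iff)
  qed
  moreover have "card C' = 4" if C': "C' \<in> gpieces (\<phi> ` W) (image \<phi> ` D)" for C'
  proof -
    note C'D = gpiecesD[OF C']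
    obtain C where C: "C \<subseteq> W" "C' = \<phi> ` C" using C'D(1) by (elim subset_imageE)
    have injC: "inj_on \<phi> C" using inj C(1) by (rule inj_on_subset)
    then have card: "card C' = card C" unfolding C(2) by (rule card_image)
    have "{i, j} \<in> D \<union> sides W \<longleftrightarrow> {i, j} \<in> sides C" if ij: "i \<in> C" "j \<in> C" "i \<noteq> j" for i j
    proof -
      have W: "i \<in> W" "j \<in> W" using ij C(1) by blast+
      have "\<phi> i \<in> C'" "\<phi> j \<in> C'" "\<phi> i \<noteq> \<phi> j" using ij C(2) eq_iff W by blast+
      then have "{\<phi> i, \<phi> j} \<in> image \<phi> ` D \<union> sides (\<phi> ` W) \<longleftrightarrow> {\<phi> i, \<phi> j} \<in> sides (\<phi> ` C)"
        using C'D(3) unfolding C(2) by blast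
      then show ?thesis using edge_map[OF DW W ij(3)] sides_map[OF C(1) ij] by blast
    qed
    then have "C \<in> gpieces W D" using C(1) C'D(2) card unfolding gpieces_def by simp
    then show ?thesis using q card unfolding quad_def by simp
  qed
  ultimately show ?thesis unfolding quad_def by blast
qed

lemma cquads_map:
  assumes "E \<subseteq> odd_chords W" "D \<in> cquads W E"
  shows "image \<phi> ` D \<in> cquads (\<phi> ` W) (image \<phi> ` E)"
proof -
  have q: "quad W D" and c: "\<And>e f. e \<in> D \<Longrightarrow> f \<in> E \<Longrightarrow> red_compat e f" using assms(2) unfolding cquads_def by blast+
  have "red_compat (\<phi> ` e) (\<phi> ` f)" if "e \<in> D" "f \<in> E" for e f
    by (rule red_compat_map) (use that assms(1) q c in \<open>auto simp: quad_def\<close>)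
  then show ?thesis using quad_map[OF q] unfolding cquads_def by blast
qed

lemma cflip_map:
  assumes E: "E \<subseteq> odd_chords W" and fl: "cflip W E D D'"
  shows "cflip (\<phi> ` W) (image \<phi> ` E) (image \<phi> ` D) (image \<phi> ` D')"
proof -
  have D: "D \<in> cquads W E" "D' \<in> cquads W E" using fl by (simp_all only: cflip_def)
  then have DW: "D \<subseteq> Pow W" "D' \<subseteq> Pow W" using quad_Pow unfolding cquads_def by simp_all
  obtain g a b c d e f where g: "g \<in> E" and t: "turn W D g a b c d e f"
    and ad: "{a, d} \<notin> D" "D' = insert {a, d} (D - {{b, e}})"
    using fl by (elim cflipE)
  note hex = turnD(1)[OF t] and be = turnD(2)[OF t] and cr = turnD(3,4)[OF t] and ed = turnD(5-10)[OF t]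
  have ne: "a \<noteq> b" "b \<noteq> c" "c \<noteq> d" "d \<noteq> e" "e \<noteq> f" "f \<noteq> a"
    using hex unfolding hexagon_def cyc_def by (smt (verit))+
  have mem: "x \<in> W \<and> y \<in> W" if "{x, y} \<in> D \<union> sides W" "x \<noteq> y" for x y
    using that(1)
  proof
    assume "{x, y} \<in> D"
    with DW(1) have "{x, y} \<in> Pow W" by (rule subsetD)
    then show ?thesis by simp
  qed (simp add: sides_iff[OF fin that(2)])
  have W: "a \<in> W" "b \<in> W" "c \<in> W" "d \<in> W" "e \<in> W" "f \<in> W"
    using mem[OF ed(1) ne(1)] mem[OF ed(3) ne(3)] mem[OF ed(5) ne(5)] by blast+
  have "hexagon (\<phi> a) (\<phi> b) (\<phi> c) (\<phi> d) (\<phi> e) (\<phi> f)"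
    using hex W unfolding hexagon_def by (simp add: cyc_iff)
  moreover have "{{\<phi> a, \<phi> b}, {\<phi> b, \<phi> c}, {\<phi> c, \<phi> d}, {\<phi> d, \<phi> e}, {\<phi> e, \<phi> f}, {\<phi> f, \<phi> a}}
      \<subseteq> image \<phi> ` D \<union> sides (\<phi> ` W)"
    unfolding insert_subset
    using edge_map[OF DW(1) W(1,2) ne(1)] edge_map[OF DW(1) W(2,3) ne(2)] edge_map[OF DW(1) W(3,4) ne(3)]
      edge_map[OF DW(1) W(4,5) ne(4)] edge_map[OF DW(1) W(5,6) ne(5)] edge_map[OF DW(1) W(6,1) ne(6)] ed
    by simp
  moreover have "{\<phi> b, \<phi> e} \<in> image \<phi> ` D" using chord_map[OF DW(1) W(2,5)] be by simp
  moreover have "red_crosses {\<phi> a, \<phi> b} (\<phi> ` g)" "red_crosses {\<phi> d, \<phi> e} (\<phi> ` g)"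
    using red_crosses_map W cr subsetD[OF E g] by blast+
  ultimately have "turn (\<phi> ` W) (image \<phi> ` D) (\<phi> ` g) (\<phi> a) (\<phi> b) (\<phi> c) (\<phi> d) (\<phi> e) (\<phi> f)"
    unfolding turn_def by blast
  moreover have "\<phi> ` g \<in> image \<phi> ` E" using g by (rule imageI)
  moreover have "{\<phi> a, \<phi> d} \<notin> image \<phi> ` D" using chord_map[OF DW(1) W(1,4)] ad(1) by simp
  moreover have "image \<phi> ` D' = insert {\<phi> a, \<phi> d} (image \<phi> ` D - {{\<phi> b, \<phi> e}})"
  proof -
    have "inj_on (image \<phi>) (Pow W)" by (rule inj_on_image_Pow) (rule inj)
    then have "image \<phi> ` (D - {{b, e}}) = image \<phi> ` D - image \<phi> ` {{b, e}}"
      by (rule inj_on_image_set_diff) (use DW be in auto)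
    then show ?thesis unfolding ad(2) by simp
  qed
  ultimately show ?thesis by (rule cflipI[OF cquads_map[OF E D(1)] cquads_map[OF E D(2)]])
qed

lemma inverse: "relabelling (\<phi> ` W) (inv_into W \<phi>)"
proof
  show "finite (\<phi> ` W)" using fin by simp
  fix a b assume "a \<in> \<phi> ` W" "b \<in> \<phi> ` W"
  then obtain x y where "a = \<phi> x" "b = \<phi> y" "x \<in> W" "y \<in> W" by blast
  then show "odd (inv_into W \<phi> a + inv_into W \<phi> b) \<longleftrightarrow> odd (a + b)"
    and "a < b \<Longrightarrow> inv_into W \<phi> a < inv_into W \<phi> b"
    using par[of x y] less_iff[of x y] inj by simp_all
qed

lemma inverse_images:
  assumes "D \<subseteq> Pow W"
  shows "image (inv_into W \<phi>) ` image \<phi> ` D = D"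
proof -
  have "inv_into W \<phi> ` \<phi> ` e = e" if "e \<in> D" for e
    using that assms inv_into_image_cancel[OF inj] by blast
  then show ?thesis by (simp add: image_image)
qed

lemma images_inverse:
  assumes "D \<subseteq> Pow (\<phi> ` W)"
  shows "image \<phi> ` image (inv_into W \<phi>) ` D = D"
proof -
  have "\<phi> ` inv_into W \<phi> ` e = e" if "e \<in> D" for e
    using that assms image_inv_into_cancel[of \<phi> W "\<phi> ` W" e] by blast
  then show ?thesis by (simp add: image_image)
qed

lemma odd_chords_map: "E \<subseteq> odd_chords W \<Longrightarrow> image \<phi> ` E \<subseteq> odd_chords (\<phi> ` W)"
proof
  fix e' assume E: "E \<subseteq> odd_chords W" "e' \<in> image \<phi> ` E"
  then obtain e where e: "e \<in> odd_chords W" "e' = \<phi> ` e" by blast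
  obtain a b where "e = {a, b}" "a \<in> W" "b \<in> W" "odd (a + b)" using e(1) by (elim odd_chordsE)
  then show "e' \<in> odd_chords (\<phi> ` W)" using par[of a b] unfolding e(2) by (simp add: odd_chords_iff)
qed

lemma cquads_bij:
  assumes E: "E \<subseteq> odd_chords W"
  shows "bij_betw (image (image \<phi>)) (cquads W E) (cquads (\<phi> ` W) (image \<phi> ` E))"
proof -
  interpret i: relabelling "\<phi> ` W" "inv_into W \<phi>" by (rule inverse)
  have inv: "inv_into W \<phi> ` \<phi> ` W = W" using inv_into_image_cancel[OF inj order_refl] .
  have E': "image (inv_into W \<phi>) ` image \<phi> ` E = E"
    by (rule inverse_images) (rule order_trans[OF E odd_chords_Pow])
  show ?thesis
  proof (rule bij_betw_byWitness[where f' = "image (image (inv_into W \<phi>))"])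
    show "\<forall>D\<in>cquads W E. image (inv_into W \<phi>) ` image \<phi> ` D = D"
      by (intro ballI inverse_images) (rule cquads_Pow)
    show "\<forall>D\<in>cquads (\<phi> ` W) (image \<phi> ` E). image \<phi> ` image (inv_into W \<phi>) ` D = D"
      by (intro ballI images_inverse) (rule i.cquads_Pow)
    show "image (image \<phi>) ` cquads W E \<subseteq> cquads (\<phi> ` W) (image \<phi> ` E)"
      by (intro image_subsetI cquads_map[OF E])
    show "image (image (inv_into W \<phi>)) ` cquads (\<phi> ` W) (image \<phi> ` E) \<subseteq> cquads W E"
      using i.cquads_map[OF odd_chords_map[OF E]] unfolding inv E' by (rule image_subsetI)
  qed
qed

lemma cflip_iff:
  assumes E: "E \<subseteq> odd_chords W" and D: "D \<in> cquads W E" "D' \<in> cquads W E"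
  shows "cflip (\<phi> ` W) (image \<phi> ` E) (image \<phi> ` D) (image \<phi> ` D') \<longleftrightarrow> cflip W E D D'"
proof
  interpret i: relabelling "\<phi> ` W" "inv_into W \<phi>" by (rule inverse)
  have inv: "inv_into W \<phi> ` \<phi> ` W = W" using inv_into_image_cancel[OF inj order_refl] .
  have Pow: "E \<subseteq> Pow W" "D \<subseteq> Pow W" "D' \<subseteq> Pow W"
    using order_trans[OF E odd_chords_Pow] D[THEN cquads_Pow] .
  assume "cflip (\<phi> ` W) (image \<phi> ` E) (image \<phi> ` D) (image \<phi> ` D')"
  from i.cflip_map[OF odd_chords_map[OF E] this] show "cflip W E D D'"
    unfolding inv Pow[THEN inverse_images] .
qed (rule cflip_map[OF E])

end

text \<open>
  Removing the vertices strictly between two vertices of different colours removes an even number of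
  consecutive vertices. The numbers in the remaining polygon differ from the old ones by even numbers, or all by
  the same number.
\<close>

lemma renumber_relabelling:
  assumes ab: "a \<in> verts_of n" "b \<in> verts_of n" "odd (a + b)"
  defines "W \<equiv> {v \<in> verts_of n. \<not> cyc a v b}"
  shows "relabelling W (renumber W)" "renumber W ` W = verts_of (card W div 2 - 1)"
proof -
  have fin: "finite W" unfolding W_def by (simp add: verts_of_def)
  have mono: "renumber W x < renumber W y" if "x \<in> W" "y \<in> W" "x < y" for x y
    unfolding renumber_def by (rule psubset_card_mono) (use that fin in auto)
  have "\<exists>r. even (card W) \<and> 2 \<le> card W \<and> (\<forall>v\<in>W. even (renumber W v + v + r))"
  proof (cases "a < b")
    case True
    have W: "W = {..a} \<union> {b..<2 * n + 2}"
      unfolding W_def using True ab by (auto simp: cyc_def verts_of_def)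
    have "card W = (a + 1) + (2 * n + 2 - b)"
      unfolding W using True by (subst card_Un_disjoint) auto
    moreover have "even (renumber W v + v)" if v: "v \<in> W" for v
    proof (cases "v \<le> a")
      case True': True
      then have "{u \<in> W. u < v} = {..<v}" unfolding W by auto
      then show ?thesis unfolding renumber_def by simp
    next
      case False
      then have "b \<le> v" using v unfolding W by auto
      then have "{u \<in> W. u < v} = {..a} \<union> {b..<v}" using v True unfolding W by auto
      then have "renumber W v = card ({..a} \<union> {b..<v})" unfolding renumber_def by (rule arg_cong)
      also have "\<dots> = card {..a} + card {b..<v}" using True by (intro card_Un_disjoint) auto
      finally have "renumber W v = (a + 1) + (v - b)" by simp
      then show ?thesis using ab(3) \<open>b \<le> v\<close> by presburger
    qed
    moreover have "b < 2 * n + 2" using ab by (simp add: verts_of_def)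
    moreover from this True ab(3) have "even ((a + 1) + (2 * n + 2 - b))" by presburger
    ultimately show ?thesis by (intro exI[of _ 0]) simp
  next
    case False
    then have "b < a" using ab(3) by (metis even_add linorder_neqE_nat)
    then have W: "W = {b..a}"
      unfolding W_def using ab by (auto simp: cyc_def verts_of_def)
    have "even (renumber W v + v + b)" if v: "v \<in> W" for v
    proof -
      have "{u \<in> W. u < v} = {b..<v}" using v unfolding W by auto
      then have "renumber W v = v - b" unfolding renumber_def by simp
      moreover have "b \<le> v" using v unfolding W by simp
      ultimately show ?thesis by presburger
    qed
    moreover have "card W = a + 1 - b" unfolding W by simp
    moreover have "even (a + 1 - b)" using \<open>b < a\<close> ab(3) by presburger
    ultimately show ?thesis using \<open>b < a\<close> by (intro exI[of _ b]) simp
  qed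
  then obtain r where card: "even (card W)" "2 \<le> card W" and r: "\<forall>v\<in>W. even (renumber W v + v + r)"
    by auto
  show rel: "relabelling W (renumber W)"
  proof
    fix x y assume "x \<in> W" "y \<in> W"
    then have "even (renumber W x + x + r)" "even (renumber W y + y + r)" using r by blast+
    then show "odd (renumber W x + renumber W y) \<longleftrightarrow> odd (x + y)" by presburger
  qed (use fin mono in auto)
  then interpret relabelling W "renumber W" .
  have "renumber W ` W = {..<card W}"
  proof (rule card_subset_eq)
    have "renumber W v < card W" if "v \<in> W" for v
      unfolding renumber_def by (rule psubset_card_mono) (use that fin in auto)
    then show "renumber W ` W \<subseteq> {..<card W}" by blast
    show "card (renumber W ` W) = card {..<card W}" using card_image[OF inj] by simp
  qed simp
  moreover have "2 * (card W div 2 - 1) + 2 = card W" using card by auto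
  ultimately show "renumber W ` W = verts_of (card W div 2 - 1)" unfolding verts_of_def by simp
qed

section \<open>The product decomposition\<close>

lemma digraph_isoI:
  assumes verts: "bij_betw F (pverts G) (pverts H)"
    and arcs: "\<And>u v. u \<in> pverts G \<Longrightarrow> v \<in> pverts G \<Longrightarrow> (u, v) \<in> parcs G \<longleftrightarrow> (F u, F v) \<in> parcs H"
    and wf: "parcs G \<subseteq> pverts G \<times> pverts G" "parcs H \<subseteq> pverts H \<times> pverts H"
  shows "digraph_iso (with_proj G) (with_proj H)"
proof -
  let ?h = "\<lparr>iso_verts = F, iso_arcs = map_prod F F, iso_head = snd, iso_tail = fst\<rparr>"
  have inj: "inj_on F (pverts G)" and im: "F ` pverts G = pverts H"
    using verts by (simp_all add: bij_betw_def)
  have "wf_digraph (with_proj G)" by unfold_locales (use wf(1) in auto)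
  moreover have "inj_on (map_prod F F) (parcs G)"
    using map_prod_inj_on[OF inj inj] wf(1) by (rule inj_on_subset)
  ultimately have iso: "pre_digraph.digraph_isomorphism (with_proj G) ?h"
    unfolding pre_digraph.digraph_isomorphism_def using inj by simp
  have "map_prod F F ` parcs G = parcs H"
  proof
    show "map_prod F F ` parcs G \<subseteq> parcs H" using arcs wf(1) by auto
    show "parcs H \<subseteq> map_prod F F ` parcs G"
    proof
      fix a assume a: "a \<in> parcs H"
      then obtain u v where uv: "u \<in> pverts G" "v \<in> pverts G" "a = (F u, F v)"
        using wf(2) unfolding im[symmetric] by auto
      then have "(u, v) \<in> parcs G" using arcs a by simp
      then show "a \<in> map_prod F F ` parcs G" unfolding uv(3) by force
    qed
  qed
  then have "with_proj H = app_iso ?h (with_proj G)"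
    unfolding app_iso_def with_proj_def using im by simp
  with iso show ?thesis unfolding digraph_iso_def by blast
qed

context bridged
begin

lemma side_chords: "{p, p'} \<in> sides V" "{q, q'} \<in> sides V"
  using adj mem distinct finV by (simp_all add: sides_iff)

text \<open>
  Cutting at \<open>{q', p}\<close> turns this edge from an inner edge into a boundary edge, without changing the set of
  all edges that belong to the part.
\<close>

lemma E1_eq:
  assumes E: "E = Q \<union> sides V"
  shows "E1 = {f \<in> Q. f \<subseteq> W1 \<and> f \<noteq> {q', p}} \<union> sides W1"
proof
  show "E1 \<subseteq> {f \<in> Q. f \<subseteq> W1 \<and> f \<noteq> {q', p}} \<union> sides W1"
  proof
    fix f assume f: "f \<in> E1"
    show "f \<in> {f \<in> Q. f \<subseteq> W1 \<and> f \<noteq> {q', p}} \<union> sides W1"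
    proof (cases "f \<in> Q")
      case True
      then show ?thesis using f far_sides(1) unfolding insert_commute[of p q'] by blast
    next
      case False
      then have s: "f \<in> sides V" "f \<subseteq> W1" "f \<in> odd_chords V" using f E EV by blast+
      then obtain x y where xy: "f = {x, y}" "x \<noteq> y" by (elim odd_chordsE)
      have "f \<in> sides W1"
        using sides_split[OF s(1)]
      proof
        assume "f \<subseteq> I1"
        then show ?thesis using sides_I1[of x y] xy s(1) by simp
      next
        assume "f \<subseteq> I2"
        then show ?thesis using far_edge[OF s(3,2)] far_sides by metis
      qed
      then show ?thesis by blast
    qed
  qed
  show "{f \<in> Q. f \<subseteq> W1 \<and> f \<noteq> {q', p}} \<union> sides W1 \<subseteq> E1"
  proof
    fix f assume "f \<in> {f \<in> Q. f \<subseteq> W1 \<and> f \<noteq> {q', p}} \<union> sides W1"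
    then show "f \<in> E1"
    proof
      assume s: "f \<in> sides W1"
      then show ?thesis
      proof (rule sides_W1_cases)
        fix x y assume xy: "f = {x, y}" "x \<in> I1" "y \<in> I1" "x \<noteq> y"
        then show ?thesis using sides_I1[OF xy(2-4)] s E I1_sub(2) by auto
      next
        assume "f = {p, q'} \<or> f = {q, q'}"
        moreover have "{p, q'} \<in> E" "{q, q'} \<in> E"
          using inner(2) side_chords(2) E by (auto simp: insert_commute)
        moreover have "p \<in> W1" "q \<in> W1" "q' \<in> W1" using pq_I1 W1_eq by auto
        ultimately show ?thesis by auto
      qed
    qed (use E in blast)
  qed
qed

lemma W1_not_cyc: "W1 = {v \<in> V. \<not> cyc q' v p}"
proof -
  have "(v = p \<or> v = q' \<or> cyc p v q') \<longleftrightarrow> \<not> cyc q' v p" for v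
    using distinct(2) unfolding cyc_def by (smt (verit))
  then show ?thesis unfolding arc_def by blast
qed

lemma parts_bij:
  "bij_betw (\<lambda>D. (D \<inter> Pow I1, D \<inter> Pow I2)) (cquads V E) (cquads W1 E1 \<times> cquads W2 E2)"
proof (rule bij_betw_byWitness[where f' = "\<lambda>(U, U'). U \<union> U'"])
  show "\<forall>D\<in>cquads V E. (case (D \<inter> Pow I1, D \<inter> Pow I2) of (U, U') \<Rightarrow> U \<union> U') = D"
    using cquads_parts by auto
  show "\<forall>P\<in>cquads W1 E1 \<times> cquads W2 E2. ((case P of (U, U') \<Rightarrow> U \<union> U') \<inter> Pow I1, (case P of (U, U') \<Rightarrow> U \<union> U') \<inter> Pow I2) = P"
  proof
    fix P assume "P \<in> cquads W1 E1 \<times> cquads W2 E2"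
    then obtain U U' where P: "P = (U, U')" and U: "U \<in> cquads W1 E1" "U' \<in> cquads W2 E2" by (elim SigmaE)
    show "((case P of (U, U') \<Rightarrow> U \<union> U') \<inter> Pow I1, (case P of (U, U') \<Rightarrow> U \<union> U') \<inter> Pow I2) = P"
      unfolding P prod.case join(2,3)[OF U] ..
  qed
  show "(\<lambda>D. (D \<inter> Pow I1, D \<inter> Pow I2)) ` cquads V E \<subseteq> cquads W1 E1 \<times> cquads W2 E2"
    by (intro image_subsetI SigmaI restrict restrict2)
  show "(\<lambda>(U, U'). U \<union> U') ` (cquads W1 E1 \<times> cquads W2 E2) \<subseteq> cquads V E"
    by (clarsimp simp only: join(1))
qed

end

lemma kept_verts_eq:
  assumes ab: "a \<in> verts_of n" "b \<in> verts_of n" "a \<noteq> b" and s: "s \<subseteq> verts_of n"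
    and cut: "\<And>v. v \<in> s \<Longrightarrow> \<not> cyc a v b" and c: "c \<in> s" "cyc b c a"
  shows "kept_verts n s {a, b} = {v \<in> verts_of n. \<not> cyc a v b}"
proof (cases "a < b")
  case True
  then have "c \<notin> {a..b}" using c(2) unfolding cyc_def by auto
  then have "\<not> s \<subseteq> {a..b}" using c(1) by blast
  moreover have "Min {a, b} = a" "Max {a, b} = b" using True by simp_all
  ultimately show ?thesis unfolding kept_verts_def using True by (auto simp: cyc_def)
next
  case False
  then have "b < a" using ab(3) by simp
  then have "s \<subseteq> {b..a}" using cut unfolding cyc_def by force
  moreover have "Min {a, b} = b" "Max {a, b} = a" using \<open>b < a\<close> by simp_all
  ultimately show ?thesis
    unfolding kept_verts_def using \<open>b < a\<close> ab by (auto simp: cyc_def verts_of_def)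
qed

text \<open>
  The flip graph of the part, with the vertices renumbered from 0, in terms of the original numbers.
\<close>

lemma kept_graph:
  fixes n Q s
  assumes br: "bridged (verts_of n) (edges n Q) p p' q q'"
    and s: "s = {p, p', q, q'}" and Q: "Q \<subseteq> odd_chords (verts_of n)"
  defines "V \<equiv> verts_of n" and "E \<equiv> edges n Q"
  defines "W \<equiv> arc V p q'"
  defines "F \<equiv> {f \<in> E. f \<subseteq> W}"
  defines "G \<equiv> flip_graph (kept_size n s {q', p}) (kept_part n Q s {q', p})"
  obtains \<phi> where "bij_betw (image (image \<phi>)) (cquads W F) (pverts G)"
    "\<And>D D'. D \<in> cquads W F \<Longrightarrow> D' \<in> cquads W F \<Longrightarrow>
      (image \<phi> ` D, image \<phi> ` D') \<in> parcs G \<longleftrightarrow> cflip W F D D'"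
proof -
  interpret bridged V E p p' q q' using br unfolding V_def E_def .
  let ?e = "{q', p}" and ?m = "kept_size n s {q', p}"
  let ?K = "{f \<in> Q. f \<subseteq> W \<and> f \<noteq> ?e}"
  have W_not: "W = {v \<in> V. \<not> cyc q' v p}" unfolding W_def by (rule W1_not_cyc)
  have kept: "kept_verts n s ?e = W"
    unfolding W_not V_def
  proof (rule kept_verts_eq)
    show "q' \<in> verts_of n" "p \<in> verts_of n" "s \<subseteq> verts_of n" "p' \<in> s" "q' \<noteq> p"
      using mem distinct unfolding V_def s by auto
    show "cyc p p' q'" using distinct(7) cyc_rotate by blast
    fix v assume "v \<in> s"
    then show "\<not> cyc q' v p" using around distinct(7) unfolding s cyc_def by (smt (verit) insertE emptyE)
  qed
  define \<phi> where "\<phi> = renumber W"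
  have "odd (q' + p)" using inner(2) EV odd_chords_iff by blast
  then have rel: "relabelling W (renumber W)" "renumber W ` W = verts_of (card W div 2 - 1)"
    using renumber_relabelling[of q' n p] mem unfolding W_not V_def by simp_all
  interpret relabelling W \<phi> unfolding \<phi>_def by (rule rel)
  have m: "?m = card W div 2 - 1" unfolding kept_size_def kept ..
  then have W': "verts_of ?m = \<phi> ` W" using rel(2) unfolding \<phi>_def by simp
  have F: "F = ?K \<union> sides W" using E1_eq[of Q] unfolding F_def W_def E_def V_def edges_def by simp
  have Fodd: "F \<subseteq> odd_chords W"
  proof
    fix f assume f: "f \<in> F"
    then have "f \<in> odd_chords V" "f \<subseteq> W" using EV unfolding F_def by blast+
    then show "f \<in> odd_chords W" by (elim odd_chordsE) (simp add: odd_chords_iff)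
  qed
  have part: "kept_part n Q s ?e = image \<phi> ` ?K" unfolding kept_part_def kept \<phi>_def ..
  have "card {p, q'} \<le> card W" using mem distinct fin unfolding W_def arc_def by (intro card_mono) auto
  then have card2: "2 \<le> card W" using distinct by simp
  have edges: "edges ?m (kept_part n Q s ?e) = image \<phi> ` F"
    unfolding edges_def part W' sides_image_eq[OF card2] F image_Un ..
  have odd: "kept_part n Q s ?e \<subseteq> odd_chords (verts_of ?m)"
  proof -
    have "image \<phi> ` F \<subseteq> odd_chords (verts_of ?m)" unfolding W' by (rule odd_chords_map[OF Fodd])
    then show ?thesis unfolding part F by blast
  qed
  note G = flip_graph_eq[OF odd, unfolded edges W', folded G_def]
  show thesis
  proof (rule that)
    show "bij_betw (image (image \<phi>)) (cquads W F) (pverts G)" unfolding G by (rule cquads_bij[OF Fodd])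
    show "(image \<phi> ` D, image \<phi> ` D') \<in> parcs G \<longleftrightarrow> cflip W F D D'"
      if "D \<in> cquads W F" "D' \<in> cquads W F" for D D'
      unfolding G using cflip_iff[OF Fodd that] by simp
  qed
qed

text \<open>
  No edge crosses \<open>{p', q}\<close> or \<open>{q', p}\<close>. So an edge with ends on both of the arcs that these cut off joins
  two vertices of the bridge, and as these have different colours, it is a boundary edge of the bridge.
\<close>

lemma bridge_bridged:
  assumes quad: "quadrangulation n Q" and br: "bridge n Q s"
    and inner: "{e \<in> Q. e \<subseteq> s} = {e\<^sub>1, e\<^sub>2}"
  obtains p p' q q' where "bridged (verts_of n) (edges n Q) p p' q q'" "s = {p, p', q, q'}"
    "e\<^sub>1 = {q', p}" "e\<^sub>2 = {p', q}"
proof -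
  let ?V = "verts_of n"
  obtain f\<^sub>1 f\<^sub>2 where s: "s \<in> pieces n Q" and f: "opposite_sides s f\<^sub>1 f\<^sub>2" "f\<^sub>1 \<in> Q" "f\<^sub>2 \<in> Q"
    using br unfolding bridge_def by blast
  have P: "s \<in> gpieces ?V Q" using s unfolding pieces_eq .
  have q: "quad ?V Q" using quad unfolding quadrangulation_iff .
  have card: "card s = 4" using quad s unfolding quadrangulation_def by blast
  then have fin: "finite s" using card_ge_0_finite by force
  have f1: "f\<^sub>1 \<in> sides s" and f2: "f\<^sub>2 = (nxt s ^^ 2) ` f\<^sub>1"
    using f(1) unfolding opposite_sides_def card by simp_all
  have "2 \<le> card s" using card by simp
  then obtain x y where xy: "f\<^sub>1 = {x, y}" "x \<in> s" "y \<in> s" "x \<noteq> y"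
    using f1 fin by (elim sidesE)
  have "\<exists>k u v l. s = {k, u, v, l} \<and> quadrilateral k u v l \<and> f\<^sub>1 = {l, k}"
  proof (rule square_along_side[OF fin card _ xy(4)])
    show "{x, y} \<in> sides s" using f1 xy(1) by simp
  next
    fix a b assume "s = {x, a, b, y}" "quadrilateral x a b y"
    then show ?thesis using xy(1) by (metis insert_commute)
  next
    fix a b assume "s = {y, a, b, x}" "quadrilateral y a b x"
    then show ?thesis using xy(1) by blast
  qed
  then obtain k u v l where kl: "s = {k, u, v, l}" "quadrilateral k u v l" "f\<^sub>1 = {l, k}" by blast
  note nx = quadrilateral_nxt[OF kl(2), folded kl(1)]
  have f2': "f\<^sub>2 = {u, v}" unfolding f2 kl(3) by (simp add: numeral_2_eq_2 nx)
  have ne: "k \<noteq> u" "k \<noteq> v" "k \<noteq> l" "u \<noteq> v" "u \<noteq> l" "v \<noteq> l"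
    using kl(2) unfolding quadrilateral_def cyc_def by (smt (verit))+
  have ff: "f\<^sub>1 \<noteq> f\<^sub>2" unfolding f2' kl(3) using ne by (auto simp: doubleton_eq_iff)
  have "f\<^sub>1 \<subseteq> s" "f\<^sub>2 \<subseteq> s" unfolding f2' kl(3) unfolding kl(1) by blast+
  then have "f\<^sub>1 \<in> {e \<in> Q. e \<subseteq> s}" "f\<^sub>2 \<in> {e \<in> Q. e \<subseteq> s}" using f(2,3) by simp_all
  then have "f\<^sub>1 \<in> {e\<^sub>1, e\<^sub>2}" "f\<^sub>2 \<in> {e\<^sub>1, e\<^sub>2}" unfolding inner .
  then have "f\<^sub>1 = e\<^sub>1 \<or> f\<^sub>1 = e\<^sub>2" "f\<^sub>2 = e\<^sub>1 \<or> f\<^sub>2 = e\<^sub>2" by simp_all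
  with ff have "e\<^sub>1 = f\<^sub>1 \<and> e\<^sub>2 = f\<^sub>2 \<or> e\<^sub>1 = f\<^sub>2 \<and> e\<^sub>2 = f\<^sub>1" by metis
  then consider "e\<^sub>1 = f\<^sub>1" "e\<^sub>2 = f\<^sub>2" | "e\<^sub>1 = f\<^sub>2" "e\<^sub>2 = f\<^sub>1" by (elim disjE conjE)
  then have "\<exists>p p' q q'. quadrilateral p p' q q' \<and> s = {p, p', q, q'} \<and> e\<^sub>1 = {q', p} \<and> e\<^sub>2 = {p', q}"
  proof cases
    case 1
    then show ?thesis using kl f2' by (intro exI[of _ k] exI[of _ u] exI[of _ v] exI[of _ l]) simp
  next
    case 2
    have "quadrilateral v l k u" using kl(2) unfolding quadrilateral_def cyc_def by (smt (verit))
    moreover have "s = {v, l, k, u}" using kl(1) by blast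
    ultimately show ?thesis using 2 kl(3) f2'
      by (intro exI[of _ v] exI[of _ l] exI[of _ k] exI[of _ u]) simp
  qed
  then obtain p p' q q' where pq: "quadrilateral p p' q q'" "s = {p, p', q, q'}" "e\<^sub>1 = {q', p}" "e\<^sub>2 = {p', q}"
    by blast
  have ne: "p \<noteq> p'" "p \<noteq> q" "p \<noteq> q'" "p' \<noteq> q" "p' \<noteq> q'" "q \<noteq> q'"
    using pq(1) unfolding quadrilateral_def cyc_def by (smt (verit))+
  have around: "cyc p p' q" "cyc p' q q'" "cyc q q' p" "cyc p' q p" "cyc q' p q"
    using pq(1) unfolding quadrilateral_def cyc_def by (smt (verit))+
  have ps: "p \<in> s" "p' \<in> s" "q \<in> s" "q' \<in> s" unfolding pq(2) by simp_all
  have V: "p \<in> ?V" "p' \<in> ?V" "q \<in> ?V" "q' \<in> ?V" using gpiecesD(1)[OF P] ps by blast+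
  have "e\<^sub>1 \<in> {e \<in> Q. e \<subseteq> s}" "e\<^sub>2 \<in> {e \<in> Q. e \<subseteq> s}" unfolding inner by simp_all
  then have e12: "e\<^sub>1 \<in> Q" "e\<^sub>2 \<in> Q" by simp_all
  have ss: "sides s = {{p, p'}, {p', q}, {q, q'}, {q', p}}" unfolding pq(2) by (rule quadrilateral_sides[OF pq(1)])
  have "{p, p'} \<in> Q \<union> sides ?V" "{q, q'} \<in> Q \<union> sides ?V"
    using gpiecesD(3)[OF P ps(1,2) ne(1)] gpiecesD(3)[OF P ps(3,4) ne(6)] ss by simp_all
  moreover have "{p, p'} \<notin> Q" "{q, q'} \<notin> Q"
  proof -
    have "{p, p'} \<notin> {e\<^sub>1, e\<^sub>2}" "{q, q'} \<notin> {e\<^sub>1, e\<^sub>2}"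
      unfolding pq(3,4) using ne by (auto simp: doubleton_eq_iff)
    then show "{p, p'} \<notin> Q" "{q, q'} \<notin> Q" unfolding inner[symmetric] using ps by simp_all
  qed
  ultimately have bd: "{p, p'} \<in> sides ?V" "{q, q'} \<in> sides ?V" by blast+
  have adj: "\<not> cyc p w p'" "\<not> cyc q w q'" if "w \<in> ?V" for w
    using bd that V around(4,5) by (auto simp: sides_iff[OF finite_verts_of ne(1)] sides_iff[OF finite_verts_of ne(6)])
  have par: "odd (p + p')" "odd (q + q')"
    using subsetD[OF sides_odd bd(1)] subsetD[OF sides_odd bd(2)] by (simp_all add: odd_chords_iff)
  have EV: "edges n Q \<subseteq> odd_chords ?V" using q sides_odd unfolding quad_def edges_def by blast
  have inner': "{p', q} \<in> edges n Q" "{q', p} \<in> edges n Q" using e12 pq(3,4) unfolding edges_def by blast+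
  have "bridged ?V (edges n Q) p p' q q'"
  proof
    show "f \<subseteq> arc ?V p' q \<or> f \<subseteq> arc ?V q' p \<or> f = {p, p'} \<or> f = {q, q'}" if f: "f \<in> edges n Q" for f
    proof -
      obtain x y where xy: "f = {x, y}" "x \<in> ?V" "y \<in> ?V" "odd (x + y)"
        using subsetD[OF EV f] by (elim odd_chordsE)
      have nc: "\<not> crosses {x, y} e" if "e \<in> Q" for e
      proof (cases "f \<in> Q")
        case True
        then show ?thesis using q that xy(1) unfolding quad_def by blast
      next
        case False
        then have "f \<in> sides ?V" using f unfolding edges_def by blast
        moreover have "e \<subseteq> ?V" using q that unfolding quad_def by (blast elim: odd_chordsE)
        ultimately show ?thesis using sides_uncrossed(1) xy(1) by blast
      qed
      have "odd (p' + q)" "odd (q' + p)"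
        using subsetD[OF EV inner'(1)] subsetD[OF EV inner'(2)] by (simp_all add: odd_chords_iff)
      then have par': "even (p + q)" "even (p' + q')" using par by presburger+
      have loc: "(w = p' \<or> w = q \<or> cyc p' w q) \<or> (w = q' \<or> w = p \<or> cyc q' w p)" if "w \<in> ?V" for w
        using adj[OF that] around ne unfolding cyc_def by (smt (verit))
      have nc': "\<not> crosses {x, y} {p', q}" "\<not> crosses {x, y} {q', p}" using nc e12 pq(3,4) by simp_all
      have mixed: "{a, b} = {p, p'} \<or> {a, b} = {q, q'}"
        if "a = p' \<or> a = q \<or> cyc p' a q" "b = q' \<or> b = p \<or> cyc q' b p" "odd (a + b)"
          "\<not> crosses {a, b} {p', q}" "\<not> crosses {a, b} {q', p}" for a b
      proof -
        have "(a = p' \<or> a = q) \<and> (b = q' \<or> b = p)"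
          using that(1,2,4,5) around ne unfolding crosses_iff cyc_def by (smt (verit))
        then show ?thesis using that(3) par' by (auto simp: add.commute)
      qed
      have comm: "{y, x} = {x, y}" "odd (y + x)" using xy(4) by (auto simp: add.commute)
      have "({x, y} \<subseteq> arc ?V p' q \<or> {x, y} \<subseteq> arc ?V q' p) \<or> {x, y} = {p, p'} \<or> {x, y} = {q, q'}"
        using loc[OF xy(2)] loc[OF xy(3)] mixed[OF _ _ xy(4) nc'] mixed[of y x, unfolded comm(1), OF _ _ comm(2) nc']
          xy(2,3) unfolding arc_def by blast
      then show ?thesis unfolding xy(1) by blast
    qed
  qed (rule finite_verts_of EV V around(1-3) par inner' | rule adj, assumption)+
  then show thesis using pq(2-4) by (rule that)
qed

theorem proposition2p2:
  fixes n :: nat and Q :: "nat set set" and s e\<^sub>1 e\<^sub>2 :: "nat set"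
  assumes "1 \<le> n" and "quadrangulation n Q" and "bridge n Q s"
    and inner_edges_of_s: "{e \<in> Q. e \<subseteq> s} = {e\<^sub>1, e\<^sub>2}"
  shows "digraph_iso
     (with_proj (flip_graph n Q))
     (with_proj (cartesian_product
        (flip_graph (kept_size n s e\<^sub>1) (kept_part n Q s e\<^sub>1))
        (flip_graph (kept_size n s e\<^sub>2) (kept_part n Q s e\<^sub>2))))"
proof -
  obtain p p' q q' where br: "bridged (verts_of n) (edges n Q) p p' q q'" and s: "s = {p, p', q, q'}"
    and e: "e\<^sub>1 = {q', p}" "e\<^sub>2 = {p', q}"
    by (rule bridge_bridged[OF assms(2,3) inner_edges_of_s])
  let ?V = "verts_of n" and ?E = "edges n Q"
  interpret bridged ?V ?E p p' q q' by (rule br)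
  have Q: "Q \<subseteq> odd_chords ?V" using assms(2) unfolding quadrangulation_iff quad_def by blast
  let ?G = "flip_graph n Q"
  let ?G1 = "flip_graph (kept_size n s e\<^sub>1) (kept_part n Q s e\<^sub>1)"
  let ?G2 = "flip_graph (kept_size n s e\<^sub>2) (kept_part n Q s e\<^sub>2)"
  have s': "s = {q, q', p, p'}" using s by blast
  obtain \<phi> where \<phi>: "bij_betw (image (image \<phi>)) (cquads W1 E1) (pverts ?G1)"
    "\<And>D D'. D \<in> cquads W1 E1 \<Longrightarrow> D' \<in> cquads W1 E1 \<Longrightarrow>
      (image \<phi> ` D, image \<phi> ` D') \<in> parcs ?G1 \<longleftrightarrow> cflip W1 E1 D D'"
    using kept_graph[OF br s Q] unfolding e(1) by blast
  obtain \<psi> where \<psi>: "bij_betw (image (image \<psi>)) (cquads W2 E2) (pverts ?G2)"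
    "\<And>D D'. D \<in> cquads W2 E2 \<Longrightarrow> D' \<in> cquads W2 E2 \<Longrightarrow>
      (image \<psi> ` D, image \<psi> ` D') \<in> parcs ?G2 \<longleftrightarrow> cflip W2 E2 D D'"
    using kept_graph[OF swapped s' Q] unfolding e(2) by blast
  define R where "R D = (D \<inter> Pow I1, D \<inter> Pow I2)" for D
  define M where "M = map_prod (image (image \<phi>)) (image (image \<psi>))"
  have bijM: "bij_betw M (cquads W1 E1 \<times> cquads W2 E2) (pverts ?G1 \<times> pverts ?G2)"
    unfolding M_def using \<phi>(1) \<psi>(1) by (rule bij_betw_map_prod)
  have bijR: "bij_betw R (cquads ?V ?E) (cquads W1 E1 \<times> cquads W2 E2)" unfolding R_def[abs_def] by (rule parts_bij)
  have G: "pverts ?G = cquads ?V ?E" "parcs ?G = {(D, D'). cflip ?V ?E D D'}" using flip_graph_eq[OF Q] .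
  have wf_flip: "parcs (flip_graph m K) \<subseteq> pverts (flip_graph m K) \<times> pverts (flip_graph m K)" for m K
    unfolding flip_graph_def flip_def by auto
  show ?thesis
  proof (rule digraph_isoI[where F = "M \<circ> R"])
    show "bij_betw (M \<circ> R) (pverts ?G) (pverts (cartesian_product ?G1 ?G2))"
      unfolding G cartesian_product_def using bij_betw_trans[OF bijR bijM] by simp
    show "parcs ?G \<subseteq> pverts ?G \<times> pverts ?G" by (rule wf_flip)
    show "parcs (cartesian_product ?G1 ?G2) \<subseteq>
        pverts (cartesian_product ?G1 ?G2) \<times> pverts (cartesian_product ?G1 ?G2)"
      using wf_flip unfolding cartesian_product_def by auto
    fix D D' assume "D \<in> pverts ?G" "D' \<in> pverts ?G"
    then have D: "D \<in> cquads ?V ?E" "D' \<in> cquads ?V ?E" unfolding G .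
    note parts = restrict[OF D(1)] restrict[OF D(2)] restrict2[OF D(1)] restrict2[OF D(2)]
    have inj: "image \<phi> ` (D \<inter> Pow I1) = image \<phi> ` (D' \<inter> Pow I1) \<longleftrightarrow> D \<inter> Pow I1 = D' \<inter> Pow I1"
      "image \<psi> ` (D \<inter> Pow I2) = image \<psi> ` (D' \<inter> Pow I2) \<longleftrightarrow> D \<inter> Pow I2 = D' \<inter> Pow I2"
      using inj_on_eq_iff[OF bij_betw_imp_inj_on[OF \<phi>(1)] parts(1,2)]
        inj_on_eq_iff[OF bij_betw_imp_inj_on[OF \<psi>(1)] parts(3,4)] .
    have mem: "image \<phi> ` (D \<inter> Pow I1) \<in> pverts ?G1" "image \<psi> ` (D \<inter> Pow I2) \<in> pverts ?G2"
      using bij_betwE[OF \<phi>(1)] bij_betwE[OF \<psi>(1)] parts by blast+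
    have prod: "((u, v), (u', v')) \<in> parcs (cartesian_product ?G1 ?G2) \<longleftrightarrow>
        (u, u') \<in> parcs ?G1 \<and> v = v' \<or> (v, v') \<in> parcs ?G2 \<and> u = u'"
      if "u \<in> pverts ?G1" "v \<in> pverts ?G2" for u v u' v'
      unfolding cartesian_product_def using that by auto
    show "(D, D') \<in> parcs ?G \<longleftrightarrow> ((M \<circ> R) D, (M \<circ> R) D') \<in> parcs (cartesian_product ?G1 ?G2)"
      unfolding comp_def M_def R_def map_prod_simp prod[OF mem] inj
        \<phi>(2)[OF parts(1,2)] \<psi>(2)[OF parts(3,4)] G(2)
      using flip_split[OF D] by simp
  qed
qed

end
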